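(* Consider the problem of minimizing $P=P_1-P_2$ over $C\cap\mathscr{F}$. Suppose that Assumptions A and B (stated in the context) hold, and that the function $$H(x,y,z):=\frac{P(x)-\bar m}{\hat\theta}+\max_{i=1,\ldots,m}[{\rm lin}_{g_i}(x,z)]_+ +\frac{L_g}{2}\|x-y\|^2+\frac{L_g}{2}\|x-z\|^2+\delta_C(x)$$ is a KL function, where $\bar m:=\inf\{P(x):x\in C\}$ and $\hat\theta$ is the eventual constant value of $\{\theta_k\}$ (see the context). Let $\{(x^k,y^k)\}$ be generated by Algorithm ESQM$_{\rm e}$ (described in the context) and let $\Omega$ be the set of accumulation points of $\{(x^{k+1},x^k,y^k)\}$. Then $\{x^k\}$ converges to a critical point $\bar x$ of the problem. Moreover, if $H$ satisfies the KL property with exponent $\alpha\in[0,1)$ at every point in $\Omega$, then there exists $\underline N\in\mathbb{N}$ such that the following statements hold. (i) If $\alpha=0$, then $\{x^k\}$ converges finitely, i.e., $x^k=\bar x$ for all $k>\underline N$. (ii) If $\alpha\in(0,\frac12]$, then there exist $a_0\in(0,1)$ and $a_1>0$ such that $\|x^k-\bar x\|\le a_1a_0^k$ for all $k>\underline N$. (iii) If $\alpha\in(\frac12,1)$, then there exists $a_2>0$ such that $\|x^k-\bar x\|\le a_2k^{-\frac{1-\alpha}{2\alpha-1}}$ for all $k>\underline N$.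
   Context: Problem. $P_1,P_2:\mathbb{R}^n\to\mathbb{R}$ are convex functions and $P:=P_1-P_2$; $g_1,\ldots,g_m:\mathbb{R}^n\to\mathbb{R}$ are differentiable with Lipschitz continuous gradients; $C\subseteq\mathbb{R}^n$ is a nonempty compact convex set; $\mathscr{F}:=\{x\in\mathbb{R}^n:g_i(x)\le 0,\ i=1,\ldots,m\}$ and $C\cap\mathscr{F}\ne\emptyset$. The problem is $\min\{P(x):x\in C\cap\mathscr{F}\}$. Constants. For each $i$ write $g_i=g_i^1-g_i^2$ with $g_i^1,g_i^2$ convex with Lipschitz continuous gradients; $L_{g_i}>0$ is a Lipschitz modulus of $\nabla g_i^1$, $\ell_{g_i}\ge 0$ is a Lipschitz modulus of $\nabla g_i^2$, and $L_{g_i}\ge\ell_{g_i}$. Set $L_g:=\max_{i=1,\ldots,m}L_{g_i}$ and $\ell_g:=\max_{i=1,\ldots,m}\ell_{g_i}$. Notation. $[t]_+:=\max\{t,0\}$ for $t\in\mathbb{R}$; $\|\cdot\|$ is the Euclidean norm; ${\rm lin}_{g_i}(u,w):=g_i(w)+\langle\nabla g_i(w),u-w\rangle$ for $i=1,\ldots,m$; $\delta_C$ is the indicator function of $C$ ($0$ on $C$, $\infty$ off $C$); $\mathcal{N}_C(x)$ is the normal cone of $C$ at $x\in C$; ${\rm dist}(x,D)$ is the Euclidean distance from $x$ to $D$; sums of sets are Minkowski sums. For a proper closed (i.e. lower semicontinuous) $f:\mathbb{R}^p\to(-\infty,+\infty]$ and $w\in{\rm dom}\,f$, the regular subdifferential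 is $\widehat\partial f(w):=\{\xi:\liminf_{v\to w,v\ne w}\frac{f(v)-f(w)-\langle\xi,v-w\rangle}{\|v-w\|}\ge 0\}$ and the (limiting) subdifferential is $\partial f(w):=\{\xi:\exists\,w^k\to w,\ f(w^k)\to f(w),\ \xi^k\to\xi,\ \xi^k\in\widehat\partial f(w^k)\ \forall k\}$; $\partial f(w)=\emptyset$ if $w\notin{\rm dom}\,f$; ${\rm dom}\,\partial f:=\{w:\partial f(w)\ne\emptyset\}$. For convex $f$, $\partial f$ is the usual convex subdifferential. Algorithm ESQM$_{\rm e}$. Choose $x^{-1}=x^0\in C$, $\theta_0>0$, $d>0$ and $\{\beta_k\}\subseteq\left[0,\sqrt{\frac{L_g}{L_g+\ell_g}}\right)$ with $\bar\beta:=\sup_k\beta_k<\sqrt{\frac{L_g}{L_g+\ell_g}}$. For $k=0,1,2,\ldots$: (1) set $y^k=x^k+\beta_k(x^k-x^{k-1})$; (2) take any $\xi^k\in\partial P_2(x^k)$ and let $(x^{k+1},s^{k+1})$ be a minimizer over $(x,s)\in C\times\mathbb{R}_+$ of $P_1(x)-\langle\xi^k,x\rangle+\theta_k s+\frac{\theta_kL_g}{2}\|x-y^k\|^2$ subject to ${\rm lin}_{g_i}(x,y^k)\le s$ for $i=1,\ldots,m$; (3) if ${\rm lin}_{g_i}(x^{k+1},y^k)\le 0$ for all $i=1,\ldots,m$, set $\theta_{k+1}=\theta_k$; otherwise set $\theta_{k+1}=\theta_k+d$. Assumption A. For every $x\in C\cap\mathscr{F}$, the condition $RCQ(x)$ holds: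 there exists $y\in C$ such that $g_i(x)+\langle\nabla g_i(x),y-x\rangle<0$ for all $i=1,\ldots,m$. Moreover, for every $x\in C\setminus\mathscr{F}$ there do not exist $u_i$, $i\in I(x)$, such that $u_i\ge 0$ for all $i\in I(x)$, $\sum_{i\in I(x)}u_i=1$ and $\left\langle\sum_{i\in I(x)}u_i\nabla g_i(x),z-x\right\rangle\ge 0$ for all $z\in C$, where $I(x):=\{\iota\in\{1,\ldots,m\}:g_\iota(x)=\max_{i=1,\ldots,m}[g_i(x)]_+\}$. Critical point. $x$ is a critical point of the problem if $x\in C$ and there exists $\lambda\in\mathbb{R}_+^m$ such that $g_i(x)\le 0$ and $\lambda_ig_i(x)=0$ for all $i=1,\ldots,m$, and $0\in\partial P_1(x)-\partial P_2(x)+\sum_{i=1}^m\lambda_i\nabla g_i(x)+\mathcal{N}_C(x)$. Let $\mathcal{X}$ be the set of critical points. Assumption B. Each $g_i$ is twice continuously differentiable. The function $P_2$ is continuously differentiable on an open set $U_0$ containing $\mathcal{X}$, and $\nabla P_2$ is locally Lipschitz continuous on $U_0$. Eventual penalty parameter. Under Assumption A there exists $N_0\in\mathbb{N}$ such that $\theta_k=\theta_{N_0}$ for all $k\ge N_0$; set $\hat\theta:=\theta_{N_0}$. KL property. A proper closed function $f$ satisfies the KL property at $\bar w\in{\rm dom}\,\partial f$ if there exist $r\in(0,\infty]$, a neighborhood $U$ of $\bar w$, and a continuous concave function $\phi:[0,r)\to\mathbb{R}_+$ with $\phi(0)=0$ such that $\phi$ is continuously differentiable on $(0,r)$ with $\phi'>0$,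 and $\phi'(f(w)-f(\bar w))\,{\rm dist}(0,\partial f(w))\ge 1$ for all $w\in U$ with $f(\bar w)<f(w)<f(\bar w)+r$. If moreover $\phi$ can be chosen as $\phi(\varsigma)=\rho\varsigma^{1-\alpha}$ for some $\rho>0$ and $\alpha\in[0,1)$, $f$ satisfies the KL property with exponent $\alpha$ at $\bar w$. A proper closed $f$ satisfying the KL property at every point of ${\rm dom}\,\partial f$ is called a KL function. *)

theory Defs
  imports "HOL-Analysis.Analysis"
begin

section \<open>Variational analysis\<close>

text \<open>Extended-valued functions take values in \<^typ>\<open>ereal\<close>.\<close>

definition proper_fun :: "('a \<Rightarrow> ereal) \<Rightarrow> bool" where
  "proper_fun f \<longleftrightarrow> (\<forall>w. f w \<noteq> -\<infinity>) \<and> (\<exists>w. f w \<noteq> \<infinity>)"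

definition closed_fun :: "('a::topological_space \<Rightarrow> ereal) \<Rightarrow> bool" where
  "closed_fun f \<longleftrightarrow> (\<forall>w. f w \<le> Liminf (at w) f)"

text \<open>The filter \<^term>\<open>at w\<close> already excludes the point \<^term>\<open>w\<close> itself.\<close>

definition regular_subdiff :: "('a::euclidean_space \<Rightarrow> ereal) \<Rightarrow> 'a \<Rightarrow> 'a set" where
  "regular_subdiff f w =
     {\<xi>. \<bar>f w\<bar> \<noteq> \<infinity> \<and>
          0 \<le> Liminf (at w) (\<lambda>v. (f v - f w - ereal (\<xi> \<bullet> (v - w))) / ereal (norm (v - w)))}"

definition limiting_subdiff :: "('a::euclidean_space \<Rightarrow> ereal) \<Rightarrow> 'a \<Rightarrow> 'a set" where
  "limiting_subdiff f w =
     {\<xi>. \<bar>f w\<bar> \<noteq> \<infinity> \<and>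
          (\<exists>W \<Xi>. W \<longlonglongrightarrow> w \<and> (\<lambda>k. f (W k)) \<longlonglongrightarrow> f w \<and> \<Xi> \<longlonglongrightarrow> \<xi> \<and>
                 (\<forall>k::nat. \<Xi> k \<in> regular_subdiff f (W k)))}"

definition dom_subdiff :: "('a::euclidean_space \<Rightarrow> ereal) \<Rightarrow> 'a set" where
  "dom_subdiff f = {w. limiting_subdiff f w \<noteq> {}}"

definition convex_subdiff :: "('a::real_inner \<Rightarrow> real) \<Rightarrow> 'a \<Rightarrow> 'a set" where
  "convex_subdiff f x = {\<xi>. \<forall>u. f x + \<xi> \<bullet> (u - x) \<le> f u}"

definition normal_cone :: "'a::real_inner set \<Rightarrow> 'a \<Rightarrow> 'a set" where
  "normal_cone C x = {v. x \<in> C \<and> (\<forall>z\<in>C. v \<bullet> (z - x) \<le> 0)}"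

text \<open>Unlike \<^const>\<open>infdist\<close>, which is \<open>0\<close> for the empty set, this distance to the
  empty set is \<open>\<infinity>\<close>.\<close>

definition edist_set :: "'a::metric_space \<Rightarrow> 'a set \<Rightarrow> ereal" where
  "edist_set x D = (INF \<xi>\<in>D. ereal (dist x \<xi>))"


section \<open>The Kurdyka--Lojasiewicz property\<close>

definition desingularizes ::
    "('a::euclidean_space \<Rightarrow> ereal) \<Rightarrow> 'a \<Rightarrow> ereal \<Rightarrow> 'a set \<Rightarrow> (real \<Rightarrow> real) \<Rightarrow> bool" where
  "desingularizes f wbar r U \<phi> \<longleftrightarrow>
     0 < r \<and> open U \<and> wbar \<in> U \<and>
     \<phi> 0 = 0 \<and>
     (\<forall>t. 0 \<le> t \<and> ereal t < r \<longrightarrow> 0 \<le> \<phi> t) \<and>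
     continuous_on {t. 0 \<le> t \<and> ereal t < r} \<phi> \<and>
     concave_on {t. 0 \<le> t \<and> ereal t < r} \<phi> \<and>
     (\<forall>t. 0 < t \<and> ereal t < r \<longrightarrow> \<phi> differentiable (at t) \<and> 0 < deriv \<phi> t) \<and>
     continuous_on {t. 0 < t \<and> ereal t < r} (deriv \<phi>) \<and>
     (\<forall>w\<in>U. f wbar < f w \<and> f w < f wbar + r \<longrightarrow>
        1 \<le> ereal (deriv \<phi> (real_of_ereal (f w - f wbar))) * edist_set 0 (limiting_subdiff f w))"

definition KL_at :: "('a::euclidean_space \<Rightarrow> ereal) \<Rightarrow> 'a \<Rightarrow> bool" where
  "KL_at f wbar \<longleftrightarrow> wbar \<in> dom_subdiff f \<and> (\<exists>r U \<phi>. desingularizes f wbar r U \<phi>)"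

definition KL_exponent_at :: "('a::euclidean_space \<Rightarrow> ereal) \<Rightarrow> real \<Rightarrow> 'a \<Rightarrow> bool" where
  "KL_exponent_at f \<alpha> wbar \<longleftrightarrow>
     0 \<le> \<alpha> \<and> \<alpha> < 1 \<and> wbar \<in> dom_subdiff f \<and>
     (\<exists>r U \<rho>. 0 < \<rho> \<and> desingularizes f wbar r U (\<lambda>t. \<rho> * t powr (1 - \<alpha>)))"

definition KL_function :: "('a::euclidean_space \<Rightarrow> ereal) \<Rightarrow> bool" where
  "KL_function f \<longleftrightarrow> proper_fun f \<and> closed_fun f \<and> (\<forall>w\<in>dom_subdiff f. KL_at f w)"


section \<open>Gradients and smoothness\<close>

definition grad :: "('a::real_inner \<Rightarrow> real) \<Rightarrow> 'a \<Rightarrow> 'a" where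
  "grad f x = (THE D. GDERIV f x :> D)"

definition lipschitz_gradient :: "real \<Rightarrow> ('a::real_inner \<Rightarrow> real) \<Rightarrow> bool" where
  "lipschitz_gradient K f \<longleftrightarrow> (\<forall>x. f differentiable (at x)) \<and> K-lipschitz_on UNIV (grad f)"

definition C1_on :: "'a::real_normed_vector set \<Rightarrow> ('a \<Rightarrow> 'b::real_normed_vector) \<Rightarrow> bool" where
  "C1_on U F \<longleftrightarrow>
     (\<exists>F'. (\<forall>x\<in>U. (F has_derivative blinfun_apply (F' x)) (at x)) \<and> continuous_on U F')"

definition twice_cont_diff :: "('a::real_inner \<Rightarrow> real) \<Rightarrow> bool" where
  "twice_cont_diff f \<longleftrightarrow> (\<forall>x. f differentiable (at x)) \<and> C1_on UNIV (grad f)"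

definition locally_lipschitz_on :: "'a::metric_space set \<Rightarrow> ('a \<Rightarrow> 'b::metric_space) \<Rightarrow> bool" where
  "locally_lipschitz_on U F \<longleftrightarrow> (\<forall>x\<in>U. \<exists>e>0. \<exists>K. K-lipschitz_on (ball x e \<inter> U) F)"

definition lin :: "('a::real_inner \<Rightarrow> real) \<Rightarrow> 'a \<Rightarrow> 'a \<Rightarrow> real" where
  "lin f u w = f w + grad f w \<bullet> (u - w)"


section \<open>The problem\<close>

text \<open>The constraint functions are indexed by an arbitrary finite (nonempty) type
  \<^typ>\<open>'m::finite\<close>, which plays the role of the index set \<open>{1, ..., m}\<close>, \<open>m \<ge> 1\<close>.\<close>

definition feasible :: "('m \<Rightarrow> 'a \<Rightarrow> real) \<Rightarrow> 'a set" where
  "feasible g = {x. \<forall>i. g i x \<le> 0}"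

definition RCQ :: "('m \<Rightarrow> 'a::real_inner \<Rightarrow> real) \<Rightarrow> 'a set \<Rightarrow> 'a \<Rightarrow> bool" where
  "RCQ g C x \<longleftrightarrow> (\<exists>y\<in>C. \<forall>i. g i x + grad (g i) x \<bullet> (y - x) < 0)"

definition active :: "('m::finite \<Rightarrow> 'a \<Rightarrow> real) \<Rightarrow> 'a \<Rightarrow> 'm set" where
  "active g x = {j. g j x = (MAX i. max (g i x) 0)}"

definition assumption_A :: "('m::finite \<Rightarrow> 'a::real_inner \<Rightarrow> real) \<Rightarrow> 'a set \<Rightarrow> bool" where
  "assumption_A g C \<longleftrightarrow>
     (\<forall>x \<in> C \<inter> feasible g. RCQ g C x) \<and>
     (\<forall>x \<in> C - feasible g.
        \<not> (\<exists>u :: 'm \<Rightarrow> real.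
              (\<forall>i\<in>active g x. 0 \<le> u i) \<and> (\<Sum>i\<in>active g x. u i) = 1 \<and>
              (\<forall>z\<in>C. 0 \<le> (\<Sum>i\<in>active g x. u i *\<^sub>R grad (g i) x) \<bullet> (z - x))))"

definition critical_points ::
    "('a::real_inner \<Rightarrow> real) \<Rightarrow> ('a \<Rightarrow> real) \<Rightarrow> ('m::finite \<Rightarrow> 'a \<Rightarrow> real) \<Rightarrow> 'a set \<Rightarrow> 'a set" where
  "critical_points P1 P2 g C =
     {x \<in> C. \<exists>lam :: 'm \<Rightarrow> real.
        (\<forall>i. 0 \<le> lam i \<and> g i x \<le> 0 \<and> lam i * g i x = 0) \<and>
        (\<exists>\<xi>1 \<in> convex_subdiff P1 x. \<exists>\<xi>2 \<in> convex_subdiff P2 x. \<exists>\<nu> \<in> normal_cone C x.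
           0 = \<xi>1 - \<xi>2 + (\<Sum>i\<in>UNIV. lam i *\<^sub>R grad (g i) x) + \<nu>)}"

definition assumption_B ::
    "('a::real_inner \<Rightarrow> real) \<Rightarrow> ('a \<Rightarrow> real) \<Rightarrow> ('m::finite \<Rightarrow> 'a \<Rightarrow> real) \<Rightarrow> 'a set \<Rightarrow> bool" where
  "assumption_B P1 P2 g C \<longleftrightarrow>
     (\<forall>i. twice_cont_diff (g i)) \<and>
     (\<exists>U0. open U0 \<and> critical_points P1 P2 g C \<subseteq> U0 \<and>
           C1_on U0 P2 \<and> locally_lipschitz_on U0 (grad P2))"


section \<open>The algorithm and its potential function\<close>

text \<open>Since natural-number subtraction truncates, \<^term>\<open>x (k - 1)\<close> is \<^term>\<open>x 0\<close> for
  \<^term>\<open>k = (0::nat)\<close>; this encodes the initialization \<open>x\<^sup>-\<^sup>1 = x\<^sup>0\<close>.  The value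
  \<^term>\<open>s 0\<close> is irrelevant.\<close>

definition ESQMe ::
    "('a::real_inner \<Rightarrow> real) \<Rightarrow> ('a \<Rightarrow> real) \<Rightarrow> ('m::finite \<Rightarrow> 'a \<Rightarrow> real) \<Rightarrow> 'a set \<Rightarrow>
     real \<Rightarrow> real \<Rightarrow> real \<Rightarrow> (nat \<Rightarrow> real) \<Rightarrow>
     (nat \<Rightarrow> 'a) \<Rightarrow> (nat \<Rightarrow> 'a) \<Rightarrow> (nat \<Rightarrow> 'a) \<Rightarrow> (nat \<Rightarrow> real) \<Rightarrow> (nat \<Rightarrow> real) \<Rightarrow> bool" where
  "ESQMe P1 P2 g C Lg lg d \<beta> x y \<xi> s \<theta> \<longleftrightarrow>
     x 0 \<in> C \<and> 0 < \<theta> 0 \<and> 0 < d \<and>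
     (\<forall>k. \<beta> k \<in> {0..<sqrt (Lg / (Lg + lg))}) \<and> (SUP k. \<beta> k) < sqrt (Lg / (Lg + lg)) \<and>
     (\<forall>k. y k = x k + \<beta> k *\<^sub>R (x k - x (k - 1)) \<and>
          \<xi> k \<in> convex_subdiff P2 (x k) \<and>
          is_arg_min
            (\<lambda>(u, t). P1 u - \<xi> k \<bullet> u + \<theta> k * t + \<theta> k * Lg / 2 * (norm (u - y k))\<^sup>2)
            (\<lambda>(u, t). u \<in> C \<and> 0 \<le> t \<and> (\<forall>i. lin (g i) u (y k) \<le> t))
            (x (Suc k), s (Suc k)) \<and>
          \<theta> (Suc k) = (if \<forall>i. lin (g i) (x (Suc k)) (y k) \<le> 0 then \<theta> k else \<theta> k + d))"

text \<open>The value at which an eventually constant sequence settles.\<close>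

definition eventual_value :: "(nat \<Rightarrow> 'a) \<Rightarrow> 'a" where
  "eventual_value \<theta> = (THE t. \<exists>N. \<forall>k\<ge>N. \<theta> k = t)"

definition indicator_fun :: "'a set \<Rightarrow> 'a \<Rightarrow> ereal" where
  "indicator_fun C x = (if x \<in> C then 0 else \<infinity>)"

definition potential_H ::
    "('a::real_inner \<Rightarrow> real) \<Rightarrow> ('m::finite \<Rightarrow> 'a \<Rightarrow> real) \<Rightarrow> 'a set \<Rightarrow> real \<Rightarrow> real \<Rightarrow>
     'a \<times> 'a \<times> 'a \<Rightarrow> ereal" where
  "potential_H P g C Lg \<theta>hat = (\<lambda>(x, y, z).
     ereal ((P x - (INF u\<in>C. P u)) / \<theta>hat + (MAX i. max (lin (g i) x z) 0)
            + Lg / 2 * (norm (x - y))\<^sup>2 + Lg / 2 * (norm (x - z))\<^sup>2)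
     + indicator_fun C x)"

definition accumulation_points :: "(nat \<Rightarrow> 'a::topological_space) \<Rightarrow> 'a set" where
  "accumulation_points X = {w. \<exists>r :: nat \<Rightarrow> nat. strict_mono r \<and> (X \<circ> r) \<longlonglongrightarrow> w}"

end

theory Submission
  imports Defs
begin

text \<open>
  Write \<open>h\<^sub>k\<close> for the value of the potential at \<open>(x\<^sub>k\<^sub>+\<^sub>1, x\<^sub>k, y\<^sub>k)\<close> and \<open>D\<^sub>k = \<parallel>x\<^sub>k\<^sub>+\<^sub>1 - x\<^sub>k\<parallel>\<close>.
  The proof combines three facts about these quantities.

  Descent. The subproblem is strongly convex, so its value at \<open>x\<^sub>k\<close> exceeds the minimum by a multiple
  of \<open>D\<^sub>k\<^sup>2\<close>; replacing the linearizations at one extrapolated point by those at the next costs, beyond a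
  term that the potential contains, a multiple of the squared extrapolation length, and the bound on the extrapolation parameters is
  exactly what leaves \<open>h\<^sub>k\<^sub>+\<^sub>1 \<le> h\<^sub>k - c D\<^sub>k\<^sup>2\<close> with \<open>c > 0\<close>. An increase of the penalty parameter only
  lowers the potential, since \<open>P\<close> is at least its infimum on \<open>C\<close>. Hence \<open>D\<^sub>k \<rightarrow> 0\<close> before anything is
  known about the penalty parameter.

  Multipliers. Every subproblem has Karush--Kuhn--Tucker multipliers, obtained by two separation
  arguments (\<open>penalty_KKT\<close>). If the penalty parameter grew without bound, then at an accumulation point
  of the iterates causing the growth the assumptions on the constraints would give a direction of uniform
  decrease of the active linearizations, and testing the stationarity condition with it would bound
  the penalty parameter. So it is eventually constant, the linearized constraints eventually hold, and
  passing to the limit in the subproblems shows that accumulation points are critical. Near a critical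
  point \<open>P\<^sub>2\<close> has a Lipschitz gradient, and the same multipliers exhibit a regular subgradient of the
  potential at \<open>(x\<^sub>k\<^sub>+\<^sub>1, x\<^sub>k, y\<^sub>k)\<close> of norm at most \<open>b (D\<^sub>k + D\<^sub>k\<^sub>-\<^sub>1)\<close>.

  Kurdyka--Lojasiewicz inequality. At an accumulation point the inequality, together with the concavity
  of the desingularizing function \<open>\<phi>\<close>, turns descent and the subgradient bound into
  \<open>3 D\<^sub>k\<^sub>+\<^sub>1 \<le> D\<^sub>k + 4 (b/c) (\<phi>(h\<^sub>k\<^sub>+\<^sub>1 - h) - \<phi>(h\<^sub>k\<^sub>+\<^sub>2 - h))\<close>, whose right-hand side telescopes. This
  keeps the iterates in the neighbourhood where the inequality is available and makes them converge
  (\<open>KL_convergence\<close>). For \<open>\<phi>(t) = \<rho> t\<^sup>1\<^sup>-\<^sup>\<alpha>\<close> the gaps \<open>u\<^sub>k = h\<^sub>k - h\<close> satisfy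
  \<open>u\<^sub>k - u\<^sub>k\<^sub>+\<^sub>2 \<ge> const u\<^sub>k\<^sub>+\<^sub>2\<^sup>2\<^sup>\<alpha>\<close>, which gives the three rates (\<open>KL_exponent_rates\<close>).
\<close>

section \<open>Finite maxima and convex subdifferentials\<close>

lemma eventually_at_right_unit: "eventually (\<lambda>t::real. 0 < t \<and> t < 1) (at_right 0)"
  using eventually_at_right_real[of 0 "1::real"] by (rule eventually_rev_mp) auto

text \<open>The nonnegative part is kept inside the maximum, so that 0 acts as one more affine
  piece of the exact penalty function.\<close>

definition pos_max :: "('m::finite \<Rightarrow> real) \<Rightarrow> real" where
  "pos_max f = (MAX i. max (f i) 0)"

lemma pos_max_le_iff: "pos_max f \<le> b \<longleftrightarrow> 0 \<le> b \<and> (\<forall>i. f i \<le> b)"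
  unfolding pos_max_def by (subst Max_le_iff) auto

lemma pos_max_nonneg: "0 \<le> pos_max f"
  using pos_max_le_iff[of f "pos_max f"] by simp

lemma le_pos_max: "f i \<le> pos_max f"
  using pos_max_le_iff[of f "pos_max f"] by simp

lemma pos_max_attained: "pos_max f = 0 \<or> (\<exists>i. f i = pos_max f)"
proof -
  have "pos_max f \<in> range (\<lambda>i. max (f i) 0)"
    unfolding pos_max_def by (rule Max_in) auto
  then show ?thesis by (auto simp: max_def split: if_splits)
qed

lemma pos_max_diff_le: "pos_max f - pos_max h \<le> (\<Sum>i\<in>UNIV. \<bar>f i - h i\<bar>)"
proof -
  have "f i \<le> pos_max h + (\<Sum>i\<in>UNIV. \<bar>f i - h i\<bar>)" for i
    using member_le_sum[of i UNIV "\<lambda>i. \<bar>f i - h i\<bar>"] le_pos_max[of h i] by auto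
  moreover have "0 \<le> pos_max h + (\<Sum>i\<in>UNIV. \<bar>f i - h i\<bar>)"
    by (intro add_nonneg_nonneg pos_max_nonneg sum_nonneg) auto
  ultimately have "pos_max f \<le> pos_max h + (\<Sum>i\<in>UNIV. \<bar>f i - h i\<bar>)"
    by (simp add: pos_max_le_iff)
  then show ?thesis by simp
qed

lemma tendsto_pos_max:
  assumes "\<And>i. ((\<lambda>k. f k i) \<longlongrightarrow> h i) F"
  shows "((\<lambda>k. pos_max (f k)) \<longlongrightarrow> pos_max h) F"
proof -
  have "((\<lambda>k. \<Sum>i\<in>UNIV. \<bar>f k i - h i\<bar>) \<longlongrightarrow> (\<Sum>i\<in>UNIV. \<bar>h i - h i\<bar>)) F"
    by (intro tendsto_intros assms)
  then have *: "((\<lambda>k. \<Sum>i\<in>UNIV. \<bar>f k i - h i\<bar>) \<longlongrightarrow> 0) F" by simp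
  have "norm (pos_max (f k) - pos_max h) \<le> (\<Sum>i\<in>UNIV. \<bar>f k i - h i\<bar>)" for k
    using pos_max_diff_le[of "f k" h] pos_max_diff_le[of h "f k"]
    by (simp add: abs_le_iff abs_minus_commute)
  then have "((\<lambda>k. pos_max (f k) - pos_max h) \<longlongrightarrow> 0) F"
    by (intro Lim_null_comparison[OF _ *] always_eventually) simp
  then show ?thesis by (simp add: LIM_zero_iff)
qed

lemma pos_max_affine_convex:
  "convex_on UNIV (\<lambda>z. pos_max (\<lambda>i. c i + v i \<bullet> (z - x)))"
proof (rule convex_onI)
  fix t :: real and z1 z2 :: 'a
  assume t: "0 < t" "t < 1"
  let ?M = "\<lambda>z. pos_max (\<lambda>i. c i + v i \<bullet> (z - x))"
  have "c i + v i \<bullet> ((1 - t) *\<^sub>R z1 + t *\<^sub>R z2 - x) \<le> (1 - t) * ?M z1 + t * ?M z2" for i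
  proof -
    have "c i + v i \<bullet> ((1 - t) *\<^sub>R z1 + t *\<^sub>R z2 - x)
        = (1 - t) * (c i + v i \<bullet> (z1 - x)) + t * (c i + v i \<bullet> (z2 - x))"
      by (simp add: inner_simps algebra_simps)
    also have "\<dots> \<le> (1 - t) * ?M z1 + t * ?M z2"
      using t le_pos_max[of "\<lambda>i. c i + v i \<bullet> (z1 - x)" i]
        le_pos_max[of "\<lambda>i. c i + v i \<bullet> (z2 - x)" i]
      by (intro add_mono mult_left_mono) auto
    finally show ?thesis .
  qed
  moreover have "0 \<le> (1 - t) * ?M z1 + t * ?M z2"
    using t by (intro add_nonneg_nonneg mult_nonneg_nonneg pos_max_nonneg) auto
  ultimately show "?M ((1 - t) *\<^sub>R z1 + t *\<^sub>R z2) \<le> (1 - t) * ?M z1 + t * ?M z2"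
    by (simp add: pos_max_le_iff)
qed simp

text \<open>This is the subdifferential sum rule for a finite convex function and a convex
  function that is only given on \<open>D\<close>. A hyperplane separating the strict epigraph of \<open>f\<close> from the
  hypograph of \<open>f x + h x - h\<close> cannot be vertical, because \<open>f\<close> is finite everywhere, and its slope is the
  required common subgradient.\<close>

lemma convex_subdiff_sandwich:
  fixes f h :: "'a::euclidean_space \<Rightarrow> real"
  assumes f: "convex_on UNIV f" and h: "convex_on D h" and x: "x \<in> D"
    and min: "\<And>u. u \<in> D \<Longrightarrow> f x + h x \<le> f u + h u"
  obtains q where "q \<in> convex_subdiff f x" "\<And>u. u \<in> D \<Longrightarrow> h x - q \<bullet> (u - x) \<le> h u"
proof -
  define S where "S = {(u, r). u \<in> D \<and> r \<le> f x + h x - h u}"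
  define T where "T = {(u, r). f u < r}"
  have "convex S"
  proof (rule convexI)
    fix p1 p2 :: "'a \<times> real" and a b :: real
    assume p: "p1 \<in> S" "p2 \<in> S" and ab: "0 \<le> a" "0 \<le> b" "a + b = 1"
    obtain u1 r1 u2 r2 where e: "p1 = (u1, r1)" "p2 = (u2, r2)" by fastforce
    have "h (a *\<^sub>R u1 + b *\<^sub>R u2) \<le> a * h u1 + b * h u2"
      using h p ab unfolding convex_on_def S_def e by auto
    moreover have "a * r1 + b * r2 \<le> a * (f x + h x - h u1) + b * (f x + h x - h u2)"
      using p ab unfolding S_def e by (intro add_mono mult_left_mono) auto
    moreover have "\<dots> = (a + b) * (f x + h x) - (a * h u1 + b * h u2)"
      by (simp add: algebra_simps)
    moreover have "a *\<^sub>R u1 + b *\<^sub>R u2 \<in> D"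
      using h p ab unfolding convex_on_def convex_def S_def e by auto
    ultimately show "a *\<^sub>R p1 + b *\<^sub>R p2 \<in> S" unfolding S_def e using ab(3) by auto
  qed
  moreover have "convex T"
  proof (rule convexI)
    fix p1 p2 :: "'a \<times> real" and a b :: real
    assume p: "p1 \<in> T" "p2 \<in> T" and ab: "0 \<le> a" "0 \<le> b" "a + b = 1"
    obtain u1 r1 u2 r2 where e: "p1 = (u1, r1)" "p2 = (u2, r2)" by fastforce
    have "f (a *\<^sub>R u1 + b *\<^sub>R u2) \<le> a * f u1 + b * f u2"
      using f ab unfolding convex_on_def by auto
    moreover have "a * (f u1 - r1) + b * (f u2 - r2) < 0"
      using p ab unfolding T_def e by (intro convex_bound_lt) auto
    ultimately show "a *\<^sub>R p1 + b *\<^sub>R p2 \<in> T" unfolding T_def e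
      by (auto simp: algebra_simps)
  qed
  moreover have lo: "(x, f x) \<in> S" and up: "(x, f x + 1) \<in> T"
    using x by (auto simp: S_def T_def)
  moreover have "S \<inter> T = {}"
    using min by (force simp: S_def T_def)
  ultimately have "\<exists>a b. a \<noteq> 0 \<and> (\<forall>w\<in>S. a \<bullet> w \<le> b) \<and> (\<forall>w\<in>T. b \<le> a \<bullet> w)"
    using separating_hyperplane_sets[of S T] by fastforce
  then obtain a b where ab: "a \<noteq> 0" "\<And>w. w \<in> S \<Longrightarrow> a \<bullet> w \<le> b" "\<And>w. w \<in> T \<Longrightarrow> b \<le> a \<bullet> w"
    by blast
  obtain p \<rho> where a: "a = (p, \<rho>)" by fastforce
  have lo': "p \<bullet> x + \<rho> * f x \<le> b" using ab(2)[OF lo] by (simp add: a)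
  have up': "b \<le> p \<bullet> u + \<rho> * r" if "f u < r" for u r
    using ab(3)[of "(u, r)"] that by (simp add: a T_def)
  have "0 \<le> \<rho>" using lo' up'[of x "f x + 1"] by (simp add: algebra_simps)
  moreover have "\<rho> \<noteq> 0"
  proof
    assume 0: "\<rho> = 0"
    then have "p \<bullet> x \<le> p \<bullet> (x - p)" using lo' up'[of "x - p" "f (x - p) + 1"] by simp
    then have "p \<bullet> p \<le> 0" by (simp add: inner_simps)
    then have "p = 0" by (metis inner_eq_zero_iff inner_ge_zero order_antisym)
    then show False using 0 ab(1) by (simp add: a zero_prod_def)
  qed
  ultimately have \<rho>: "\<rho> > 0" by simp
  have up2: "b \<le> p \<bullet> u + \<rho> * f u" for u
  proof (rule field_le_epsilon)
    fix e :: real assume "e > 0"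
    then show "b \<le> p \<bullet> u + \<rho> * f u + e"
      using up'[of u "f u + e / \<rho>"] \<rho> by (simp add: algebra_simps)
  qed
  define q where "q = - (p /\<^sub>R \<rho>)"
  have q: "\<rho> * (q \<bullet> (u - x)) = p \<bullet> x - p \<bullet> u" for u
  proof -
    have "\<rho> * (q \<bullet> (u - x)) = - (\<rho> * inverse \<rho>) * (p \<bullet> (u - x))" by (simp add: q_def)
    then show ?thesis using \<rho> by (simp add: inner_diff_right)
  qed
  have "f x + q \<bullet> (u - x) \<le> f u" for u
  proof -
    have "\<rho> * (f x + q \<bullet> (u - x)) \<le> \<rho> * f u"
      using up2[of u] lo' q[of u] by (simp add: algebra_simps)
    then show ?thesis using \<rho> by simp
  qed
  moreover have "h x - q \<bullet> (u - x) \<le> h u" if "u \<in> D" for u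
  proof -
    have "(u, f x + h x - h u) \<in> S" using that by (simp add: S_def)
    from ab(2)[OF this] have "p \<bullet> u + \<rho> * (f x + h x - h u) \<le> b" by (simp add: a)
    then have "\<rho> * (h x - q \<bullet> (u - x)) \<le> \<rho> * h u"
      using up2[of x] q[of u] by (simp add: algebra_simps)
    then show ?thesis using \<rho> by simp
  qed
  ultimately show thesis using that by (auto simp: convex_subdiff_def)
qed

text \<open>A theorem of the alternative of Gordan and Ville type: if no point of \<open>C\<close> is a direction of strict
  decrease for all \<open>a j\<close> at once, then a convex combination of the \<open>a j\<close> is nonnegative on \<open>C - x\<close>.
  The values \<open>a j \<bullet> (z - x)\<close> together with everything above them form a convex set of vectors that misses 0;
  the normal of a separating hyperplane, rescaled to sum 1, is the convex combination.\<close>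

lemma finite_alternative:
  fixes a :: "'j::finite \<Rightarrow> 'a::real_inner"
  assumes C: "convex C" "C \<noteq> {}"
    and alt: "\<And>z. z \<in> C \<Longrightarrow> \<exists>j\<in>J. 0 \<le> a j \<bullet> (z - x)"
  obtains u :: "'j \<Rightarrow> real" where "\<And>j. 0 \<le> u j" "\<And>j. j \<notin> J \<Longrightarrow> u j = 0" "sum u UNIV = 1"
    "\<And>z. z \<in> C \<Longrightarrow> 0 \<le> (\<Sum>j\<in>UNIV. u j *\<^sub>R a j) \<bullet> (z - x)"
proof -
  \<comment> \<open>Coordinates outside \<open>J\<close> are unconstrained, which forces their weights to vanish.\<close>
  define S :: "(real ^ 'j) set" where "S = {w. \<exists>z\<in>C. \<forall>j\<in>J. a j \<bullet> (z - x) < w $ j}"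
  have "convex S"
  proof (rule convexI)
    fix w1 w2 and s t :: real
    assume w: "w1 \<in> S" "w2 \<in> S" and st: "0 \<le> s" "0 \<le> t" "s + t = 1"
    obtain z1 z2 where z: "z1 \<in> C" "z2 \<in> C"
      "\<And>j. j \<in> J \<Longrightarrow> a j \<bullet> (z1 - x) < w1 $ j" "\<And>j. j \<in> J \<Longrightarrow> a j \<bullet> (z2 - x) < w2 $ j"
      using w unfolding S_def by auto
    have "a j \<bullet> (s *\<^sub>R z1 + t *\<^sub>R z2 - x) < (s *\<^sub>R w1 + t *\<^sub>R w2) $ j" if "j \<in> J" for j
    proof -
      have "s * (a j \<bullet> (z1 - x) - w1 $ j) + t * (a j \<bullet> (z2 - x) - w2 $ j) < 0"
        using z(3,4)[OF that] st by (intro convex_bound_lt) auto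
      moreover have "x = (s + t) *\<^sub>R x" using st by simp
      then have "a j \<bullet> x = s * (a j \<bullet> x) + t * (a j \<bullet> x)"
        by (metis inner_scaleR_right distrib_right)
      ultimately show ?thesis by (simp add: inner_simps algebra_simps)
    qed
    moreover have "s *\<^sub>R z1 + t *\<^sub>R z2 \<in> C" using C z st by (auto simp: convex_def)
    ultimately show "s *\<^sub>R w1 + t *\<^sub>R w2 \<in> S" unfolding S_def by blast
  qed
  moreover have "0 \<notin> S" using alt unfolding S_def by (force simp: not_less)
  ultimately have "\<exists>p. p \<noteq> 0 \<and> (\<forall>w\<in>S. 0 \<le> p \<bullet> w)"
    by (rule separating_hyperplane_set_0)
  then obtain p where p: "p \<noteq> 0" "\<And>w. w \<in> S \<Longrightarrow> 0 \<le> p \<bullet> w" by auto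
  obtain z0 where z0: "z0 \<in> C" using C by auto
  define w0 :: "real ^ 'j" where "w0 = (\<chi> j. a j \<bullet> (z0 - x) + 1)"
  have shift: "0 \<le> p \<bullet> w0 + t * p $ k" if "k \<in> J \<Longrightarrow> 0 \<le> t" for t k
  proof -
    have "w0 + t *\<^sub>R axis k 1 \<in> S"
      unfolding S_def using z0 that by (auto simp: w0_def axis_def intro!: bexI[of _ z0])
    from p(2)[OF this] show ?thesis by (simp add: inner_simps inner_axis)
  qed
  have p0: "0 \<le> p \<bullet> w0" using shift[of _ 0] by simp
  have pos: "0 \<le> p $ k" for k
  proof (rule ccontr)
    assume n: "\<not> 0 \<le> p $ k"
    have "0 \<le> (p \<bullet> w0 + 1) / (- p $ k)"
      using n p0 by (intro divide_nonneg_nonneg) auto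
    then have "0 \<le> p \<bullet> w0 + ((p \<bullet> w0 + 1) / (- p $ k)) * p $ k"
      by (intro shift)
    also have "((p \<bullet> w0 + 1) / (- p $ k)) * p $ k = - (p \<bullet> w0 + 1)" using n by auto
    finally show False by simp
  qed
  have zero: "p $ k = 0" if "k \<notin> J" for k
  proof (rule ccontr)
    assume n: "p $ k \<noteq> 0"
    have "0 \<le> p \<bullet> w0 + (- ((p \<bullet> w0 + 1) / p $ k)) * p $ k"
      using that by (intro shift) simp
    also have "(- ((p \<bullet> w0 + 1) / p $ k)) * p $ k = - (p \<bullet> w0 + 1)" using n by auto
    finally show False by simp
  qed
  define s where "s = (\<Sum>j\<in>UNIV. p $ j)"
  have s: "s > 0"
  proof -
    obtain k where "p $ k \<noteq> 0" using p(1) by (auto simp: vec_eq_iff)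
    then show ?thesis using pos unfolding s_def
      by (intro sum_pos2[of UNIV k]) (auto simp: less_le)
  qed
  have main: "0 \<le> (\<Sum>j\<in>UNIV. p $ j * (a j \<bullet> (z - x)))" if "z \<in> C" for z
  proof (rule field_le_epsilon)
    fix e :: real assume e: "e > 0"
    have "(\<chi> j. a j \<bullet> (z - x) + e / s) \<in> S"
      unfolding S_def using that e s by (auto intro!: bexI[of _ z])
    moreover have "p \<bullet> (\<chi> j. a j \<bullet> (z - x) + e / s)
        = (\<Sum>j\<in>UNIV. p $ j * (a j \<bullet> (z - x))) + (\<Sum>j\<in>UNIV. p $ j) * (e / s)"
      by (simp add: inner_vec_def distrib_left sum.distrib sum_distrib_right sum_divide_distrib)
    ultimately show "0 \<le> (\<Sum>j\<in>UNIV. p $ j * (a j \<bullet> (z - x))) + e"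
      using p(2) s by (fastforce simp: s_def)
  qed
  show thesis
  proof
    show "0 \<le> p $ j / s" for j using pos s by simp
    show "p $ j / s = 0" if "j \<notin> J" for j using zero that by simp
    show "(\<Sum>j\<in>UNIV. p $ j / s) = 1" using s by (simp add: s_def flip: sum_divide_distrib)
    show "0 \<le> (\<Sum>j\<in>UNIV. (p $ j / s) *\<^sub>R a j) \<bullet> (z - x)" if "z \<in> C" for z
    proof -
      have "(\<Sum>j\<in>UNIV. (p $ j / s) *\<^sub>R a j) \<bullet> (z - x) = (\<Sum>j\<in>UNIV. p $ j * (a j \<bullet> (z - x))) / s"
        by (simp add: inner_sum_left sum_divide_distrib)
      then show ?thesis using main[OF that] s by simp
    qed
  qed
qed

text \<open>At a minimizer over a convex set, a smooth quadratic term may be replaced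
  by its linearization: along the segment from \<open>x\<close> to \<open>z\<close> the two differ only to second order.\<close>

lemma quadratic_minorant_removal:
  fixes x z y :: "'a::real_inner"
  assumes "convex C" "convex_on C \<psi>" "x \<in> C" "z \<in> C"
    and min: "\<And>z. z \<in> C \<Longrightarrow> \<psi> x + K * (norm (x - y))\<^sup>2 \<le> \<psi> z + K * (norm (z - y))\<^sup>2"
  shows "\<psi> x \<le> \<psi> z + 2 * K * ((x - y) \<bullet> (z - x))"
proof -
  define d where "d = \<psi> z - \<psi> x + 2 * K * ((x - y) \<bullet> (z - x))"
  have key: "0 \<le> d + t * (K * (norm (z - x))\<^sup>2)" if t: "0 < t" "t < 1" for t
  proof -
    define zt where "zt = (1 - t) *\<^sub>R x + t *\<^sub>R z"
    have "zt \<in> C" using assms(1,3,4) t by (auto simp: zt_def convex_def)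
    then have "\<psi> x + K * (norm (x - y))\<^sup>2 \<le> \<psi> zt + K * (norm (zt - y))\<^sup>2" by (rule min)
    moreover have "\<psi> zt \<le> (1 - t) * \<psi> x + t * \<psi> z"
      unfolding zt_def using assms t by (intro convex_onD) auto
    moreover have "zt - y = (x - y) + t *\<^sub>R (z - x)" by (simp add: zt_def algebra_simps)
    then have "(norm (zt - y))\<^sup>2 = (norm (x - y))\<^sup>2 + 2 * t * ((x - y) \<bullet> (z - x)) + t * t * (norm (z - x))\<^sup>2"
      by (simp only: power2_norm_eq_inner inner_add_left inner_add_right inner_scaleR_left inner_scaleR_right)
        (simp add: inner_commute algebra_simps)
    ultimately have "0 \<le> t * (d + t * (K * (norm (z - x))\<^sup>2))"
      by (simp add: d_def algebra_simps)
    then show ?thesis using t by (simp add: zero_le_mult_iff)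
  qed
  have "((\<lambda>t. d + t * (K * (norm (z - x))\<^sup>2)) \<longlongrightarrow> d + 0 * (K * (norm (z - x))\<^sup>2)) (at_right 0)"
    by (intro tendsto_intros)
  moreover have "eventually (\<lambda>t. 0 \<le> d + t * (K * (norm (z - x))\<^sup>2)) (at_right 0)"
    by (rule eventually_mono[OF eventually_at_right_unit]) (use key in auto)
  ultimately have "0 \<le> d + 0 * (K * (norm (z - x))\<^sup>2)"
    by (rule tendsto_lowerbound) simp
  then show ?thesis by (simp add: d_def)
qed

text \<open>First order conditions for the exact penalty subproblem. The quadratic term is linearized,
  the sandwich lemma splits off a subgradient of \<open>\<phi>\<close>, and what remains is the statement that
  no direction into \<open>C\<close> decreases all active pieces of the piecewise affine term; the theorem of the
  alternative converts it into multipliers.\<close>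

lemma penalty_KKT:
  fixes \<phi> :: "'a::euclidean_space \<Rightarrow> real" and v :: "'m::finite \<Rightarrow> 'a" and c :: "'m \<Rightarrow> real"
  assumes \<phi>: "convex_on UNIV \<phi>" and C: "convex C" and x: "x \<in> C" and \<theta>: "0 < \<theta>"
    and min: "\<And>z. z \<in> C \<Longrightarrow> \<phi> x + \<theta> * pos_max c + K * (norm (x - y))\<^sup>2
               \<le> \<phi> z + \<theta> * pos_max (\<lambda>i. c i + v i \<bullet> (z - x)) + K * (norm (z - y))\<^sup>2"
  obtains \<mu> p \<nu> where "p \<in> convex_subdiff \<phi> x" "\<nu> \<in> normal_cone C x"
    "\<And>i. 0 \<le> \<mu> i" "sum \<mu> UNIV \<le> 1" "\<And>i. \<mu> i \<noteq> 0 \<Longrightarrow> c i = pos_max c"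
    "0 < pos_max c \<Longrightarrow> sum \<mu> UNIV = 1"
    "p + \<theta> *\<^sub>R (\<Sum>i\<in>UNIV. \<mu> i *\<^sub>R v i) + (2 * K) *\<^sub>R (x - y) + \<nu> = 0"
proof -
  define M where "M z = pos_max (\<lambda>i. c i + v i \<bullet> (z - x))" for z
  have Mx: "M x = pos_max c" by (simp add: M_def)
  have Mconv: "convex_on UNIV M" unfolding M_def by (rule pos_max_affine_convex)
  have \<theta>M: "convex_on UNIV (\<lambda>z. \<theta> * M z)" using Mconv \<theta> by (simp add: convex_on_cmul)
  have lin: "convex_on UNIV (\<lambda>z. 2 * K * ((x - y) \<bullet> (z - x)))"
    by (rule convex_onI) (auto simp: inner_simps algebra_simps)
  define h where "h z = \<theta> * M z + 2 * K * ((x - y) \<bullet> (z - x))" for z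
  have hconv: "convex_on C h"
    unfolding h_def using convex_on_add[OF \<theta>M lin] C by (auto intro: convex_on_subset)
  have "convex_on C (\<lambda>z. \<phi> z + \<theta> * M z)"
    using convex_on_add[OF \<phi> \<theta>M] C by (auto intro: convex_on_subset)
  then have linearized: "\<phi> x + \<theta> * M x \<le> \<phi> z + \<theta> * M z + 2 * K * ((x - y) \<bullet> (z - x))" if "z \<in> C" for z
    using quadratic_minorant_removal[of C "\<lambda>z. \<phi> z + \<theta> * M z" x z K y] C x that min
    by (simp add: M_def)
  have "\<phi> x + h x \<le> \<phi> z + h z" if "z \<in> C" for z
    using linearized[OF that] by (simp add: h_def)
  then obtain p where p: "p \<in> convex_subdiff \<phi> x" "\<And>z. z \<in> C \<Longrightarrow> h x - p \<bullet> (z - x) \<le> h z"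
    using convex_subdiff_sandwich[OF \<phi> hconv x] by blast
  define w where "w = p + (2 * K) *\<^sub>R (x - y)"
  have w: "\<theta> * M x \<le> \<theta> * M z + w \<bullet> (z - x)" if "z \<in> C" for z
    using p(2)[OF that] by (simp add: h_def w_def inner_simps algebra_simps)
  \<comment> \<open>Index \<open>None\<close> stands for the constant piece 0 of the maximum.\<close>
  define c' where "c' j = (case j of None \<Rightarrow> 0 | Some i \<Rightarrow> c i)" for j
  define v' where "v' j = (case j of None \<Rightarrow> 0 | Some i \<Rightarrow> v i)" for j
  define J where "J = {j. c' j = pos_max c}"
  have c'le: "c' j \<le> pos_max c" for j
    using le_pos_max[of c] pos_max_nonneg[of c] by (auto simp: c'_def split: option.splits)
  have "\<exists>j\<in>J. 0 \<le> (w + \<theta> *\<^sub>R v' j) \<bullet> (z - x)" if z: "z \<in> C" for z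
  proof (rule ccontr)
    assume "\<not> ?thesis"
    then have neg: "(w + \<theta> *\<^sub>R v' j) \<bullet> (z - x) < 0" if "j \<in> J" for j
      using that by (force simp: not_le)
    have ev: "eventually (\<lambda>t. \<theta> * c' j + t * ((w + \<theta> *\<^sub>R v' j) \<bullet> (z - x)) < \<theta> * pos_max c)
                (at_right 0)" for j
    proof (cases "j \<in> J")
      case True
      have "eventually (\<lambda>t::real. 0 < t) (at_right 0)" by (rule eventually_at_right_less)
      then show ?thesis
        by (rule eventually_mono) (use neg[OF True] True in \<open>auto simp: J_def mult_pos_neg\<close>)
    next
      case False
      then have "c' j < pos_max c" using c'le[of j] by (auto simp: J_def)
      then have "\<theta> * c' j + 0 * ((w + \<theta> *\<^sub>R v' j) \<bullet> (z - x)) < \<theta> * pos_max c" using \<theta> by simp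
      moreover have "((\<lambda>t. \<theta> * c' j + t * ((w + \<theta> *\<^sub>R v' j) \<bullet> (z - x)))
          \<longlongrightarrow> \<theta> * c' j + 0 * ((w + \<theta> *\<^sub>R v' j) \<bullet> (z - x))) (at_right 0)"
        by (intro tendsto_intros)
      ultimately show ?thesis by (simp add: order_tendstoD(2))
    qed
    from eventually_at_right_unit eventually_all_finite[of "\<lambda>t j. \<theta> * c' j + t * ((w + \<theta> *\<^sub>R v' j) \<bullet> (z - x)) < \<theta> * pos_max c", OF ev]
    have "eventually (\<lambda>t. (0 < t \<and> t < 1) \<and>
        (\<forall>j. \<theta> * c' j + t * ((w + \<theta> *\<^sub>R v' j) \<bullet> (z - x)) < \<theta> * pos_max c)) (at_right 0)"
      by (rule eventually_conj)
    then obtain t where t: "0 < t" "t < 1"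
      "\<And>j. \<theta> * c' j + t * ((w + \<theta> *\<^sub>R v' j) \<bullet> (z - x)) < \<theta> * pos_max c"
      using eventually_happens[of _ "at_right (0::real)"] by (auto simp: trivial_limit_at_right_real)
    define zt where "zt = (1 - t) *\<^sub>R x + t *\<^sub>R z"
    have zt: "zt \<in> C" "zt - x = t *\<^sub>R (z - x)"
      using C x z t by (auto simp: zt_def convex_def) (simp add: algebra_simps)
    obtain j where j: "M zt = c' j + v' j \<bullet> (zt - x)"
    proof (cases "M zt = 0")
      case True
      then show ?thesis using that[of None] by (simp add: c'_def v'_def)
    next
      case False
      then obtain i where "c i + v i \<bullet> (zt - x) = M zt"
        using pos_max_attained[of "\<lambda>i. c i + v i \<bullet> (zt - x)"] unfolding M_def by auto
      then show ?thesis using that[of "Some i"] by (simp add: c'_def v'_def)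
    qed
    have "\<theta> * M zt + w \<bullet> (zt - x) = \<theta> * c' j + t * ((w + \<theta> *\<^sub>R v' j) \<bullet> (z - x))"
      unfolding j zt(2) by (simp add: inner_simps algebra_simps)
    then show False using t(3)[of j] w[OF zt(1)] Mx by simp
  qed
  then obtain u where u: "\<And>j. 0 \<le> u j" "\<And>j. j \<notin> J \<Longrightarrow> u j = 0" "sum u UNIV = 1"
    "\<And>z. z \<in> C \<Longrightarrow> 0 \<le> (\<Sum>j\<in>UNIV. u j *\<^sub>R (w + \<theta> *\<^sub>R v' j)) \<bullet> (z - x)"
    using finite_alternative[of C J "\<lambda>j. w + \<theta> *\<^sub>R v' j" x] C x by blast
  have split: "(\<Sum>j\<in>UNIV. f j) = f None + (\<Sum>i\<in>UNIV. f (Some i))"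
    for f :: "'m option \<Rightarrow> 'z::comm_monoid_add"
    by (simp add: UNIV_option_conv sum.reindex)
  define \<mu> where "\<mu> i = u (Some i)" for i
  define \<nu> where "\<nu> = - (w + \<theta> *\<^sub>R (\<Sum>i\<in>UNIV. \<mu> i *\<^sub>R v i))"
  have "(\<Sum>j\<in>UNIV. u j *\<^sub>R (w + \<theta> *\<^sub>R v' j)) = w + \<theta> *\<^sub>R (\<Sum>j\<in>UNIV. u j *\<^sub>R v' j)"
    using u(3) by (simp add: scaleR_add_right sum.distrib flip: scaleR_sum_left)
      (simp add: scaleR_sum_right mult.commute)
  also have "(\<Sum>j\<in>UNIV. u j *\<^sub>R v' j) = (\<Sum>i\<in>UNIV. \<mu> i *\<^sub>R v i)"
    by (simp add: split v'_def \<mu>_def)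
  finally have "\<nu> = - (\<Sum>j\<in>UNIV. u j *\<^sub>R (w + \<theta> *\<^sub>R v' j))" by (simp add: \<nu>_def)
  then have "\<nu> \<in> normal_cone C x" using u(4) x by (auto simp: normal_cone_def inner_minus_left)
  moreover have sum: "u None + sum \<mu> UNIV = 1" using u(3) by (simp add: split \<mu>_def)
  moreover have "sum \<mu> UNIV = 1" if "0 < pos_max c"
    using that sum u(2)[of None] by (simp add: J_def c'_def)
  moreover have "c i = pos_max c" if "\<mu> i \<noteq> 0" for i
    using that u(2)[of "Some i"] by (auto simp: \<mu>_def J_def c'_def)
  moreover have "p + \<theta> *\<^sub>R (\<Sum>i\<in>UNIV. \<mu> i *\<^sub>R v i) + (2 * K) *\<^sub>R (x - y) + \<nu> = 0"
    by (simp add: \<nu>_def w_def)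
  moreover have "sum \<mu> UNIV \<le> 1" using sum u(1)[of None] by simp
  moreover have "0 \<le> \<mu> i" for i using u(1) by (simp add: \<mu>_def)
  ultimately show thesis using that[of p \<nu> \<mu>] p(1) by simp
qed

text \<open>Testing the subgradient inequality with a unit step in the direction of \<open>q\<close>
  bounds \<open>norm q\<close> by the oscillation of \<open>f\<close> on a slightly larger ball.\<close>

lemma convex_subdiff_bounded:
  fixes f :: "'a::euclidean_space \<Rightarrow> real"
  assumes f: "convex_on UNIV f" and S: "bounded S"
  obtains R where "0 < R" "\<And>x q. x \<in> S \<Longrightarrow> q \<in> convex_subdiff f x \<Longrightarrow> norm q \<le> R"
proof -
  obtain r where r: "\<And>x. x \<in> S \<Longrightarrow> norm x \<le> r" using S by (auto simp: bounded_iff)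
  have "continuous_on UNIV f" using convex_on_continuous[OF open_UNIV f] .
  then have "compact (f ` cball 0 (r + 1))"
    by (intro compact_continuous_image) (auto intro: continuous_on_subset)
  then obtain B where B: "\<And>u. norm u \<le> r + 1 \<Longrightarrow> \<bar>f u\<bar> \<le> B"
    using compact_imp_bounded by (force simp: bounded_iff)
  have "norm q \<le> \<bar>2 * B\<bar> + 1" if x: "x \<in> S" and q: "q \<in> convex_subdiff f x" for x q
  proof -
    define u where "u = x + sgn q"
    have "norm u \<le> norm x + norm (sgn q)" unfolding u_def by (rule norm_triangle_ineq)
    then have "norm u \<le> r + 1" using r[OF x] by (simp add: norm_sgn split: if_splits)
    moreover have "f x + q \<bullet> (u - x) \<le> f u" using q by (simp add: convex_subdiff_def)
    moreover have "q \<bullet> (u - x) = norm q"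
      by (cases "q = 0") (simp_all add: u_def sgn_div_norm dot_square_norm power2_eq_square)
    ultimately show ?thesis using B[of u] B[of x] r[OF x] by fastforce
  qed
  moreover have "0 < \<bar>2 * B\<bar> + 1" by simp
  ultimately show thesis using that by blast
qed

lemma convex_subdiff_closed:
  fixes f :: "'a::euclidean_space \<Rightarrow> real"
  assumes f: "convex_on UNIV f" and lim: "X \<longlonglongrightarrow> x" "Q \<longlonglongrightarrow> q"
    and sub: "\<And>n. Q n \<in> convex_subdiff f (X n)"
  shows "q \<in> convex_subdiff f x"
proof -
  have cont: "continuous_on UNIV f" using convex_on_continuous[OF open_UNIV f] .
  have "f x + q \<bullet> (u - x) \<le> f u" for u
  proof (rule LIMSEQ_le_const2)
    show "(\<lambda>n. f (X n) + Q n \<bullet> (u - X n)) \<longlonglongrightarrow> f x + q \<bullet> (u - x)"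
      using cont by (intro tendsto_intros lim continuous_on_tendsto_compose[OF cont]) auto
    show "\<exists>N. \<forall>n\<ge>N. f (X n) + Q n \<bullet> (u - X n) \<le> f u"
      using sub by (auto simp: convex_subdiff_def)
  qed
  then show ?thesis by (simp add: convex_subdiff_def)
qed

lemma finite_negative_margin:
  fixes f :: "'m::finite \<Rightarrow> real"
  assumes "\<And>i. f i < 0"
  obtains \<eta> where "0 < \<eta>" "\<And>i. f i < - \<eta>"
proof -
  define M where "M = Min (range (\<lambda>i. - f i))"
  have "M \<in> range (\<lambda>i. - f i)" unfolding M_def by (intro Min_in) auto
  then have "0 < M" using assms by auto
  moreover have "M \<le> - f i" for i unfolding M_def by (intro Min_le) auto
  then have "f i \<le> - M" for i by (simp add: le_minus_iff)
  ultimately have "f i < - (M / 2)" for i by (smt (verit) field_sum_of_halves)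
  then show thesis using \<open>0 < M\<close> that[of "M / 2"] by simp
qed

section \<open>Gradients and regular subgradients\<close>

text \<open>Uniqueness of gradients, which makes the description by \<open>THE\<close> usable.\<close>

lemma grad_eqI:
  assumes "GDERIV f x :> D"
  shows "grad f x = D"
proof -
  have "D' = D" if "GDERIV f x :> D'" for D'
  proof -
    have "(\<lambda>h. h \<bullet> D') = (\<lambda>h. h \<bullet> D)"
      using has_derivative_unique that assms unfolding gderiv_def by blast
    then have "(D' - D) \<bullet> D' = (D' - D) \<bullet> D" by metis
    then have "(D' - D) \<bullet> (D' - D) = 0" by (simp add: inner_diff_right)
    then show ?thesis by simp
  qed
  then show ?thesis unfolding grad_def using assms by blast
qed

lemma GDERIV_grad:
  fixes f :: "'a::euclidean_space \<Rightarrow> real"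
  assumes "f differentiable (at x)"
  shows "GDERIV f x :> grad f x"
proof -
  obtain D where D: "(f has_derivative D) (at x)"
    using assms by (auto simp: differentiable_def)
  then have "linear D" using has_derivative_linear by blast
  then have "h \<bullet> adjoint D 1 = D h" for h by (simp add: adjoint_works)
  then have "GDERIV f x :> adjoint D 1" using D by (simp add: gderiv_def)
  then show ?thesis using grad_eqI by metis
qed

lemma DERIV_along_line:
  fixes f :: "'a::euclidean_space \<Rightarrow> real"
  assumes "f differentiable (at (x + t *\<^sub>R d))"
  shows "((\<lambda>s. f (x + s *\<^sub>R d)) has_real_derivative grad f (x + t *\<^sub>R d) \<bullet> d) (at t)"
proof -
  have "((\<lambda>s. x + s *\<^sub>R d) has_derivative (\<lambda>s. s *\<^sub>R d)) (at t)"
    by (auto intro!: derivative_eq_intros)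
  from has_derivative_compose[OF this GDERIV_grad[OF assms, unfolded gderiv_def]]
  have "((\<lambda>s. f (x + s *\<^sub>R d)) has_derivative (\<lambda>s. (s *\<^sub>R d) \<bullet> grad f (x + t *\<^sub>R d))) (at t)" .
  then show ?thesis
    by (simp add: has_field_derivative_def inner_commute mult_commute_abs)
qed

lemma directional_quotient_tendsto:
  fixes f :: "'a::euclidean_space \<Rightarrow> real"
  assumes "f differentiable (at x)"
  shows "((\<lambda>t. (f (x + t *\<^sub>R d) - f x) / t) \<longlongrightarrow> grad f x \<bullet> d) (at_right 0)"
proof -
  have "((\<lambda>s. f (x + s *\<^sub>R d)) has_real_derivative grad f x \<bullet> d) (at 0)"
    using DERIV_along_line[of f x 0 d] assms by simp
  then have "((\<lambda>t. (f (x + t *\<^sub>R d) - f x) / t) \<longlongrightarrow> grad f x \<bullet> d) (at 0)"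
    by (simp add: has_field_derivative_iff)
  then show ?thesis by (rule tendsto_mono[rotated]) (simp add: at_le)
qed

lemma grad_in_convex_subdiff:
  fixes f :: "'a::euclidean_space \<Rightarrow> real"
  assumes "convex_on UNIV f" "f differentiable (at x)"
  shows "grad f x \<in> convex_subdiff f x"
proof -
  have "grad f x \<bullet> (u - x) \<le> f u - f x" for u
  proof -
    have "(f (x + t *\<^sub>R (u - x)) - f x) / t \<le> f u - f x" if t: "0 < t" "t < 1" for t
    proof -
      have "f ((1 - t) *\<^sub>R x + t *\<^sub>R u) \<le> (1 - t) * f x + t * f u"
        using assms(1) t by (intro convex_onD) auto
      moreover have "(1 - t) *\<^sub>R x + t *\<^sub>R u = x + t *\<^sub>R (u - x)" by (simp add: algebra_simps)
      ultimately show ?thesis using t by (simp add: field_simps)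
    qed
    then have "eventually (\<lambda>t. (f (x + t *\<^sub>R (u - x)) - f x) / t \<le> f u - f x) (at_right 0)"
      by (intro eventually_mono[OF eventually_at_right_unit]) auto
    with directional_quotient_tendsto[OF assms(2)] show ?thesis
      by (rule tendsto_upperbound) simp
  qed
  then show ?thesis by (simp add: convex_subdiff_def algebra_simps)
qed

lemma convex_subdiff_eq_grad:
  fixes f :: "'a::euclidean_space \<Rightarrow> real"
  assumes "q \<in> convex_subdiff f x" "f differentiable (at x)"
  shows "q = grad f x"
proof -
  have "q \<bullet> d \<le> grad f x \<bullet> d" for d
  proof -
    have "q \<bullet> d \<le> (f (x + t *\<^sub>R d) - f x) / t" if t: "0 < t" "t < 1" for t
    proof -
      have "f x + q \<bullet> (x + t *\<^sub>R d - x) \<le> f (x + t *\<^sub>R d)"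
        using assms(1) unfolding convex_subdiff_def by blast
      then show ?thesis using t by (simp add: field_simps)
    qed
    then have "eventually (\<lambda>t. q \<bullet> d \<le> (f (x + t *\<^sub>R d) - f x) / t) (at_right 0)"
      by (intro eventually_mono[OF eventually_at_right_unit]) auto
    with directional_quotient_tendsto[OF assms(2)] show ?thesis
      by (rule tendsto_lowerbound) simp
  qed
  from this[of "q - grad f x"] have "(q - grad f x) \<bullet> (q - grad f x) \<le> 0"
    by (simp add: inner_diff_left)
  then have "(q - grad f x) \<bullet> (q - grad f x) = 0"
    by (metis inner_ge_zero order_antisym)
  then show ?thesis by simp
qed

text \<open>The descent lemma: restricted to the segment from \<open>w\<close> to \<open>u\<close>, the left side minus the
  right side has nonpositive derivative, by the Lipschitz bound.\<close>

lemma lipschitz_gradient_upper: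
  fixes f :: "'a::euclidean_space \<Rightarrow> real"
  assumes "lipschitz_gradient K f"
  shows "f u \<le> lin f u w + K / 2 * (norm (u - w))\<^sup>2"
proof -
  define d where "d = u - w"
  have diff: "f differentiable (at z)" for z
    using assms by (simp add: lipschitz_gradient_def)
  define F where "F t = f (w + t *\<^sub>R d) - t * (grad f w \<bullet> d) - K / 2 * t\<^sup>2 * (norm d)\<^sup>2" for t
  have "F 1 \<le> F 0"
  proof (rule DERIV_nonpos_imp_nonincreasing[of 0 1 F])
    fix t :: real assume t: "0 \<le> t" "t \<le> 1"
    have "(F has_real_derivative
        grad f (w + t *\<^sub>R d) \<bullet> d - grad f w \<bullet> d - K * t * (norm d)\<^sup>2) (at t)"
      unfolding F_def by (auto intro!: derivative_eq_intros DERIV_along_line diff)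
    moreover have "grad f (w + t *\<^sub>R d) \<bullet> d - grad f w \<bullet> d - K * t * (norm d)\<^sup>2 \<le> 0"
    proof -
      have "grad f (w + t *\<^sub>R d) \<bullet> d - grad f w \<bullet> d = (grad f (w + t *\<^sub>R d) - grad f w) \<bullet> d"
        by (simp add: inner_diff_left)
      also have "\<dots> \<le> norm (grad f (w + t *\<^sub>R d) - grad f w) * norm d"
        by (rule norm_cauchy_schwarz)
      also have "\<dots> \<le> (K * (t * norm d)) * norm d"
        using assms lipschitz_onD[of K UNIV "grad f" "w + t *\<^sub>R d" w] t
        by (intro mult_right_mono) (auto simp: lipschitz_gradient_def dist_norm)
      finally show ?thesis by (simp add: power2_eq_square algebra_simps)
    qed
    ultimately show "\<exists>y. (F has_real_derivative y) (at t) \<and> y \<le> 0" by blast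
  qed simp
  then show ?thesis by (simp add: F_def d_def lin_def)
qed

lemma GDERIV_cmult:
  assumes "GDERIV f x :> D"
  shows "GDERIV (\<lambda>v. c * f v) x :> c *\<^sub>R D"
  using has_derivative_mult_right[OF assms[unfolded gderiv_def], of c]
  by (simp add: gderiv_def)

lemma GDERIV_sum:
  assumes "\<And>i. i \<in> I \<Longrightarrow> GDERIV (f i) x :> D i"
  shows "GDERIV (\<lambda>v. \<Sum>i\<in>I. f i v) x :> (\<Sum>i\<in>I. D i)"
  using has_derivative_sum[of I f "\<lambda>i h. h \<bullet> D i" "at x"] assms
  by (simp add: gderiv_def inner_sum_right)

text \<open>Differentiating the linearization in its base point cancels the gradient and leaves the
  transposed second derivative, applied to \<open>X - Z\<close>.\<close>

lemma GDERIV_lin: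
  fixes g :: "'a::euclidean_space \<Rightarrow> real"
  assumes g: "g differentiable (at Z)" and dg: "(grad g has_derivative blinfun_apply F) (at Z)"
  shows "GDERIV (\<lambda>v. lin g (fst v) (snd (snd v))) (X, Y :: 'a, Z)
           :> (grad g Z, 0, adjoint (blinfun_apply F) (X - Z))"
proof -
  let ?w = "(X, Y, Z)"
  have z: "((\<lambda>v::'a \<times> 'a \<times> 'a. snd (snd v)) has_derivative (\<lambda>h. snd (snd h))) (at ?w)"
    by (auto intro!: derivative_eq_intros)
  have f: "((\<lambda>v::'a \<times> 'a \<times> 'a. fst v) has_derivative fst) (at ?w)"
    by (auto intro!: derivative_eq_intros)
  have 1: "((\<lambda>v::'a \<times> 'a \<times> 'a. g (snd (snd v))) has_derivative (\<lambda>h. snd (snd h) \<bullet> grad g Z)) (at ?w)"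
    using has_derivative_compose[OF z, of g] GDERIV_grad[OF g] by (simp add: gderiv_def)
  have 2: "((\<lambda>v::'a \<times> 'a \<times> 'a. grad g (snd (snd v))) has_derivative (\<lambda>h. F (snd (snd h)))) (at ?w)"
    using has_derivative_compose[OF z, of "grad g"] dg by simp
  have "((\<lambda>v::'a \<times> 'a \<times> 'a. lin g (fst v) (snd (snd v))) has_derivative
     (\<lambda>h. snd (snd h) \<bullet> grad g Z + (grad g Z \<bullet> (fst h - snd (snd h)) + F (snd (snd h)) \<bullet> (X - Z)))) (at ?w)"
    unfolding lin_def
    using has_derivative_add[OF 1 has_derivative_inner[OF 2 has_derivative_diff[OF f z]]] by simp
  moreover have "snd (snd h) \<bullet> grad g Z + (grad g Z \<bullet> (fst h - snd (snd h)) + F (snd (snd h)) \<bullet> (X - Z))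
     = h \<bullet> (grad g Z, 0, adjoint (blinfun_apply F) (X - Z))" for h :: "'a \<times> 'a \<times> 'a"
    by (cases h) (auto simp: inner_diff_right inner_commute adjoint_works
        bounded_linear.linear[OF blinfun.bounded_linear_right])
  ultimately show ?thesis by (simp add: gderiv_def)
qed

lemma norm_adjoint_blinfun_le:
  fixes F :: "'a::euclidean_space \<Rightarrow>\<^sub>L 'a"
  shows "norm (adjoint (blinfun_apply F) v) \<le> norm F * norm v"
proof -
  let ?a = "adjoint (blinfun_apply F) v"
  have "?a \<bullet> ?a = F ?a \<bullet> v"
    by (rule adjoint_works) (rule bounded_linear.linear[OF blinfun.bounded_linear_right])
  also have "\<dots> \<le> norm (F ?a) * norm v" by (rule norm_cauchy_schwarz)
  also have "\<dots> \<le> (norm F * norm ?a) * norm v"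
    by (intro mult_right_mono norm_blinfun) auto
  finally have "norm ?a * norm ?a \<le> (norm F * norm v) * norm ?a"
    by (simp add: dot_square_norm power2_eq_square mult_ac)
  then show ?thesis by (cases "norm ?a = 0") auto
qed

lemma GDERIV_sq_dist_12:
  "GDERIV (\<lambda>v. (norm (fst v - fst (snd v)))\<^sup>2) (X, Y :: 'a::real_inner, Z :: 'a)
     :> (2 *\<^sub>R (X - Y), - 2 *\<^sub>R (X - Y), 0)"
  unfolding gderiv_def power2_norm_eq_inner
  by (auto intro!: derivative_eq_intros simp: inner_prod_def fun_eq_iff inner_simps inner_commute)

lemma GDERIV_sq_dist_13:
  "GDERIV (\<lambda>v. (norm (fst v - snd (snd v)))\<^sup>2) (X, Y :: 'a::real_inner, Z :: 'a)
     :> (2 *\<^sub>R (X - Z), 0, - 2 *\<^sub>R (X - Z))"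
  unfolding gderiv_def power2_norm_eq_inner
  by (auto intro!: derivative_eq_intros simp: inner_prod_def fun_eq_iff inner_simps inner_commute)

lemma GDERIV_fst_comp:
  fixes f :: "'a::real_inner \<Rightarrow> real"
  assumes "GDERIV f X :> D"
  shows "GDERIV (\<lambda>v. f (fst v)) (X, Y :: 'a, Z :: 'a) :> (D, 0, 0)"
proof -
  have f: "((\<lambda>v::'a \<times> 'a \<times> 'a. fst v) has_derivative fst) (at (X, Y, Z))"
    by (auto intro!: derivative_eq_intros)
  have "((\<lambda>v::'a \<times> 'a \<times> 'a. f (fst v)) has_derivative (\<lambda>h. fst h \<bullet> D)) (at (X, Y, Z))"
    using has_derivative_compose[OF f, of f] assms by (simp add: gderiv_def)
  then show ?thesis by (simp add: gderiv_def inner_prod_def)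
qed

text \<open>The difference quotient of the minorant tends to 0 and bounds the one of \<open>f\<close> from below. This
  replaces calculus rules for sums and maxima of nonsmooth functions.\<close>

lemma regular_subdiff_smooth_minorant:
  fixes f :: "'a::euclidean_space \<Rightarrow> ereal"
  assumes "f w = ereal (q w)" and minor: "\<And>v. ereal (q v) \<le> f v" and "GDERIV q w :> \<zeta>"
  shows "\<zeta> \<in> regular_subdiff f w"
proof -
  have "((\<lambda>v. ((q v - q w) - (v - w) \<bullet> \<zeta>) /\<^sub>R norm (v - w)) \<longlongrightarrow> 0) (at w)"
    using assms(3) by (simp add: gderiv_def has_derivative_at_within)
  then have "((\<lambda>v. ereal (((q v - q w) - (v - w) \<bullet> \<zeta>) /\<^sub>R norm (v - w))) \<longlongrightarrow> ereal 0) (at w)"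
    by (simp only: lim_ereal)
  then have "Liminf (at w) (\<lambda>v. ereal (((q v - q w) - (v - w) \<bullet> \<zeta>) /\<^sub>R norm (v - w))) = 0"
    by (intro lim_imp_Liminf) (auto simp: zero_ereal_def)
  moreover have ev: "eventually (\<lambda>v. ereal (((q v - q w) - (v - w) \<bullet> \<zeta>) /\<^sub>R norm (v - w))
     \<le> (f v - f w - ereal (\<zeta> \<bullet> (v - w))) / ereal (norm (v - w))) (at w)"
  proof -
    have "ereal (((q v - q w) - (v - w) \<bullet> \<zeta>) /\<^sub>R norm (v - w))
     \<le> (f v - f w - ereal (\<zeta> \<bullet> (v - w))) / ereal (norm (v - w))" if "v \<noteq> w" for v
    proof (cases "f v")
      case (real r)
      then have "q v \<le> r" using minor[of v] by simp
      then have "(q v - q w - \<zeta> \<bullet> (v - w)) / norm (v - w) \<le> (r - q w - \<zeta> \<bullet> (v - w)) / norm (v - w)"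
        by (intro divide_right_mono) auto
      moreover have "(f v - f w - ereal (\<zeta> \<bullet> (v - w))) / ereal (norm (v - w))
          = ereal ((r - q w - \<zeta> \<bullet> (v - w)) / norm (v - w))"
        using that real assms(1) by simp
      moreover have "((q v - q w) - (v - w) \<bullet> \<zeta>) /\<^sub>R norm (v - w)
          = (q v - q w - \<zeta> \<bullet> (v - w)) / norm (v - w)"
        by (simp add: inner_commute[of \<zeta>] divide_inverse mult.commute)
      ultimately show ?thesis by simp
    next
      case PInf
      have "inverse (ereal (norm (v - w))) = ereal (inverse (norm (v - w)))" using that by simp
      moreover have "\<infinity> * ereal (inverse (norm (v - w))) = \<infinity>"
        using that by simp
      ultimately have "(f v - f w - ereal (\<zeta> \<bullet> (v - w))) / ereal (norm (v - w)) = \<infinity>"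
        using PInf assms(1) by (simp only: divide_ereal_def) simp
      then show ?thesis by (simp only: ereal_less_eq)
    next
      case MInf
      then have False using minor[of v] by simp
      then show ?thesis ..
    qed
    then show ?thesis by (auto simp: eventually_at_filter)
  qed
  ultimately have "0 \<le> Liminf (at w) (\<lambda>v. (f v - f w - ereal (\<zeta> \<bullet> (v - w))) / ereal (norm (v - w)))"
    using Liminf_mono[OF ev] by simp
  then show ?thesis using assms(1) by (simp add: regular_subdiff_def)
qed

lemma regular_subset_limiting: "regular_subdiff f w \<subseteq> limiting_subdiff f w"
proof
  fix \<zeta> assume \<zeta>: "\<zeta> \<in> regular_subdiff f w"
  then have "\<bar>f w\<bar> \<noteq> \<infinity>" by (simp add: regular_subdiff_def)
  moreover have "\<exists>W \<Xi>. W \<longlonglongrightarrow> w \<and> (\<lambda>k. f (W k)) \<longlonglongrightarrow> f w \<and> \<Xi> \<longlonglongrightarrow> \<zeta> \<and>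
      (\<forall>k::nat. \<Xi> k \<in> regular_subdiff f (W k))"
    by (rule exI[of _ "\<lambda>_. w"], rule exI[of _ "\<lambda>_. \<zeta>"]) (simp add: \<zeta>)
  ultimately show "\<zeta> \<in> limiting_subdiff f w"
    unfolding limiting_subdiff_def by simp
qed

section \<open>Descent sequences under a Kurdyka--Lojasiewicz inequality\<close>

text \<open>Concavity: a desingularizing function lies below its tangents. The left end \<open>t = 0\<close>
  is included, where \<open>\<phi>\<close> need not be differentiable.\<close>

lemma desingularizes_tangent:
  assumes "desingularizes f w r U \<phi>" and st: "0 < s" "ereal s < r" "0 \<le> t" "t \<le> s"
  shows "deriv \<phi> s * (s - t) \<le> \<phi> s - \<phi> t"
proof -
  define I where "I = {t. 0 \<le> t \<and> ereal t < r}"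
  have conc: "convex_on I (\<lambda>t. - \<phi> t)"
    using assms(1) by (simp add: desingularizes_def concave_on_def I_def)
  have "\<phi> differentiable (at s)" using assms(1) st by (simp add: desingularizes_def)
  then have der: "((\<lambda>t. - \<phi> t) has_real_derivative - deriv \<phi> s) (at s)"
    using DERIV_deriv_iff_real_differentiable DERIV_minus by blast
  have "connected I" using conc by (simp add: convex_on_imp_convex convex_connected)
  moreover have "s \<in> interior I"
  proof -
    obtain b where b: "ereal s < ereal b" "ereal b < r" using ereal_dense2[OF st(2)] by auto
    have "ereal a < r" if "a < b" for a
      using that b(2) by (metis less_ereal.simps(1) less_trans)
    then have "{0<..<b} \<subseteq> I" by (auto simp: I_def)
    moreover have "s \<in> {0<..<b}" using b st by simp
    ultimately show ?thesis by (meson interiorI open_greaterThanLessThan)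
  qed
  moreover have "t \<in> I" using st le_less_trans[of "ereal t" "ereal s" r] by (auto simp: I_def)
  ultimately have "- deriv \<phi> s * (t - s) \<le> - \<phi> t - - \<phi> s"
    using convex_on_imp_above_tangent[OF conc] der
    by (metis has_field_derivative_at_within)
  then show ?thesis by (simp add: algebra_simps)
qed

lemma deriv_power_desingularizer:
  fixes t :: real
  assumes "0 < t"
  shows "deriv (\<lambda>t. \<rho> * t powr (1 - \<alpha>)) t = \<rho> * (1 - \<alpha>) * t powr (- \<alpha>)"
  using assms by (intro DERIV_imp_deriv) (auto intro!: derivative_eq_intros)

lemma descent_step_sizes_vanish:
  fixes h D :: "nat \<Rightarrow> real"
  assumes c: "0 < c" and descent: "\<And>k. N \<le> k \<Longrightarrow> h (Suc k) \<le> h k - c * (D k)\<^sup>2"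
    and lim: "h \<longlonglongrightarrow> l"
  shows "D \<longlonglongrightarrow> 0"
proof -
  have "(\<lambda>k. (h k - h (Suc k)) / c) \<longlonglongrightarrow> (l - l) / c"
    using c by (intro tendsto_intros lim LIMSEQ_Suc) auto
  then have lim0: "(\<lambda>k. (h k - h (Suc k)) / c) \<longlonglongrightarrow> 0" by simp
  have "eventually (\<lambda>k. norm ((D k)\<^sup>2) \<le> (h k - h (Suc k)) / c) sequentially"
    unfolding eventually_sequentially using descent c
    by (intro exI[of _ N]) (force simp: field_simps)
  from Lim_null_comparison[OF this lim0] have "(\<lambda>k. (D k)\<^sup>2) \<longlonglongrightarrow> 0" .
  from tendsto_real_sqrt[OF this] show ?thesis by (simp add: tendsto_rabs_zero_iff)
qed

lemma limit_le_of_eventually_decreasing: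
  fixes h :: "nat \<Rightarrow> real"
  assumes "\<And>k. N \<le> k \<Longrightarrow> h (Suc k) \<le> h k" "h \<longlonglongrightarrow> l" "N \<le> k"
  shows "l \<le> h k"
proof (rule LIMSEQ_le_const2[OF assms(2)], intro exI[of _ k] allI impI)
  fix n assume "k \<le> n"
  then show "h n \<le> h k"
    by (induction n rule: dec_induct) (use assms(1,3) in \<open>auto intro: order_trans\<close>)
qed

text \<open>The finite length argument. Concavity of \<open>\<phi>\<close> and the Kurdyka--Lojasiewicz inequality bound
  \<open>c * (D (Suc k))\<^sup>2\<close> by \<open>b * (D k + D (Suc k))\<close> times the decrease of \<open>\<phi> (h k - l)\<close> from index
  \<open>Suc k\<close> to the next, and the arithmetic-geometric mean inequality makes this linear and telescoping. The inequality is only available within \<open>\<delta>\<close> of the accumulation point \<open>xs\<close>;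
  once an iterate is close to \<open>xs\<close> with small step and small gap, the telescoped bound on the distance
  travelled keeps all later iterates within \<open>\<delta>\<close>.\<close>

lemma KL_convergence:
  fixes x :: "nat \<Rightarrow> 'a::real_normed_vector" and h D :: "nat \<Rightarrow> real" and \<phi> \<psi> :: "real \<Rightarrow> real"
  assumes D: "\<And>k. D k = norm (x (Suc k) - x k)"
    and c: "0 < c" and descent: "\<And>k. N \<le> k \<Longrightarrow> h (Suc k) \<le> h k - c * (D k)\<^sup>2"
    and lim: "h \<longlonglongrightarrow> l"
    and r: "strict_mono r" "(x \<circ> r) \<longlonglongrightarrow> xs"
    and pos: "0 < \<delta>" "0 < r0" "0 < b"
    and \<phi>: "\<phi> 0 = 0" "\<And>t. 0 \<le> t \<Longrightarrow> t < r0 \<Longrightarrow> 0 \<le> \<phi> t" "continuous_on {0..<r0} \<phi>"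
    and tangent: "\<And>s t. 0 < s \<Longrightarrow> s < r0 \<Longrightarrow> 0 \<le> t \<Longrightarrow> t \<le> s \<Longrightarrow> \<psi> s * (s - t) \<le> \<phi> s - \<phi> t"
    and \<psi>: "\<And>s. 0 < s \<Longrightarrow> s < r0 \<Longrightarrow> 0 < \<psi> s"
    and KL: "\<And>k. N \<le> k \<Longrightarrow> norm (x (Suc k) - xs) < \<delta> \<Longrightarrow> l < h (Suc k) \<Longrightarrow> h (Suc k) < l + r0
        \<Longrightarrow> 1 \<le> \<psi> (h (Suc k) - l) * (b * (D k + D (Suc k)))"
  shows "x \<longlonglongrightarrow> xs"
    and "\<exists>K. \<forall>k\<ge>K. norm (x (Suc k) - xs) \<le> D k + 2 * (b / c) * \<phi> (h (Suc k) - l)"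
proof -
  define E where "E k = \<phi> (h k - l)" for k
  define G where "G = b / c"
  have G: "0 < G" using pos c by (simp add: G_def)
  have D0: "0 \<le> D k" for k by (simp add: D)
  have decr: "h (Suc k) \<le> h k" if "N \<le> k" for k
  proof -
    have "0 \<le> c * (D k)\<^sup>2" using c by simp
    then show ?thesis using descent[OF that] by linarith
  qed
  have hl: "l \<le> h k" if "N \<le> k" for k
    using limit_le_of_eventually_decreasing[OF decr lim that] .
  have Dlim: "D \<longlonglongrightarrow> 0" using descent_step_sizes_vanish[OF c descent lim] .
  have "eventually (\<lambda>k. h k < l + r0) sequentially"
    using lim pos(2) by (intro order_tendstoD(2)) auto
  then have evr: "eventually (\<lambda>k. N \<le> k \<and> h k < l + r0) sequentially"
    using eventually_ge_at_top[of N] by eventually_elim auto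
  then obtain N1 where N1: "\<And>k. N1 \<le> k \<Longrightarrow> N \<le> k \<and> h k < l + r0"
    unfolding eventually_sequentially by blast
  have gap: "(\<lambda>k. h k - l) \<longlonglongrightarrow> 0" using lim by (simp add: LIM_zero)
  have mem: "eventually (\<lambda>k. h k - l \<in> {0..<r0}) sequentially"
    using evr by eventually_elim (use hl in auto)
  have "continuous (at 0 within {0..<r0}) \<phi>"
    using \<phi>(3) pos(2) by (simp add: continuous_on_eq_continuous_within)
  then have "(\<lambda>k. \<phi> (h k - l)) \<longlonglongrightarrow> \<phi> 0"
    by (rule continuous_within_tendsto_compose[OF _ mem gap])
  then have Elim: "E \<longlonglongrightarrow> 0" by (simp add: E_def[abs_def] \<phi>(1))
  have E0: "0 \<le> E k" if "N1 \<le> k" for k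
    unfolding E_def using N1[OF that] hl[of k] by (intro \<phi>(2)) auto
  \<comment> \<open>A zero gap is included: the step vanishes then, because \<open>h\<close> cannot fall below \<open>l\<close>.\<close>
  have contract: "3 * D (Suc k) \<le> D k + 4 * G * (E (Suc k) - E (Suc (Suc k)))"
    if k: "N1 \<le> k" and near: "norm (x (Suc k) - xs) < \<delta>" for k
  proof -
    have N: "N \<le> k" "N \<le> Suc k" "N \<le> Suc (Suc k)" using N1[OF k] by auto
    have hr: "h (Suc k) < l + r0" using N1[of "Suc k"] k by auto
    have desc: "h (Suc (Suc k)) \<le> h (Suc k) - c * (D (Suc k))\<^sup>2" using descent[OF N(2)] .
    show ?thesis
    proof (cases "h (Suc k) = l")
      case True
      have "c * (D (Suc k))\<^sup>2 \<le> 0" using desc hl[OF N(3)] True by linarith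
      then have "D (Suc k) = 0" using c by (simp add: mult_le_0_iff)
      moreover have "h (Suc (Suc k)) = l" using decr[OF N(2)] hl[OF N(3)] True by simp
      ultimately show ?thesis using True D0 by (simp add: E_def)
    next
      case False
      then have gt: "l < h (Suc k)" using hl[OF N(2)] by simp
      define a where "a = h (Suc k) - l"
      define t where "t = h (Suc (Suc k)) - l"
      define S where "S = D k + D (Suc k)"
      define W where "W = G * (E (Suc k) - E (Suc (Suc k)))"
      have at: "0 < a" "a < r0" "0 \<le> t" "t \<le> a"
        using gt hr hl[OF N(3)] decr[OF N(2)] by (auto simp: a_def t_def)
      have 1: "1 \<le> \<psi> a * (b * S)"
        using KL[OF N(1) near gt hr] by (simp add: a_def S_def)
      have "\<psi> a * (c * (D (Suc k))\<^sup>2) \<le> \<psi> a * (a - t)"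
        using desc \<psi>[OF at(1,2)] by (intro mult_left_mono) (auto simp: a_def t_def)
      also have "\<dots> \<le> E (Suc k) - E (Suc (Suc k))"
        using tangent[OF at] by (simp add: E_def a_def t_def)
      finally have 2: "\<psi> a * (c * (D (Suc k))\<^sup>2) \<le> E (Suc k) - E (Suc (Suc k))" .
      have S0: "0 \<le> S" using D0 by (simp add: S_def)
      have "c * (D (Suc k))\<^sup>2 * 1 \<le> c * (D (Suc k))\<^sup>2 * (\<psi> a * (b * S))"
        using 1 c by (intro mult_left_mono) auto
      also have "\<dots> = \<psi> a * (c * (D (Suc k))\<^sup>2) * (b * S)" by simp
      also have "\<dots> \<le> (E (Suc k) - E (Suc (Suc k))) * (b * S)"
        using 2 S0 pos by (intro mult_right_mono) auto
      finally have DS: "(D (Suc k))\<^sup>2 \<le> W * S"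
        using c by (simp add: W_def G_def field_simps)
      have W0: "0 \<le> W"
      proof -
        have "0 \<le> \<psi> a * (c * (D (Suc k))\<^sup>2)" using \<psi>[OF at(1,2)] c by simp
        then show ?thesis using 2 G by (simp add: W_def)
      qed
      \<comment> \<open>The arithmetic-geometric mean inequality for \<open>S\<close> and \<open>4 W\<close>.\<close>
      have "(4 * D (Suc k))\<^sup>2 \<le> 16 * (W * S)" using DS by (simp add: power_mult_distrib)
      also have "\<dots> \<le> (S + 4 * W)\<^sup>2"
        using zero_le_power2[of "S - 4 * W"] by (simp add: power2_eq_square algebra_simps)
      finally have "4 * D (Suc k) \<le> S + 4 * W"
        using S0 W0 by (intro power2_le_imp_le[of "4 * D (Suc k)" "S + 4 * W"]) auto
      then show ?thesis by (simp add: S_def W_def)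
    qed
  qed
  have summed: "2 * norm (x (Suc n) - x (Suc K)) + D n \<le> D K + 4 * G * (E (Suc K) - E (Suc n))"
    if "K \<le> n" "N1 \<le> K" "\<And>j. K \<le> j \<Longrightarrow> j < n \<Longrightarrow> norm (x (Suc j) - xs) < \<delta>" for n K
    using that(1,3)
  proof (induction n rule: dec_induct)
    case base
    then show ?case by simp
  next
    case (step n)
    have "2 * norm (x (Suc n) - x (Suc K)) + D n \<le> D K + 4 * G * (E (Suc K) - E (Suc n))"
      using step by auto
    moreover have "3 * D (Suc n) \<le> D n + 4 * G * (E (Suc n) - E (Suc (Suc n)))"
      using step that(2) by (intro contract) auto
    moreover have "norm (x (Suc (Suc n)) - x (Suc K)) \<le> D (Suc n) + norm (x (Suc n) - x (Suc K))"
      using norm_triangle_ineq[of "x (Suc (Suc n)) - x (Suc n)" "x (Suc n) - x (Suc K)"] by (simp add: D)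
    ultimately show ?case by (simp add: algebra_simps)
  qed
  have bound: "norm (x (Suc n) - x (Suc K)) \<le> D K + 2 * G * E (Suc K)"
    if "K \<le> n" "N1 \<le> K" "\<And>j. K \<le> j \<Longrightarrow> j < n \<Longrightarrow> norm (x (Suc j) - xs) < \<delta>" for n K
  proof -
    have "0 \<le> G * E (Suc n)" using E0[of "Suc n"] that(1,2) G by simp
    then show ?thesis using summed[OF that] D0[of n] D0[of K] by (simp add: algebra_simps)
  qed
  have xr: "(\<lambda>j. x (Suc (r j))) \<longlonglongrightarrow> xs"
  proof -
    have "(\<lambda>j. norm (x (Suc (r j)) - x (r j))) \<longlonglongrightarrow> 0"
      using LIMSEQ_subseq_LIMSEQ[OF Dlim r(1)] by (simp add: D comp_def)
    then have "(\<lambda>j. x (Suc (r j)) - x (r j)) \<longlonglongrightarrow> 0" by (simp add: tendsto_norm_zero_iff)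
    from tendsto_add[OF this r(2)] show ?thesis by (simp add: comp_def)
  qed
  have Blim: "(\<lambda>k. D k + 2 * G * E (Suc k)) \<longlonglongrightarrow> 0"
  proof -
    have "(\<lambda>k. D k + 2 * G * E (Suc k)) \<longlonglongrightarrow> 0 + 2 * G * 0"
      by (intro tendsto_intros Dlim LIMSEQ_Suc Elim)
    then show ?thesis by simp
  qed
  have "eventually (\<lambda>k. D k + 2 * G * E (Suc k) < \<delta> / 2) sequentially"
    using Blim pos(1) by (intro order_tendstoD(2)) auto
  then have "eventually (\<lambda>j. D (r j) + 2 * G * E (Suc (r j)) < \<delta> / 2) sequentially"
    by (rule eventually_compose_filterlim) (rule filterlim_subseq[OF r(1)])
  moreover have "eventually (\<lambda>j. dist (x (Suc (r j))) xs < \<delta> / 2) sequentially"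
    using xr pos(1) by (intro tendstoD) auto
  moreover have "eventually (\<lambda>j. N1 \<le> r j) sequentially"
    using filterlim_subseq[OF r(1)] by (simp add: filterlim_at_top)
  ultimately have "eventually (\<lambda>j. D (r j) + 2 * G * E (Suc (r j)) < \<delta> / 2 \<and>
      dist (x (Suc (r j))) xs < \<delta> / 2 \<and> N1 \<le> r j) sequentially"
    by eventually_elim auto
  then obtain j where j: "D (r j) + 2 * G * E (Suc (r j)) < \<delta> / 2"
      "dist (x (Suc (r j))) xs < \<delta> / 2" "N1 \<le> r j"
    using eventually_happens[of _ sequentially] by auto
  define K where "K = r j"
  have near: "norm (x (Suc n) - xs) < \<delta>" if "K \<le> n" for n
    using that
  proof (induction n rule: less_induct)
    case (less n)
    have "norm (x (Suc n) - x (Suc K)) \<le> D K + 2 * G * E (Suc K)"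
      using less j by (intro bound) (auto simp: K_def)
    then show ?case
      using j norm_triangle_ineq[of "x (Suc n) - x (Suc K)" "x (Suc K) - xs"]
      by (simp add: K_def dist_norm)
  qed
  have est: "norm (x (Suc k) - xs) \<le> D k + 2 * G * E (Suc k)" if k: "K \<le> k" for k
  proof -
    have "(\<lambda>j. norm (x (Suc (r j)) - x (Suc k))) \<longlonglongrightarrow> norm (xs - x (Suc k))"
      by (intro tendsto_intros xr)
    moreover have "eventually (\<lambda>j. k \<le> r j) sequentially"
      using filterlim_subseq[OF r(1)] by (simp add: filterlim_at_top)
    then have "eventually (\<lambda>j. norm (x (Suc (r j)) - x (Suc k)) \<le> D k + 2 * G * E (Suc k)) sequentially"
      by eventually_elim (use k j near in \<open>auto intro!: bound simp: K_def\<close>)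
    ultimately have "norm (xs - x (Suc k)) \<le> D k + 2 * G * E (Suc k)"
      by (rule tendsto_upperbound) simp
    then show ?thesis by (simp add: norm_minus_commute)
  qed
  then show "\<exists>K. \<forall>k\<ge>K. norm (x (Suc k) - xs) \<le> D k + 2 * (b / c) * \<phi> (h (Suc k) - l)"
    by (auto simp: G_def E_def)
  have "eventually (\<lambda>k. norm (x (Suc k) - xs) \<le> D k + 2 * G * E (Suc k)) sequentially"
    using est unfolding eventually_sequentially by blast
  from Lim_null_comparison[OF this Blim] have "(\<lambda>k. x (Suc k)) \<longlonglongrightarrow> xs"
    by (simp add: LIM_zero_iff)
  then show "x \<longlonglongrightarrow> xs" by (rule LIMSEQ_imp_Suc)
qed

section \<open>Rates from a Kurdyka--Lojasiewicz exponent\<close>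

text \<open>A contraction over two steps by the factor \<open>q\<close> is a geometric bound with ratio \<open>sqrt q\<close>;
  the induction carries two consecutive indices.\<close>

lemma two_step_linear_rate:
  fixes u :: "nat \<Rightarrow> real"
  assumes u0: "\<And>k. N \<le> k \<Longrightarrow> 0 \<le> u k" and decr: "\<And>k. N \<le> k \<Longrightarrow> u (Suc k) \<le> u k"
    and q: "0 < q" "q < 1" and rec: "\<And>k. N \<le> k \<Longrightarrow> u (Suc (Suc k)) \<le> q * u k"
  obtains A a where "0 < A" "0 < a" "a < 1" "\<And>k. N \<le> k \<Longrightarrow> u k \<le> A * a ^ k"
proof -
  define a where "a = sqrt q"
  have a: "0 < a" "a < 1" "a * a = q" using q by (auto simp: a_def)
  define A where "A = (u N + 1) / a ^ Suc N"
  have A: "0 < A" using u0[of N] a by (simp add: A_def add_nonneg_pos)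
  have eN: "A * a ^ Suc N = u N + 1" using a by (simp add: A_def)
  have "A * a ^ Suc N \<le> A * a ^ N" using a A by (intro mult_left_mono power_decreasing) auto
  then have base: "u N \<le> A * a ^ N" "u (Suc N) \<le> A * a ^ Suc N"
    using eN decr[of N] by linarith+
  have both: "u k \<le> A * a ^ k \<and> u (Suc k) \<le> A * a ^ Suc k" if "N \<le> k" for k
    using that
  proof (induction k rule: dec_induct)
    case (step k)
    have "u (Suc (Suc k)) \<le> q * u k" using rec step by auto
    also have "\<dots> \<le> q * (A * a ^ k)" using step q by (intro mult_left_mono) auto
    also have "\<dots> = A * a ^ Suc (Suc k)" by (simp flip: a(3))
    finally show ?case using step by auto
  qed (use base in auto)
  show thesis using that[of A a] A a both by blast
qed

text \<open>The sequence of powers \<open>v powr (1 - p)\<close> grows by a fixed amount in every step. The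
  convexity of \<open>s powr (1 - p)\<close> at 1 bounds the growth below by \<open>(p - 1) * v powr (1 - p) * (1 - v'/v)\<close>.
  If \<open>v'\<close> is at least half of \<open>v\<close>, the recursion makes this at least a constant; otherwise it is at least \<open>(p - 1) / 2\<close> times
  \<open>v powr (1 - p)\<close>, and \<open>v\<close> is bounded above by \<open>V\<close>.\<close>

lemma powr_gap_one_step:
  fixes v v' :: real
  assumes v: "0 < v'" "v' \<le> v" "v \<le> V" and p: "1 < p" and C: "0 < C"
    and rec: "C * v' powr p \<le> v - v'"
  shows "v powr (1 - p) + min ((p - 1) * C * (1/2) powr p) ((p - 1) / 2 * V powr (1 - p))
    \<le> v' powr (1 - p)"
proof -
  have v0: "0 < v" using v by simp
  define s where "s = v' / v"
  have s: "0 < s" using v v0 by (simp add: s_def)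
  have "1 + (p - 1) * (1 - s) \<le> 1 + (p - 1) * (- ln s)"
    using ln_le_minus_one[OF s] p by (intro add_left_mono mult_left_mono) auto
  also have "\<dots> \<le> exp ((p - 1) * (- ln s))" by (rule exp_ge_add_one_self)
  also have "\<dots> = s powr (1 - p)" using s by (simp add: powr_def algebra_simps)
  finally have "v powr (1 - p) * (1 + (p - 1) * (1 - s)) \<le> v powr (1 - p) * s powr (1 - p)"
    by (intro mult_left_mono) auto
  also have "v powr (1 - p) * s powr (1 - p) = v' powr (1 - p)"
    using v0 s v by (simp add: s_def flip: powr_mult)
  finally have 1: "v powr (1 - p) + (p - 1) * (v powr (1 - p) * (1 - s)) \<le> v' powr (1 - p)"
    by (simp add: algebra_simps)
  have "min ((p - 1) * C * (1/2) powr p) ((p - 1) / 2 * V powr (1 - p))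
     \<le> (p - 1) * (v powr (1 - p) * (1 - s))"
  proof (cases "1/2 \<le> s")
    case True
    have "(1/2) powr p * C = v powr (- p) * (C * (v / 2) powr p)"
      using v0 by (simp add: powr_divide powr_minus field_simps)
    also have "\<dots> \<le> v powr (- p) * (C * v' powr p)"
      using True v0 C p by (intro mult_left_mono powr_mono2) (auto simp: s_def field_simps)
    also have "\<dots> \<le> v powr (- p) * (v - v')"
      using rec by (intro mult_left_mono) auto
    also have "\<dots> = v powr (1 - p) * (1 - s)"
      using v0 by (simp add: s_def powr_diff powr_minus field_simps)
    finally have "(p - 1) * (C * (1/2) powr p) \<le> (p - 1) * (v powr (1 - p) * (1 - s))"
      using p by (intro mult_left_mono) (auto simp: mult.commute)
    then show ?thesis by (simp add: min_le_iff_disj mult.assoc)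
  next
    case False
    have "V powr (1 - p) * (1/2) \<le> v powr (1 - p) * (1 - s)"
      using False v v0 p by (intro mult_mono powr_mono2') auto
    then have "(p - 1) * (V powr (1 - p) * (1/2)) \<le> (p - 1) * (v powr (1 - p) * (1 - s))"
      using p by (intro mult_left_mono) auto
    then show ?thesis by (simp add: min_le_iff_disj)
  qed
  with 1 show ?thesis by linarith
qed

text \<open>By the preceding lemma \<open>u k powr (1 - p)\<close> grows at least linearly in \<open>k\<close>; taking
  the power \<open>-1/(p - 1)\<close> gives the bound. The case that \<open>u\<close> reaches 0 is separate because \<open>0 powr (1 - p) = 0\<close>.\<close>

lemma two_step_sublinear_rate:
  fixes u :: "nat \<Rightarrow> real"
  assumes u0: "\<And>k. N \<le> k \<Longrightarrow> 0 \<le> u k" and decr: "\<And>k. N \<le> k \<Longrightarrow> u (Suc k) \<le> u k"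
    and p: "1 < p" and C: "0 < C"
    and rec: "\<And>k. N \<le> k \<Longrightarrow> C * u (Suc (Suc k)) powr p \<le> u k - u (Suc (Suc k))"
  obtains A K where "0 < A" "\<And>k. K \<le> k \<Longrightarrow> u k \<le> A * real k powr (- (1 / (p - 1)))"
proof (cases "\<exists>m\<ge>N. u m = 0")
  case True
  then obtain m where m: "N \<le> m" "u m = 0" by auto
  have "u k \<le> 1 * real k powr (- (1 / (p - 1)))" if "m \<le> k" for k
  proof -
    from that have "u k \<le> 0"
      by (induction k rule: dec_induct) (use m decr in \<open>auto intro: order_trans\<close>)
    then show ?thesis by (simp add: order_trans[OF _ powr_ge_zero])
  qed
  then show thesis using that[of 1 m] by simp
next
  case False
  then have up: "0 < u k" if "N \<le> k" for k using u0[OF that] that by (force simp: less_le)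
  define \<mu> where "\<mu> = min ((p - 1) * C * (1/2) powr p) ((p - 1) / 2 * u N powr (1 - p))"
  have \<mu>: "0 < \<mu>" using p C up[of N] by (simp add: \<mu>_def)
  have mono: "u n \<le> u m" if "N \<le> m" "m \<le> n" for m n
    using that(2) by (induction n rule: dec_induct) (use that(1) decr in \<open>auto intro: order_trans\<close>)
  have grow: "real j * \<mu> \<le> u (N + 2 * j) powr (1 - p)" for j
  proof (induction j)
    case (Suc j)
    have "u (N + 2 * j) powr (1 - p) + \<mu> \<le> u (Suc (Suc (N + 2 * j))) powr (1 - p)"
      unfolding \<mu>_def using p C rec[of "N + 2 * j"]
      by (intro powr_gap_one_step up mono) auto
    then show ?case using Suc by (simp add: algebra_simps)
  qed simp
  have "u k \<le> (\<mu> / 4) powr (- (1 / (p - 1))) * real k powr (- (1 / (p - 1)))" if k: "2 * N + 2 \<le> k" for k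
  proof -
    define j where "j = (k - N) div 2"
    have j: "N + 2 * j \<le> k" "k \<le> 4 * j" using k by (auto simp: j_def)
    have uk: "0 < u k" using k by (intro up) auto
    have "\<mu> / 4 * real k \<le> real j * \<mu>"
      using j(2) \<mu> by simp
    also have "\<dots> \<le> u (N + 2 * j) powr (1 - p)" by (rule grow)
    also have "\<dots> \<le> u k powr (1 - p)"
      using p uk j by (intro powr_mono2' mono) auto
    finally have "(u k powr (1 - p)) powr (- (1 / (p - 1))) \<le> (\<mu> / 4 * real k) powr (- (1 / (p - 1)))"
      using p \<mu> k by (intro powr_mono2') auto
    moreover have "(1 - p) * (- (1 / (p - 1))) = 1" using p by (simp add: field_simps)
    then have "(u k powr (1 - p)) powr (- (1 / (p - 1))) = u k"
      using uk by (simp only: powr_powr) simp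
    moreover have "(\<mu> / 4 * real k) powr (- (1 / (p - 1))) = (\<mu> / 4) powr (- (1 / (p - 1))) * real k powr (- (1 / (p - 1)))"
      by (rule powr_mult)
    ultimately show ?thesis by simp
  qed
  moreover have "0 < (\<mu> / 4) powr (- (1 / (p - 1)))" using \<mu> by simp
  ultimately show thesis using that by blast
qed

text \<open>Adding two consecutive descent inequalities and inserting the Kurdyka--Lojasiewicz
  inequality gives \<open>C * u (k + 2) powr (2 \<alpha>) \<le> u k - u (k + 2)\<close>. Two steps are taken because the subgradient bound involves
  two consecutive step lengths. For \<open>\<alpha> \<le> 1/2\<close> the power may be replaced by the first power as soon as
  \<open>u \<le> 1\<close>, which gives a linear rate; for \<open>\<alpha> > 1/2\<close> the rate is sublinear. The distance to the limit is
  bounded by \<open>u k\<close> to the power \<open>min (1/2) (1 - \<alpha>)\<close>. For \<open>\<alpha> = 0\<close> the inequality bounds the sum of two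
  consecutive steps away from 0, so it cannot apply infinitely often.\<close>

lemma KL_exponent_rates:
  fixes x :: "nat \<Rightarrow> 'a::real_normed_vector" and u D :: "nat \<Rightarrow> real"
  assumes \<alpha>: "0 \<le> \<alpha>" "\<alpha> < 1" and c: "0 < c" and A: "0 < A" and G: "0 < G"
    and D0: "\<And>k. 0 \<le> D k" and u0: "\<And>k. N \<le> k \<Longrightarrow> 0 \<le> u k" and ulim: "u \<longlonglongrightarrow> 0"
    and descent: "\<And>k. N \<le> k \<Longrightarrow> u (Suc k) \<le> u k - c * (D k)\<^sup>2"
    and est: "\<And>k. N \<le> k \<Longrightarrow> norm (x (Suc k) - xs) \<le> D k + A * u (Suc k) powr (1 - \<alpha>)"
    and KL: "\<And>k. N \<le> k \<Longrightarrow> 0 < u (Suc k) \<Longrightarrow>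
        1 \<le> G * u (Suc k) powr (- \<alpha>) * (D k + D (Suc k))"
  shows "\<exists>M::nat.
     (\<alpha> = 0 \<longrightarrow> (\<forall>k>M. x k = xs)) \<and>
     (0 < \<alpha> \<and> \<alpha> \<le> 1/2 \<longrightarrow>
        (\<exists>a0 a1. 0 < a0 \<and> a0 < 1 \<and> 0 < a1 \<and> (\<forall>k>M. norm (x k - xs) \<le> a1 * a0 ^ k))) \<and>
     (1/2 < \<alpha> \<longrightarrow>
        (\<exists>a2>0. \<forall>k>M. norm (x k - xs) \<le> a2 * real k powr (- ((1 - \<alpha>) / (2 * \<alpha> - 1)))))"
proof -
  have decr: "u (Suc k) \<le> u k" if "N \<le> k" for k
  proof -
    have "0 \<le> c * (D k)\<^sup>2" using c by simp
    then show ?thesis using descent[OF that] by linarith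
  qed
  have Dlim: "D \<longlonglongrightarrow> 0" using descent_step_sizes_vanish[OF c descent ulim] .
  have "eventually (\<lambda>k. u k < 1) sequentially" using ulim by (intro order_tendstoD(2)) auto
  then have "eventually (\<lambda>k. N \<le> k \<and> u k < 1) sequentially"
    using eventually_ge_at_top[of N] by eventually_elim auto
  then obtain N1 where N1: "\<And>k. N1 \<le> k \<Longrightarrow> N \<le> k \<and> u k < 1"
    unfolding eventually_sequentially by blast
  define \<kappa> where "\<kappa> = min (1/2) (1 - \<alpha>)"
  have \<kappa>le: "\<kappa> \<le> 1/2" "\<kappa> \<le> 1 - \<alpha>"
    unfolding \<kappa>_def by (rule min.cobounded1, rule min.cobounded2)
  define B where "B = 1 / sqrt c + A"
  have B: "0 < B" using c A by (simp add: B_def add_pos_pos)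
  have est': "norm (x (Suc k) - xs) \<le> B * u k powr \<kappa>" if k: "N1 \<le> k" for k
  proof -
    have N: "N \<le> k" "u k \<le> 1" "0 \<le> u k" using N1[OF k] u0 by auto
    have "(D k)\<^sup>2 \<le> u k / c" using descent[OF N(1)] u0[of "Suc k"] N c by (simp add: field_simps)
    then have "D k \<le> sqrt (u k / c)" by (rule real_le_rsqrt)
    also have "\<dots> = 1 / sqrt c * u k powr (1/2)"
      using N(3) by (simp add: real_sqrt_divide powr_half_sqrt)
    also have "\<dots> \<le> 1 / sqrt c * u k powr \<kappa>"
    proof (intro mult_left_mono)
      show "u k powr (1/2) \<le> u k powr \<kappa>"
        using N \<kappa>le by (cases "u k = 0") (simp_all add: powr_mono')
    qed (use c in auto)
    finally have 1: "D k \<le> 1 / sqrt c * u k powr \<kappa>" .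
    have "u (Suc k) powr (1 - \<alpha>) \<le> u k powr (1 - \<alpha>)"
      using \<alpha> decr[OF N(1)] u0[of "Suc k"] N by (intro powr_mono2) auto
    also have "\<dots> \<le> u k powr \<kappa>"
      using N \<kappa>le by (cases "u k = 0") (simp_all add: powr_mono')
    finally have "A * u (Suc k) powr (1 - \<alpha>) \<le> A * u k powr \<kappa>" using A by simp
    then show ?thesis using est[OF N(1)] 1 by (simp add: B_def algebra_simps)
  qed
  define C where "C = c / (2 * G\<^sup>2)"
  have C: "0 < C" using c G by (simp add: C_def)
  have rec: "C * u (Suc (Suc k)) powr (2 * \<alpha>) \<le> u k - u (Suc (Suc k))" if k: "N \<le> k" for k
  proof (cases "u (Suc (Suc k)) = 0")
    case True
    then show ?thesis using u0[OF k] by simp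
  next
    case False
    define S where "S = D k + D (Suc k)"
    have u2: "0 < u (Suc (Suc k))" using False u0[of "Suc (Suc k)"] k by simp
    have le: "u (Suc (Suc k)) \<le> u (Suc k)" using decr[of "Suc k"] k by simp
    have u1: "0 < u (Suc k)" using u2 le by simp
    have S0: "0 \<le> S" using D0 by (simp add: S_def)
    have "u (Suc (Suc k)) powr \<alpha> \<le> u (Suc k) powr \<alpha>" using \<alpha> le u2 by (intro powr_mono2) auto
    also have "\<dots> \<le> G * S"
      using KL[OF k u1] u1 by (simp add: S_def powr_minus field_simps)
    finally have "(u (Suc (Suc k)) powr \<alpha>)\<^sup>2 \<le> (G * S)\<^sup>2" by (intro power_mono) auto
    moreover have "(u (Suc (Suc k)) powr \<alpha>)\<^sup>2 = u (Suc (Suc k)) powr (2 * \<alpha>)"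
      by (simp add: power2_eq_square flip: powr_add)
    ultimately have "C * u (Suc (Suc k)) powr (2 * \<alpha>) \<le> C * (G * S)\<^sup>2" using C by simp
    also have "\<dots> = c / 2 * S\<^sup>2" using G by (simp add: C_def power_mult_distrib)
    also have "\<dots> \<le> c * ((D k)\<^sup>2 + (D (Suc k))\<^sup>2)"
    proof -
      have "S\<^sup>2 \<le> 2 * ((D k)\<^sup>2 + (D (Suc k))\<^sup>2)"
        using zero_le_power2[of "D k - D (Suc k)"]
        by (simp add: S_def power2_eq_square algebra_simps)
      then show ?thesis using c by simp
    qed
    also have "\<dots> \<le> u k - u (Suc (Suc k))"
      using descent[OF k] descent[of "Suc k"] k by (simp add: algebra_simps)
    finally show ?thesis .
  qed
  consider (zero) "\<alpha> = 0" | (half) "0 < \<alpha>" "\<alpha> \<le> 1/2" | (large) "1/2 < \<alpha>" using \<alpha> by linarith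
  then show ?thesis
  proof cases
    case zero
    have "(\<lambda>k. G * (D k + D (Suc k))) \<longlonglongrightarrow> G * (0 + 0)"
      by (intro tendsto_intros Dlim LIMSEQ_Suc)
    then have "eventually (\<lambda>k. G * (D k + D (Suc k)) < 1) sequentially"
      by (intro order_tendstoD(2)) auto
    then obtain M where M: "\<And>k. M \<le> k \<Longrightarrow> G * (D k + D (Suc k)) < 1"
      unfolding eventually_sequentially by blast
    have "x k = xs" if k: "max M N1 + 1 < k" for k
    proof -
      obtain n where n: "k = Suc (Suc n)" "M \<le> n" "N1 \<le> n"
        using k by (intro that[of "k - 2"]) auto
      have N: "N \<le> n" using N1 n by auto
      have "u (Suc n) = 0"
      proof (rule ccontr)
        assume "u (Suc n) \<noteq> 0"
        then have "0 < u (Suc n)" using u0[of "Suc n"] N by simp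
        then show False using KL[OF N] M[OF n(2)] zero by simp
      qed
      then have "norm (x k - xs) \<le> 0" using est'[of "Suc n"] n by simp
      then show ?thesis by simp
    qed
    then show ?thesis using zero by (intro exI[of _ "max M N1 + 1"]) auto
  next
    case half
    have lin: "u (Suc (Suc k)) \<le> 1 / (1 + C) * u k" if k: "N1 \<le> k" for k
    proof -
      have N: "N \<le> k" "u (Suc (Suc k)) < 1" "0 \<le> u (Suc (Suc k))"
        using N1[OF k] N1[of "Suc (Suc k)"] k u0[of "Suc (Suc k)"] by auto
      have "u (Suc (Suc k)) \<le> u (Suc (Suc k)) powr (2 * \<alpha>)"
        using N half powr_mono'[of "2 * \<alpha>" 1 "u (Suc (Suc k))"] by (cases "u (Suc (Suc k)) = 0") auto
      then have "C * u (Suc (Suc k)) \<le> C * u (Suc (Suc k)) powr (2 * \<alpha>)" using C by simp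
      also have "\<dots> \<le> u k - u (Suc (Suc k))" by (rule rec[OF N(1)])
      finally show ?thesis using C by (simp add: field_simps)
    qed
    obtain A' a where a: "0 < A'" "0 < a" "a < 1" "\<And>k. N1 \<le> k \<Longrightarrow> u k \<le> A' * a ^ k"
    proof (rule two_step_linear_rate[of N1 u "1 / (1 + C)"])
      show "0 \<le> u k" "u (Suc k) \<le> u k" if "N1 \<le> k" for k
        using u0 decr N1[OF that] by auto
    qed (use C lin in auto)
    have \<kappa>: "\<kappa> = 1/2" using half by (simp add: \<kappa>_def)
    have "norm (x k - xs) \<le> (B * sqrt A' / sqrt a) * sqrt a ^ k" if k: "N1 < k" for k
    proof -
      obtain n where n: "k = Suc n" "N1 \<le> n" using k by (intro that[of "k - 1"]) auto
      have "u n powr \<kappa> = sqrt (u n)" using u0[of n] N1[OF n(2)] unfolding \<kappa> by (simp add: powr_half_sqrt)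
      also have "\<dots> \<le> sqrt (A' * a ^ n)" using a(4)[OF n(2)] by simp
      also have "\<dots> = sqrt A' * sqrt a ^ n" by (simp add: real_sqrt_mult real_sqrt_power)
      finally have "B * u n powr \<kappa> \<le> B * (sqrt A' * sqrt a ^ n)" using B by simp
      then show ?thesis using est'[OF n(2)] a n(1) by simp
    qed
    moreover have "0 < B * sqrt A' / sqrt a" using a B by simp
    moreover have "0 < sqrt a" "sqrt a < 1" using a by auto
    ultimately have "\<exists>a0 a1. 0 < a0 \<and> a0 < 1 \<and> 0 < a1 \<and> (\<forall>k>N1. norm (x k - xs) \<le> a1 * a0 ^ k)"
      by blast
    then show ?thesis using half by (intro exI[of _ N1]) simp
  next
    case large
    define e where "e = (1 - \<alpha>) / (2 * \<alpha> - 1)"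
    have e: "0 < e" using large \<alpha> by (simp add: e_def)
    have \<kappa>: "\<kappa> = 1 - \<alpha>" using large by (simp add: \<kappa>_def)
    obtain A' K where A': "0 < A'" "\<And>k. K \<le> k \<Longrightarrow> u k \<le> A' * real k powr (- (1 / (2 * \<alpha> - 1)))"
      using two_step_sublinear_rate[of N u "2 * \<alpha>" C, OF u0 decr _ C rec] large by auto
    have "norm (x k - xs) \<le> (B * A' powr \<kappa> * 2 powr e) * real k powr (- e)" if k: "max K (max N1 1) < k" for k
    proof -
      obtain n where n: "k = Suc n" "N1 \<le> n" "K \<le> n" "1 \<le> n"
        using k by (intro that[of "k - 1"]) auto
      have "u n powr \<kappa> \<le> (A' * real n powr (- (1 / (2 * \<alpha> - 1)))) powr \<kappa>"
        using A'(2)[OF n(3)] u0[of n] N1[OF n(2)] \<alpha> \<kappa> by (intro powr_mono2) auto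
      also have "\<dots> = A' powr \<kappa> * real n powr (- e)"
        using A'(1) by (simp add: powr_mult powr_powr \<kappa> e_def)
      also have "\<dots> \<le> A' powr \<kappa> * (real k / 2) powr (- e)"
        using n e by (intro mult_left_mono powr_mono2') auto
      also have "\<dots> = A' powr \<kappa> * (2 powr e * real k powr (- e))"
        using k by (simp add: powr_divide powr_minus field_simps)
      finally have "B * u n powr \<kappa> \<le> B * (A' powr \<kappa> * (2 powr e * real k powr (- e)))" using B by simp
      then show ?thesis using est'[OF n(2)] n(1) by (simp add: mult.assoc)
    qed
    moreover have "0 < B * A' powr \<kappa> * 2 powr e" using B A' by simp
    ultimately have "\<exists>a2>0. \<forall>k>max K (max N1 1). norm (x k - xs) \<le> a2 * real k powr (- e)"
      by blast
    then show ?thesis using large unfolding e_def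
      by (intro exI[of _ "max K (max N1 1)"]) simp
  qed
qed

section \<open>Descent of the merit values along a run\<close>

locale ESQMe_run =
  fixes P P1 P2 :: "'a::euclidean_space \<Rightarrow> real"
    and g g1 g2 :: "'m::finite \<Rightarrow> 'a \<Rightarrow> real"
    and C :: "'a set"
    and L l :: "'m \<Rightarrow> real" and Lg lg d :: real
    and \<beta> s \<theta> :: "nat \<Rightarrow> real"
    and x y \<xi> :: "nat \<Rightarrow> 'a"
  assumes P1: "convex_on UNIV P1" and P2: "convex_on UNIV P2"
    and P_eq: "P = (\<lambda>u. P1 u - P2 u)"
    and g_smooth: "\<And>i. \<exists>K. lipschitz_gradient K (g i)"
    and C_compact: "compact C" and C_convex: "convex C"
    and g_eq: "\<And>i. g i = (\<lambda>u. g1 i u - g2 i u)"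
    and g1: "\<And>i. convex_on UNIV (g1 i)" and g2: "\<And>i. convex_on UNIV (g2 i)"
    and g1_lip: "\<And>i. lipschitz_gradient (L i) (g1 i)"
    and g2_lip: "\<And>i. lipschitz_gradient (l i) (g2 i)"
    and L_pos: "\<And>i. 0 < L i" and l_nonneg: "\<And>i. 0 \<le> l i"
    and Lg_eq: "Lg = (MAX i. L i)" and lg_eq: "lg = (MAX i. l i)"
    and A: "assumption_A g C"
    and B: "assumption_B P1 P2 g C"
    and run: "ESQMe P1 P2 g C Lg lg d \<beta> x y \<xi> s \<theta>"
begin

definition violation :: "'a \<Rightarrow> 'a \<Rightarrow> real" where
  "violation u w = pos_max (\<lambda>i. lin (g i) u w)"

definition P_inf :: real where "P_inf = (INF u\<in>C. P u)"

definition D :: "nat \<Rightarrow> real" where "D k = norm (x (Suc k) - x k)"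

text \<open>For \<open>t\<close> the eventual penalty parameter this is the potential at \<open>(x (Suc k), x k, y k)\<close>. The parameter
  is left free because descent has to be established before the penalty parameter is known to settle.\<close>

definition merit :: "real \<Rightarrow> nat \<Rightarrow> real" where
  "merit t k = (P (x (Suc k)) - P_inf) / t + violation (x (Suc k)) (y k)
     + Lg / 2 * (norm (x (Suc k) - x k))\<^sup>2 + Lg / 2 * (norm (x (Suc k) - y k))\<^sup>2"

lemma L_le: "L i \<le> Lg" and l_le: "l i \<le> lg"
  unfolding Lg_eq lg_eq by (auto intro: Max_ge)

lemma Lg_pos: "0 < Lg" using L_pos L_le by (rule less_le_trans)

lemma lg_nonneg: "0 \<le> lg" using l_nonneg l_le by (rule order_trans)

lemma g1_diff: "g1 i differentiable (at u)" and g2_diff: "g2 i differentiable (at u)"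
  using g1_lip g2_lip by (auto simp: lipschitz_gradient_def)

lemma g_diff: "g i differentiable (at u)"
  using g_smooth[of i] by (auto simp: lipschitz_gradient_def)

lemma grad_g: "grad (g i) u = grad (g1 i) u - grad (g2 i) u"
  unfolding g_eq by (intro grad_eqI GDERIV_diff GDERIV_grad g1_diff g2_diff)

lemma lin_g: "lin (g i) u w = lin (g1 i) u w - lin (g2 i) u w"
  unfolding lin_def grad_g by (simp add: g_eq inner_diff_left)

lemma convex_lower: "lin (g1 i) u w \<le> g1 i u" "lin (g2 i) u w \<le> g2 i u"
  using grad_in_convex_subdiff[OF g1 g1_diff] grad_in_convex_subdiff[OF g2 g2_diff]
  by (auto simp: lin_def convex_subdiff_def)

text \<open>Linearizing the convex function \<open>g2 i\<close> only helps in this direction, so only the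
  modulus of \<open>grad (g1 i)\<close> enters; in \<open>g_lower\<close> the roles are exchanged.\<close>

lemma g_upper: "g i u \<le> lin (g i) u w + Lg / 2 * (norm (u - w))\<^sup>2"
proof -
  have "g i u \<le> lin (g i) u w + L i / 2 * (norm (u - w))\<^sup>2"
    using lipschitz_gradient_upper[OF g1_lip, of i u w] convex_lower(2)[of i u w]
    by (simp add: lin_g) (simp add: g_eq)
  also have "\<dots> \<le> lin (g i) u w + Lg / 2 * (norm (u - w))\<^sup>2"
    using L_le[of i] by (intro add_left_mono mult_right_mono) auto
  finally show ?thesis .
qed

lemma g_lower: "lin (g i) u w \<le> g i u + lg / 2 * (norm (u - w))\<^sup>2"
proof -
  have "lin (g i) u w \<le> g i u + l i / 2 * (norm (u - w))\<^sup>2"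
    using lipschitz_gradient_upper[OF g2_lip, of i u w] convex_lower(1)[of i u w]
    by (simp add: lin_g) (simp add: g_eq)
  also have "\<dots> \<le> g i u + lg / 2 * (norm (u - w))\<^sup>2"
    using l_le[of i] by (intro add_left_mono mult_right_mono) auto
  finally show ?thesis .
qed

text \<open>Passing from the linearization at the old extrapolated point \<open>w\<close> to the one at the
  new point \<open>w'\<close> goes through the values \<open>g i u\<close> and costs one quadratic term for each of the two linearizations.\<close>

lemma violation_extrapolated:
  "violation u w' \<le> violation u w + Lg / 2 * (norm (u - w))\<^sup>2 + lg / 2 * (norm (u - w'))\<^sup>2"
proof -
  have "lin (g i) u w' \<le> violation u w + Lg / 2 * (norm (u - w))\<^sup>2 + lg / 2 * (norm (u - w'))\<^sup>2" for i
    using g_lower[of i u w'] g_upper[of i u w] le_pos_max[of "\<lambda>i. lin (g i) u w" i]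
    by (simp add: violation_def)
  moreover have "0 \<le> violation u w + Lg / 2 * (norm (u - w))\<^sup>2 + lg / 2 * (norm (u - w'))\<^sup>2"
    using Lg_pos lg_nonneg pos_max_nonneg by (intro add_nonneg_nonneg) (auto simp: violation_def)
  ultimately show ?thesis by (subst violation_def) (simp add: pos_max_le_iff)
qed

lemma run_facts:
  shows x0: "x 0 \<in> C" and theta0: "0 < \<theta> 0" and d_pos: "0 < d"
    and beta: "\<beta> k \<in> {0..<sqrt (Lg / (Lg + lg))}"
    and beta_sup: "(SUP k. \<beta> k) < sqrt (Lg / (Lg + lg))"
    and y_eq: "y k = x k + \<beta> k *\<^sub>R (x k - x (k - 1))"
    and xi: "\<xi> k \<in> convex_subdiff P2 (x k)"
    and argmin: "is_arg_min
            (\<lambda>(u, t). P1 u - \<xi> k \<bullet> u + \<theta> k * t + \<theta> k * Lg / 2 * (norm (u - y k))\<^sup>2)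
            (\<lambda>(u, t). u \<in> C \<and> 0 \<le> t \<and> (\<forall>i. lin (g i) u (y k) \<le> t))
            (x (Suc k), s (Suc k))"
    and theta_Suc: "\<theta> (Suc k) = (if \<forall>i. lin (g i) (x (Suc k)) (y k) \<le> 0 then \<theta> k else \<theta> k + d)"
  using run unfolding ESQMe_def by blast+

lemma x_in_C: "x k \<in> C"
  using x0 argmin[of "k - 1"] by (cases k) (auto simp: is_arg_min_def)

lemma theta_mono: "\<theta> k \<le> \<theta> (Suc k)"
  using d_pos by (simp add: theta_Suc)

lemma theta_mono': "j \<le> k \<Longrightarrow> \<theta> j \<le> \<theta> k"
  using theta_mono by (rule lift_Suc_mono_le)

lemma theta_pos: "0 < \<theta> k"
  using theta0 theta_mono'[of 0 k] by simp

text \<open>The slack variable is eliminated: for given \<open>u\<close> its best value is \<open>violation u (y k)\<close>.\<close>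

lemma subproblem_optimal:
  assumes "u \<in> C"
  shows "P1 (x (Suc k)) - \<xi> k \<bullet> x (Suc k) + \<theta> k * violation (x (Suc k)) (y k)
      + \<theta> k * Lg / 2 * (norm (x (Suc k) - y k))\<^sup>2
    \<le> P1 u - \<xi> k \<bullet> u + \<theta> k * violation u (y k) + \<theta> k * Lg / 2 * (norm (u - y k))\<^sup>2"
proof -
  have feas: "x (Suc k) \<in> C" "0 \<le> s (Suc k)" "\<And>i. lin (g i) (x (Suc k)) (y k) \<le> s (Suc k)"
    using argmin[of k] by (auto simp: is_arg_min_def)
  have opt: "P1 (x (Suc k)) - \<xi> k \<bullet> x (Suc k) + \<theta> k * s (Suc k) + \<theta> k * Lg / 2 * (norm (x (Suc k) - y k))\<^sup>2
      \<le> P1 v - \<xi> k \<bullet> v + \<theta> k * t + \<theta> k * Lg / 2 * (norm (v - y k))\<^sup>2"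
    if "v \<in> C" "0 \<le> t" "\<And>i. lin (g i) v (y k) \<le> t" for v t
  proof (rule ccontr)
    assume "\<not> ?thesis"
    then show False using argmin[of k] that unfolding is_arg_min_def not_le
      by (auto dest!: spec[of _ v] spec[of _ t])
  qed
  have "violation (x (Suc k)) (y k) \<le> s (Suc k)"
    using feas by (simp add: violation_def pos_max_le_iff)
  then have "\<theta> k * violation (x (Suc k)) (y k) \<le> \<theta> k * s (Suc k)"
    using theta_pos[of k] by simp
  moreover have "P1 (x (Suc k)) - \<xi> k \<bullet> x (Suc k) + \<theta> k * s (Suc k) + \<theta> k * Lg / 2 * (norm (x (Suc k) - y k))\<^sup>2
      \<le> P1 u - \<xi> k \<bullet> u + \<theta> k * violation u (y k) + \<theta> k * Lg / 2 * (norm (u - y k))\<^sup>2"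
    using assms unfolding violation_def
    by (intro opt pos_max_nonneg le_pos_max[of "\<lambda>i. lin (g i) u (y k)"])
  ultimately show ?thesis by simp
qed

lemma violation_affine:
  "violation u w = pos_max (\<lambda>i. lin (g i) v w + grad (g i) w \<bullet> (u - v))"
  unfolding violation_def lin_def by (simp add: inner_diff_right algebra_simps)

lemma tilted_P1_convex: "convex_on UNIV (\<lambda>u. P1 u - q \<bullet> u)"
proof -
  have "convex_on UNIV (\<lambda>u. - (q \<bullet> u))"
    by (rule convex_onI) (auto simp: inner_simps algebra_simps)
  from convex_on_add[OF P1 this] show ?thesis by simp
qed

lemma violation_convex: "convex_on UNIV (\<lambda>u. violation u w)"
  unfolding violation_affine[of _ w w] by (rule pos_max_affine_convex)

lemma penalty_KKT_violation:
  assumes v: "v \<in> C" and t: "0 < t"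
    and min: "\<And>u. u \<in> C \<Longrightarrow> P1 v - q \<bullet> v + t * violation v w + t * Lg / 2 * (norm (v - w))\<^sup>2
      \<le> P1 u - q \<bullet> u + t * violation u w + t * Lg / 2 * (norm (u - w))\<^sup>2"
  obtains \<mu> p \<nu> where "p \<in> convex_subdiff P1 v" "\<nu> \<in> normal_cone C v"
    "\<forall>i. 0 \<le> \<mu> i" "sum \<mu> UNIV \<le> 1" "\<forall>i. \<mu> i \<noteq> 0 \<longrightarrow> lin (g i) v w = violation v w"
    "0 < violation v w \<longrightarrow> sum \<mu> UNIV = 1"
    "p - q + t *\<^sub>R (\<Sum>i\<in>UNIV. \<mu> i *\<^sub>R grad (g i) w) + (t * Lg) *\<^sub>R (v - w) + \<nu> = 0"
proof (rule penalty_KKT[OF tilted_P1_convex C_convex v t])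
  show "P1 v - q \<bullet> v + t * pos_max (\<lambda>i. lin (g i) v w) + t * Lg / 2 * (norm (v - w))\<^sup>2
      \<le> P1 z - q \<bullet> z + t * pos_max (\<lambda>i. lin (g i) v w + grad (g i) w \<bullet> (z - v)) + t * Lg / 2 * (norm (z - w))\<^sup>2"
    if "z \<in> C" for z
    using min[OF that] by (simp add: violation_affine[of z w v] violation_def[of v w])
next
  fix \<mu> p \<nu>
  assume K: "p \<in> convex_subdiff (\<lambda>u. P1 u - q \<bullet> u) v" "\<nu> \<in> normal_cone C v"
    "\<And>i. 0 \<le> \<mu> i" "sum \<mu> UNIV \<le> 1" "\<And>i. \<mu> i \<noteq> 0 \<Longrightarrow> lin (g i) v w = pos_max (\<lambda>i. lin (g i) v w)"
    "0 < pos_max (\<lambda>i. lin (g i) v w) \<Longrightarrow> sum \<mu> UNIV = 1"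
    "p + t *\<^sub>R (\<Sum>i\<in>UNIV. \<mu> i *\<^sub>R grad (g i) w) + (2 * (t * Lg / 2)) *\<^sub>R (v - w) + \<nu> = 0"
  show thesis
  proof (rule that[of "p + q" \<nu> \<mu>])
    show "p + q \<in> convex_subdiff P1 v"
      using K(1) by (auto simp: convex_subdiff_def inner_simps algebra_simps)
    show "p + q - q + t *\<^sub>R (\<Sum>i\<in>UNIV. \<mu> i *\<^sub>R grad (g i) w) + (t * Lg) *\<^sub>R (v - w) + \<nu> = 0"
      using K(7) by simp
    show "\<forall>i. \<mu> i \<noteq> 0 \<longrightarrow> lin (g i) v w = violation v w"
      unfolding violation_def by (intro allI impI K(5))
    show "0 < violation v w \<longrightarrow> sum \<mu> UNIV = 1"
      using K(6) unfolding violation_def by blast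
  qed (use K(2-4) in auto)
qed

text \<open>The quadratic term makes the subproblem strongly convex, which gives the additional
  term \<open>(norm (u - x (Suc k)))\<^sup>2\<close> on the left.\<close>

lemma subproblem_growth:
  assumes u: "u \<in> C"
  shows "P1 (x (Suc k)) - \<xi> k \<bullet> x (Suc k) + \<theta> k * violation (x (Suc k)) (y k)
      + \<theta> k * Lg / 2 * (norm (x (Suc k) - y k))\<^sup>2 + \<theta> k * Lg / 2 * (norm (u - x (Suc k)))\<^sup>2
    \<le> P1 u - \<xi> k \<bullet> u + \<theta> k * violation u (y k) + \<theta> k * Lg / 2 * (norm (u - y k))\<^sup>2"
proof -
  define X Y K where "X = x (Suc k)" and "Y = y k" and "K = \<theta> k * Lg / 2"
  define \<psi> where "\<psi> v = P1 v - \<xi> k \<bullet> v + \<theta> k * violation v Y" for v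
  have "convex_on UNIV (\<lambda>v. \<theta> k * violation v Y)"
    using violation_convex theta_pos[of k] by (intro convex_on_cmul) auto
  from convex_on_add[OF tilted_P1_convex this] have conv: "convex_on C \<psi>"
    unfolding \<psi>_def by (rule convex_on_subset) (auto simp: C_convex)
  have "\<psi> X \<le> \<psi> u + 2 * K * ((X - Y) \<bullet> (u - X))"
    using subproblem_optimal[of _ k] u x_in_C[of "Suc k"]
    by (intro quadratic_minorant_removal[OF C_convex conv])
      (auto simp: \<psi>_def X_def Y_def K_def)
  moreover have "(norm (u - Y))\<^sup>2 = (norm (X - Y))\<^sup>2 + 2 * ((X - Y) \<bullet> (u - X)) + (norm (u - X))\<^sup>2"
  proof -
    have "u - Y = (X - Y) + (u - X)" by simp
    then show ?thesis
      by (simp only: power2_norm_eq_inner inner_add_left inner_add_right) (simp add: inner_commute)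
  qed
  from this[THEN arg_cong, of "\<lambda>a. K * a"] have "K * (norm (u - Y))\<^sup>2 = K * (norm (X - Y))\<^sup>2 + 2 * K * ((X - Y) \<bullet> (u - X)) + K * (norm (u - X))\<^sup>2"
    by (simp add: distrib_left)
  ultimately have "\<psi> X + K * (norm (X - Y))\<^sup>2 + K * (norm (u - X))\<^sup>2 \<le> \<psi> u + K * (norm (u - Y))\<^sup>2"
    by linarith
  then show ?thesis by (simp only: \<psi>_def X_def Y_def K_def)
qed

lemma P_ge_P_inf: "u \<in> C \<Longrightarrow> P_inf \<le> P u"
proof -
  assume u: "u \<in> C"
  have "continuous_on UNIV P" unfolding P_eq
    by (intro continuous_on_diff convex_on_continuous P1 P2) auto
  then have "compact (P ` C)"
    using C_compact by (intro compact_continuous_image) (auto intro: continuous_on_subset)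
  then have "bdd_below (P ` C)" by (simp add: compact_imp_bounded bounded_imp_bdd_below)
  then show ?thesis unfolding P_inf_def using u by (intro cINF_lower) auto
qed

definition \<beta>b :: real where "\<beta>b = (SUP k. \<beta> k)"

definition c :: real where "c = (Lg - (Lg + lg) * \<beta>b\<^sup>2) / 2"

lemma beta_le: "\<beta> k \<le> \<beta>b"
  unfolding \<beta>b_def using beta by (intro cSUP_upper) (auto intro!: bdd_aboveI[of _ "sqrt (Lg / (Lg + lg))"] less_imp_le)

lemma beta_nonneg: "0 \<le> \<beta> k" using beta[of k] by simp

lemma betab_nonneg: "0 \<le> \<beta>b" using beta_le[of 0] beta_nonneg[of 0] by simp

text \<open>Positivity restates the bound \<open>\<beta>b < sqrt (Lg / (Lg + lg))\<close>.\<close>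

lemma c_pos: "0 < c"
proof -
  have pos: "0 < Lg + lg" using Lg_pos lg_nonneg by simp
  have "\<beta>b\<^sup>2 < (sqrt (Lg / (Lg + lg)))\<^sup>2"
    using beta_sup betab_nonneg unfolding \<beta>b_def[symmetric] by (intro power_strict_mono) auto
  then have "\<beta>b\<^sup>2 < Lg / (Lg + lg)" using pos Lg_pos by simp
  then show ?thesis using pos by (simp add: c_def field_simps)
qed

lemma beta_le_1: "\<beta> k \<le> 1"
proof -
  have "sqrt (Lg / (Lg + lg)) \<le> 1" using Lg_pos lg_nonneg by simp
  moreover have "\<beta> k \<le> sqrt (Lg / (Lg + lg))" using beta[of k] by simp
  ultimately show ?thesis by (rule order_trans[rotated])
qed

lemma D_nonneg: "0 \<le> D k" by (simp add: D_def)

lemma extrapolation_norm: "norm (x (Suc k) - y (Suc k)) = \<beta> (Suc k) * D k"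
  using beta_nonneg[of "Suc k"] by (simp add: y_eq[of "Suc k"] D_def)

lemma extrapolation_le: "norm (x (Suc k) - y (Suc k)) \<le> D k"
  using mult_right_mono[OF beta_le_1 D_nonneg] by (simp add: extrapolation_norm)

text \<open>Holds because \<open>P - P_inf\<close> is nonnegative on \<open>C\<close>.\<close>

lemma merit_antimono: "0 < t \<Longrightarrow> t \<le> t' \<Longrightarrow> merit t' k \<le> merit t k"
  using P_ge_P_inf[OF x_in_C[of "Suc k"]] by (simp add: merit_def frac_le)

text \<open>The growth inequality is used at \<open>u = x (Suc k)\<close>, and \<open>P2\<close> is bounded below by its
  linearization; the remaining positive terms on the right are the extrapolation error
  \<open>(Lg + lg)/2 * (norm (x (Suc k) - y (Suc k)))\<^sup>2\<close>, which \<open>\<beta> \<le> \<beta>b\<close> bounds by a multiple of \<open>(D k)\<^sup>2\<close>.\<close>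

lemma merit_descent_fixed: "merit (\<theta> (Suc k)) (Suc k) \<le> merit (\<theta> (Suc k)) k - c * (D k)\<^sup>2"
proof -
  define X X' Y t where "X = x (Suc k)" and "X' = x (Suc (Suc k))" and "Y = y (Suc k)"
    and "t = \<theta> (Suc k)"
  have t: "0 < t" by (simp add: t_def theta_pos)
  have growth: "P1 X' - \<xi> (Suc k) \<bullet> X' + t * violation X' Y
      + t * Lg / 2 * (norm (X' - Y))\<^sup>2 + t * Lg / 2 * (norm (X - X'))\<^sup>2
    \<le> P1 X - \<xi> (Suc k) \<bullet> X + t * violation X Y + t * Lg / 2 * (norm (X - Y))\<^sup>2"
    using subproblem_growth[OF x_in_C[of "Suc k"], of "Suc k"] by (simp add: X_def X'_def Y_def t_def)
  have "P2 X + \<xi> (Suc k) \<bullet> (X' - X) \<le> P2 X'"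
    using xi[of "Suc k"] by (simp add: convex_subdiff_def X_def)
  with growth have 1: "P X' + t * (violation X' Y + Lg / 2 * (norm (X' - Y))\<^sup>2 + Lg / 2 * (norm (X' - X))\<^sup>2)
      \<le> P X + t * (violation X Y + Lg / 2 * (norm (X - Y))\<^sup>2)"
    by (simp add: P_eq inner_diff_right norm_minus_commute[of X X'] algebra_simps)
  have "violation X Y \<le> violation X (y k) + Lg / 2 * (norm (X - y k))\<^sup>2 + lg / 2 * (norm (X - Y))\<^sup>2"
    by (rule violation_extrapolated)
  then have "t * (violation X Y + Lg / 2 * (norm (X - Y))\<^sup>2)
    \<le> t * (violation X (y k) + Lg / 2 * (norm (X - y k))\<^sup>2 + (Lg + lg) / 2 * (norm (X - Y))\<^sup>2)"
    using t by (intro mult_left_mono) (auto simp: algebra_simps add_divide_distrib)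
  also have "\<dots> \<le> t * (violation X (y k) + Lg / 2 * (norm (X - y k))\<^sup>2 + (Lg + lg) / 2 * (\<beta>b\<^sup>2 * (D k)\<^sup>2))"
  proof -
    have "(norm (X - Y))\<^sup>2 \<le> (\<beta>b * D k)\<^sup>2"
      using beta_le D_nonneg beta_nonneg
      by (intro power_mono) (auto simp: X_def Y_def extrapolation_norm mult_right_mono)
    then show ?thesis using t Lg_pos lg_nonneg
      by (intro mult_left_mono add_left_mono) (auto simp: power_mult_distrib)
  qed
  finally have "P X' + t * (violation X' Y + Lg / 2 * (norm (X' - Y))\<^sup>2 + Lg / 2 * (norm (X' - X))\<^sup>2)
      \<le> P X + t * (violation X (y k) + Lg / 2 * (norm (X - y k))\<^sup>2 + (Lg + lg) / 2 * (\<beta>b\<^sup>2 * (D k)\<^sup>2))"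
    using 1 by simp
  then have "t * merit t (Suc k) \<le> t * (merit t k - c * (D k)\<^sup>2)"
    using t by (simp add: merit_def c_def D_def X_def X'_def Y_def algebra_simps diff_divide_distrib add_divide_distrib)
  then show ?thesis using t by (simp add: t_def)
qed

lemma merit_descent: "merit (\<theta> (Suc k)) (Suc k) \<le> merit (\<theta> k) k - c * (D k)\<^sup>2"
  using merit_descent_fixed[of k] merit_antimono[OF theta_pos theta_mono, of k k] by simp

lemma merit_nonneg: "0 < t \<Longrightarrow> 0 \<le> merit t k"
  using P_ge_P_inf[OF x_in_C[of "Suc k"]] Lg_pos
  by (simp add: merit_def violation_def pos_max_nonneg)

lemma merit_convergent: obtains h where "(\<lambda>k. merit (\<theta> k) k) \<longlonglongrightarrow> h"
proof -
  have "merit (\<theta> (Suc k)) (Suc k) \<le> merit (\<theta> k) k" for k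
  proof -
    have "0 \<le> c * (D k)\<^sup>2" using c_pos by simp
    then show ?thesis using merit_descent[of k] by linarith
  qed
  then have "decseq (\<lambda>k. merit (\<theta> k) k)" by (rule decseq_SucI)
  moreover have "\<forall>k. 0 \<le> merit (\<theta> k) k" using merit_nonneg theta_pos by simp
  ultimately obtain h where "(\<lambda>k. merit (\<theta> k) k) \<longlonglongrightarrow> h" by (rule decseq_convergent)
  then show thesis by (rule that)
qed

lemma D_tendsto: "D \<longlonglongrightarrow> 0"
proof -
  obtain h where "(\<lambda>k. merit (\<theta> k) k) \<longlonglongrightarrow> h" by (rule merit_convergent)
  then show ?thesis using descent_step_sizes_vanish[OF c_pos, of 0 "\<lambda>k. merit (\<theta> k) k" D h] merit_descent by simp
qed

lemma x_steps: "(\<lambda>k. x (Suc k) - x k) \<longlonglongrightarrow> 0"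
  using D_tendsto by (simp add: D_def[abs_def] tendsto_norm_zero_iff)

lemma y_steps: "(\<lambda>k. y k - x k) \<longlonglongrightarrow> 0"
proof (rule LIMSEQ_imp_Suc, rule Lim_null_comparison[OF _ D_tendsto])
  show "eventually (\<lambda>k. norm (y (Suc k) - x (Suc k)) \<le> D k) sequentially"
    using extrapolation_le by (simp add: norm_minus_commute)
qed

lemma subsequence_limits:
  assumes r: "strict_mono r" and lim: "(x \<circ> r) \<longlonglongrightarrow> xs"
  shows "(\<lambda>n. x (r n)) \<longlonglongrightarrow> xs" "(\<lambda>n. x (Suc (r n))) \<longlonglongrightarrow> xs" "(\<lambda>n. y (r n)) \<longlonglongrightarrow> xs"
proof -
  show 1: "(\<lambda>n. x (r n)) \<longlonglongrightarrow> xs" using lim by (simp add: comp_def)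
  show "(\<lambda>n. x (Suc (r n))) \<longlonglongrightarrow> xs"
    using tendsto_add[OF LIMSEQ_subseq_LIMSEQ[OF x_steps r] lim] by (simp add: comp_def)
  show "(\<lambda>n. y (r n)) \<longlonglongrightarrow> xs"
    using tendsto_add[OF LIMSEQ_subseq_LIMSEQ[OF y_steps r] lim] by (simp add: comp_def)
qed

lemma grad_tendsto: "U \<longlonglongrightarrow> u \<Longrightarrow> (\<lambda>n. grad (g i) (U n)) \<longlonglongrightarrow> grad (g i) u"
proof -
  assume U: "U \<longlonglongrightarrow> u"
  obtain K where "K-lipschitz_on UNIV (grad (g i))" using g_smooth[of i] by (auto simp: lipschitz_gradient_def)
  then have "continuous_on UNIV (grad (g i))" by (rule lipschitz_on_continuous_on)
  then show ?thesis using U by (rule continuous_on_tendsto_compose) auto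
qed

lemma lin_tendsto:
  assumes "U \<longlonglongrightarrow> u" "W \<longlonglongrightarrow> w"
  shows "(\<lambda>n. lin (g i) (U n) (W n)) \<longlonglongrightarrow> lin (g i) u w"
proof -
  have "continuous (at w) (g i)" by (intro differentiable_imp_continuous_within g_diff)
  then have "(\<lambda>n. g i (W n)) \<longlonglongrightarrow> g i w" using assms(2) by (rule isCont_tendsto_compose)
  then show ?thesis unfolding lin_def by (intro tendsto_intros assms grad_tendsto)
qed

lemma violation_tendsto:
  assumes "U \<longlonglongrightarrow> u" "W \<longlonglongrightarrow> w"
  shows "(\<lambda>n. violation (U n) (W n)) \<longlonglongrightarrow> violation u w"
  unfolding violation_def by (intro tendsto_pos_max lin_tendsto assms)

lemma P1_tendsto: "U \<longlonglongrightarrow> u \<Longrightarrow> (\<lambda>n. P1 (U n)) \<longlonglongrightarrow> P1 u"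
  by (rule continuous_on_tendsto_compose[OF convex_on_continuous[OF open_UNIV P1]]) auto

lemma P2_tendsto: "U \<longlonglongrightarrow> u \<Longrightarrow> (\<lambda>n. P2 (U n)) \<longlonglongrightarrow> P2 u"
  by (rule continuous_on_tendsto_compose[OF convex_on_continuous[OF open_UNIV P2]]) auto

lemma xi_bounded: obtains R where "0 < R" "\<And>k. norm (\<xi> k) \<le> R"
  using convex_subdiff_bounded[OF P2 compact_imp_bounded[OF C_compact]] xi x_in_C by metis

section \<open>Stabilization of the penalty parameter\<close>

text \<open>At a feasible limit point the constraint qualification provides \<open>z\<close> with
  negative linearizations. A violated linearization is positive at \<open>U n\<close> and, for large \<open>n\<close>, less than \<open>- \<eta>\<close> at \<open>z\<close>, so
  it decreases from \<open>U n\<close> to \<open>z\<close>.\<close>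

lemma descent_direction_feasible:
  assumes xs: "xs \<in> C" "xs \<in> feasible g"
    and U: "U \<longlonglongrightarrow> xs" and W: "W \<longlonglongrightarrow> xs"
  obtains z \<eta> where "z \<in> C" "0 < \<eta>"
    "eventually (\<lambda>n. 0 < violation (U n) (W n) \<longrightarrow>
       (\<forall>i. lin (g i) (U n) (W n) = violation (U n) (W n) \<longrightarrow> grad (g i) (W n) \<bullet> (z - U n) \<le> - \<eta>)) sequentially"
proof -
  have "RCQ g C xs" using A xs by (simp add: assumption_A_def)
  then obtain z where z: "z \<in> C" "\<And>i. lin (g i) z xs < 0" by (auto simp: RCQ_def lin_def)
  obtain \<eta> where \<eta>: "0 < \<eta>" "\<And>i. lin (g i) z xs < - \<eta>"
    by (rule finite_negative_margin[of "\<lambda>i. lin (g i) z xs"]) (use z(2) in blast)+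
  have "eventually (\<lambda>n. \<forall>i. lin (g i) z (W n) < - \<eta>) sequentially"
    by (intro eventually_all_finite order_tendstoD(2)[OF lin_tendsto[OF tendsto_const W] \<eta>(2)])
  then have "eventually (\<lambda>n. 0 < violation (U n) (W n) \<longrightarrow>
       (\<forall>i. lin (g i) (U n) (W n) = violation (U n) (W n) \<longrightarrow> grad (g i) (W n) \<bullet> (z - U n) \<le> - \<eta>)) sequentially"
  proof eventually_elim
    case (elim n)
    have "grad (g i) (W n) \<bullet> (z - U n) = lin (g i) z (W n) - lin (g i) (U n) (W n)" for i
      by (simp add: lin_def inner_diff_right)
    then show ?case using elim by (smt (verit))
  qed
  then show thesis using that z(1) \<eta>(1) by blast
qed

text \<open>At an infeasible limit point the second part of the assumption and the
  theorem of the alternative yield a direction along which all constraints active there decrease. By continuity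
  no other constraint can attain the violation at \<open>U n\<close> for large \<open>n\<close>.\<close>

lemma descent_direction_infeasible:
  assumes xs: "xs \<in> C" "xs \<notin> feasible g"
    and U: "U \<longlonglongrightarrow> xs" and W: "W \<longlonglongrightarrow> xs"
  obtains z \<eta> where "z \<in> C" "0 < \<eta>"
    "eventually (\<lambda>n. 0 < violation (U n) (W n) \<longrightarrow>
       (\<forall>i. lin (g i) (U n) (W n) = violation (U n) (W n) \<longrightarrow> grad (g i) (W n) \<bullet> (z - U n) \<le> - \<eta>)) sequentially"
proof -
  have "\<exists>z\<in>C. \<forall>i\<in>active g xs. grad (g i) xs \<bullet> (z - xs) < 0"
  proof (rule ccontr)
    assume "\<not> ?thesis"
    then have alt: "\<And>z. z \<in> C \<Longrightarrow> \<exists>i\<in>active g xs. 0 \<le> grad (g i) xs \<bullet> (z - xs)"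
      by (force simp: not_less)
    have "C \<noteq> {}" using xs(1) by auto
    from finite_alternative[OF C_convex this alt] obtain u :: "'m \<Rightarrow> real" where
      u: "\<And>i. 0 \<le> u i" "\<And>i. i \<notin> active g xs \<Longrightarrow> u i = 0" "sum u UNIV = 1"
      "\<And>z. z \<in> C \<Longrightarrow> 0 \<le> (\<Sum>i\<in>UNIV. u i *\<^sub>R grad (g i) xs) \<bullet> (z - xs)"
      by auto
    have "sum u (active g xs) = sum u UNIV"
      using u(2) by (intro sum.mono_neutral_left) auto
    moreover have "(\<Sum>i\<in>active g xs. u i *\<^sub>R grad (g i) xs) = (\<Sum>i\<in>UNIV. u i *\<^sub>R grad (g i) xs)"
      using u(2) by (intro sum.mono_neutral_left) auto
    ultimately have "(\<forall>i\<in>active g xs. 0 \<le> u i) \<and> sum u (active g xs) = 1 \<and>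
        (\<forall>z\<in>C. 0 \<le> (\<Sum>i\<in>active g xs. u i *\<^sub>R grad (g i) xs) \<bullet> (z - xs))"
      using u by simp
    moreover have "xs \<in> C - feasible g" using xs by simp
    ultimately show False using A unfolding assumption_A_def by blast
  qed
  then obtain z where z: "z \<in> C" "\<And>i. i \<in> active g xs \<Longrightarrow> grad (g i) xs \<bullet> (z - xs) < 0" by auto
  define f where "f i = (if i \<in> active g xs then grad (g i) xs \<bullet> (z - xs) else - 1)" for i
  have "f i < 0" for i using z(2) by (simp add: f_def)
  then obtain \<eta> where \<eta>: "0 < \<eta>" "\<And>i. f i < - \<eta>" by (rule finite_negative_margin[of f]) blast
  have lin_xs: "lin (g i) xs xs = g i xs" for i by (simp add: lin_def)
  have "eventually (\<lambda>n. \<forall>i. lin (g i) (U n) (W n) = violation (U n) (W n) \<longrightarrow>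
      grad (g i) (W n) \<bullet> (z - U n) \<le> - \<eta>) sequentially"
  proof (rule eventually_all_finite)
    fix i
    show "eventually (\<lambda>n. lin (g i) (U n) (W n) = violation (U n) (W n) \<longrightarrow>
      grad (g i) (W n) \<bullet> (z - U n) \<le> - \<eta>) sequentially"
    proof (cases "i \<in> active g xs")
      case True
      have "(\<lambda>n. grad (g i) (W n) \<bullet> (z - U n)) \<longlonglongrightarrow> grad (g i) xs \<bullet> (z - xs)"
        by (intro tendsto_intros grad_tendsto U W)
      moreover have "grad (g i) xs \<bullet> (z - xs) < - \<eta>" using \<eta>(2)[of i] True by (simp add: f_def)
      ultimately have "eventually (\<lambda>n. grad (g i) (W n) \<bullet> (z - U n) < - \<eta>) sequentially"
        by (rule order_tendstoD(2))
      then show ?thesis by eventually_elim simp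
    next
      case False
      have v: "violation xs xs = pos_max (\<lambda>i. g i xs)" by (simp add: violation_def lin_xs)
      have "g i xs \<noteq> pos_max (\<lambda>i. g i xs)" using False by (simp add: active_def pos_max_def)
      then have "0 < violation xs xs - lin (g i) xs xs"
        using le_pos_max[of "\<lambda>i. g i xs" i] by (simp add: v lin_xs)
      moreover have "(\<lambda>n. violation (U n) (W n) - lin (g i) (U n) (W n)) \<longlonglongrightarrow> violation xs xs - lin (g i) xs xs"
        by (intro tendsto_intros violation_tendsto lin_tendsto U W)
      ultimately have "eventually (\<lambda>n. 0 < violation (U n) (W n) - lin (g i) (U n) (W n)) sequentially"
        by (rule order_tendstoD(1)[rotated])
      then show ?thesis by eventually_elim simp
    qed
  qed
  then have "eventually (\<lambda>n. 0 < violation (U n) (W n) \<longrightarrow>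
       (\<forall>i. lin (g i) (U n) (W n) = violation (U n) (W n) \<longrightarrow> grad (g i) (W n) \<bullet> (z - U n) \<le> - \<eta>)) sequentially"
    by eventually_elim simp
  then show thesis using that z(1) \<eta>(1) by blast
qed

text \<open>If the linearized constraints are violated, the multipliers sum to 1. Testing the
  stationarity condition with \<open>z - x (Suc k)\<close> therefore produces \<open>\<theta> k * \<eta>\<close>, while the remaining terms do not
  grow with the penalty parameter.\<close>

lemma penalty_bound:
  assumes z: "z \<in> C" and pos: "0 < violation (x (Suc k)) (y k)"
    and dir: "\<And>i. lin (g i) (x (Suc k)) (y k) = violation (x (Suc k)) (y k)
        \<Longrightarrow> grad (g i) (y k) \<bullet> (z - x (Suc k)) \<le> - \<eta>"
  shows "\<theta> k * (\<eta> - Lg * ((x (Suc k) - y k) \<bullet> (z - x (Suc k))))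
    \<le> P1 z - P1 (x (Suc k)) - \<xi> k \<bullet> (z - x (Suc k))"
proof -
  define X Y t where "X = x (Suc k)" and "Y = y k" and "t = \<theta> k"
  have t: "0 < t" by (simp add: t_def theta_pos)
  note opt = subproblem_optimal[of _ k, folded X_def Y_def t_def]
  have X: "X \<in> C" by (simp add: X_def x_in_C)
  obtain \<mu> p \<nu> where K: "p \<in> convex_subdiff P1 X" "\<nu> \<in> normal_cone C X"
    "\<forall>i. 0 \<le> \<mu> i" "sum \<mu> UNIV \<le> 1" "\<forall>i. \<mu> i \<noteq> 0 \<longrightarrow> lin (g i) X Y = violation X Y"
    "0 < violation X Y \<longrightarrow> sum \<mu> UNIV = 1"
    "p - \<xi> k + t *\<^sub>R (\<Sum>i\<in>UNIV. \<mu> i *\<^sub>R grad (g i) Y) + (t * Lg) *\<^sub>R (X - Y) + \<nu> = 0"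
    by (rule penalty_KKT_violation[OF X t opt])
  define e where "e = z - X"
  have "p \<bullet> e \<le> P1 z - P1 X" using K(1) by (auto simp: convex_subdiff_def e_def algebra_simps)
  moreover have "\<nu> \<bullet> e \<le> 0" using K(2) z by (simp add: normal_cone_def e_def)
  moreover have "(\<Sum>i\<in>UNIV. \<mu> i *\<^sub>R grad (g i) Y) \<bullet> e \<le> - \<eta>"
  proof -
    have "(\<Sum>i\<in>UNIV. \<mu> i *\<^sub>R grad (g i) Y) \<bullet> e = (\<Sum>i\<in>UNIV. \<mu> i * (grad (g i) Y \<bullet> e))"
      by (simp add: inner_sum_left)
    also have "\<dots> \<le> (\<Sum>i\<in>UNIV. \<mu> i * (- \<eta>))"
    proof (rule sum_mono)
      fix i
      show "\<mu> i * (grad (g i) Y \<bullet> e) \<le> \<mu> i * (- \<eta>)"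
        using K(3,5) dir[of i] mult_left_mono[of "grad (g i) Y \<bullet> e" "- \<eta>" "\<mu> i"]
        by (cases "\<mu> i = 0") (auto simp: X_def Y_def e_def)
    qed
    also have "\<dots> = sum \<mu> UNIV * (- \<eta>)" by (rule sum_distrib_right[symmetric])
    also have "\<dots> = - \<eta>" using K(6) pos by (simp add: X_def Y_def)
    finally show ?thesis .
  qed
  then have "t * ((\<Sum>i\<in>UNIV. \<mu> i *\<^sub>R grad (g i) Y) \<bullet> e) \<le> t * (- \<eta>)" using t by (intro mult_left_mono) auto
  moreover have "p \<bullet> e - \<xi> k \<bullet> e + t * ((\<Sum>i\<in>UNIV. \<mu> i *\<^sub>R grad (g i) Y) \<bullet> e) + t * Lg * ((X - Y) \<bullet> e) + \<nu> \<bullet> e = 0"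
    using arg_cong[OF K(7), of "\<lambda>a. a \<bullet> e"]
    by (simp only: inner_add_left inner_diff_left inner_scaleR_left inner_zero_left)
  ultimately have "t * \<eta> - t * Lg * ((X - Y) \<bullet> e) \<le> P1 z - P1 X - \<xi> k \<bullet> e" by simp
  then show ?thesis by (simp add: X_def Y_def t_def e_def right_diff_distrib mult.assoc)
qed

text \<open>Otherwise the parameter increases along a subsequence. Near a limit point of
  that subsequence there is a common descent direction for the linearized constraints, and
  \<open>penalty_bound\<close> contradicts the divergence of the parameter.\<close>

lemma theta_eventually_const: "\<exists>N. \<forall>k\<ge>N. \<theta> k = \<theta> N"
proof -
  define S where "S = {k. \<not> (\<forall>i. lin (g i) (x (Suc k)) (y k) \<le> 0)}"
  show ?thesis
  proof (cases "finite S")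
    case True
    then obtain N where N: "\<And>k. k \<in> S \<Longrightarrow> k < N"
      by (auto simp: finite_nat_set_iff_bounded)
    have "\<theta> k = \<theta> N" if "N \<le> k" for k
      using that
    proof (induction k rule: dec_induct)
      case (step k)
      then have "k \<notin> S" using N by fastforce
      then show ?case using step by (auto simp: S_def theta_Suc)
    qed simp
    then show ?thesis by blast
  next
    case False
    then obtain r :: "nat \<Rightarrow> nat" where r: "strict_mono r" "\<And>n. r n \<in> S"
      by (auto dest: infinite_enumerate)
    have grow: "\<theta> 0 + real n * d \<le> \<theta> (r n)" for n
    proof (induction n)
      case 0
      then show ?case using theta_mono' by simp
    next
      case (Suc n)
      have "\<theta> (r n) + d = \<theta> (Suc (r n))" using r(2)[of n] by (auto simp: S_def theta_Suc)
      also have "\<dots> \<le> \<theta> (r (Suc n))"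
        using r(1) by (intro theta_mono') (simp add: Suc_leI strict_mono_Suc_iff)
      finally show ?case using Suc by (simp add: algebra_simps)
    qed
    have "\<forall>n. (x \<circ> r) n \<in> C" using x_in_C by simp
    then obtain xs q where q: "xs \<in> C" "strict_mono q" "((x \<circ> r) \<circ> q) \<longlonglongrightarrow> xs"
      using C_compact unfolding compact_def by metis
    define R where "R = r \<circ> q"
    have R: "strict_mono R" "(x \<circ> R) \<longlonglongrightarrow> xs"
      using r q by (auto simp: R_def strict_mono_o comp_assoc)
    note lims = subsequence_limits[OF R]
    obtain z \<eta> where z: "z \<in> C" "0 < \<eta>" and ev: "eventually (\<lambda>n. 0 < violation (x (Suc (R n))) (y (R n)) \<longrightarrow>
       (\<forall>i. lin (g i) (x (Suc (R n))) (y (R n)) = violation (x (Suc (R n))) (y (R n)) \<longrightarrow>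
         grad (g i) (y (R n)) \<bullet> (z - x (Suc (R n))) \<le> - \<eta>)) sequentially"
    proof (cases "xs \<in> feasible g")
      case True
      show ?thesis by (rule descent_direction_feasible[OF q(1) True lims(2,3)]) (fact that)
    next
      case False
      show ?thesis by (rule descent_direction_infeasible[OF q(1) False lims(2,3)]) (fact that)
    qed
    have pos: "0 < violation (x (Suc (R n))) (y (R n))" for n
    proof -
      have "R n \<in> S" using r(2) by (simp add: R_def)
      then obtain i where "0 < lin (g i) (x (Suc (R n))) (y (R n))" by (auto simp: S_def not_le)
      also have "\<dots> \<le> violation (x (Suc (R n))) (y (R n))"
        unfolding violation_def by (rule le_pos_max)
      finally show ?thesis .
    qed
    have "(\<lambda>n. \<eta> - Lg * ((x (Suc (R n)) - y (R n)) \<bullet> (z - x (Suc (R n))))) \<longlonglongrightarrow>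
        \<eta> - Lg * ((xs - xs) \<bullet> (z - xs))"
      by (intro tendsto_intros lims)
    then have "(\<lambda>n. \<eta> - Lg * ((x (Suc (R n)) - y (R n)) \<bullet> (z - x (Suc (R n))))) \<longlonglongrightarrow> \<eta>" by simp
    then have ev2: "eventually (\<lambda>n. \<eta> / 2 < \<eta> - Lg * ((x (Suc (R n)) - y (R n)) \<bullet> (z - x (Suc (R n))))) sequentially"
      using z(2) by (intro order_tendstoD(1)) auto
    obtain R\<xi> where R\<xi>: "0 < R\<xi>" "\<And>k. norm (\<xi> k) \<le> R\<xi>" by (rule xi_bounded) blast
    define b where "b n = P1 z - P1 (x (Suc (R n))) + R\<xi> * norm (z - x (Suc (R n)))" for n
    have "b \<longlonglongrightarrow> P1 z - P1 xs + R\<xi> * norm (z - xs)"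
      unfolding b_def by (intro tendsto_intros P1_tendsto lims)
    then have ev3: "eventually (\<lambda>n. b n < P1 z - P1 xs + R\<xi> * norm (z - xs) + 1) sequentially"
      by (rule order_tendstoD(2)) simp
    have "eventually (\<lambda>n. \<theta> (R n) * (\<eta> / 2) < P1 z - P1 xs + R\<xi> * norm (z - xs) + 1) sequentially"
      using ev ev2 ev3
    proof eventually_elim
      case (elim n)
      have "\<theta> (R n) * (\<eta> / 2) \<le> \<theta> (R n) * (\<eta> - Lg * ((x (Suc (R n)) - y (R n)) \<bullet> (z - x (Suc (R n)))))"
        using elim(2) theta_pos[of "R n"] by (intro mult_left_mono) auto
      also have "\<dots> \<le> P1 z - P1 (x (Suc (R n))) - \<xi> (R n) \<bullet> (z - x (Suc (R n)))"
        using elim(1) pos by (intro penalty_bound z(1)) auto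
      also have "\<dots> \<le> b n"
      proof -
        have "- (\<xi> (R n) \<bullet> (z - x (Suc (R n)))) \<le> norm (\<xi> (R n)) * norm (z - x (Suc (R n)))"
          using Cauchy_Schwarz_ineq2[of "\<xi> (R n)" "z - x (Suc (R n))"] by linarith
        also have "\<dots> \<le> R\<xi> * norm (z - x (Suc (R n)))" using R\<xi>(2) by (intro mult_right_mono) auto
        finally show ?thesis by (simp add: b_def)
      qed
      finally show ?case using elim(3) by simp
    qed
    moreover have "filterlim (\<lambda>n. \<theta> 0 + real (q n) * d) at_top sequentially"
    proof -
      have "filterlim (\<lambda>n. real (q n)) at_top sequentially"
        by (rule filterlim_compose[OF filterlim_real_sequentially filterlim_subseq[OF q(2)]])
      then show ?thesis using d_pos
        by (intro filterlim_tendsto_add_at_top[OF tendsto_const] filterlim_at_top_mult_tendsto_pos[OF tendsto_const])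
    qed
    then have "eventually (\<lambda>n. (P1 z - P1 xs + R\<xi> * norm (z - xs) + 1) / (\<eta> / 2) \<le> \<theta> 0 + real (q n) * d) sequentially"
      by (simp add: filterlim_at_top)
    ultimately have "eventually (\<lambda>n::nat. False) sequentially"
    proof eventually_elim
      case (elim n)
      have "(P1 z - P1 xs + R\<xi> * norm (z - xs) + 1) / (\<eta> / 2) \<le> \<theta> (R n)"
        using elim(2) grow[of "q n"] by (simp add: R_def)
      then show False using elim(1) z(2) by (simp add: field_simps)
    qed
    then show ?thesis by simp
  qed
qed

section \<open>Criticality of accumulation points\<close>

definition T :: real where "T = eventual_value \<theta>"

lemma theta_settles: obtains N where "\<And>k. N \<le> k \<Longrightarrow> \<theta> k = T"
proof -
  obtain N where N: "\<And>k. N \<le> k \<Longrightarrow> \<theta> k = \<theta> N" using theta_eventually_const by blast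
  have "T = \<theta> N" unfolding T_def eventual_value_def
  proof (rule the_equality)
    fix t assume "\<exists>M. \<forall>k\<ge>M. \<theta> k = t"
    then obtain M where "\<forall>k\<ge>M. \<theta> k = t" by blast
    then have "\<theta> (max M N) = t" by simp
    then show "t = \<theta> N" using N[of "max M N"] by simp
  qed (use N in blast)
  show thesis
  proof (rule that[of N])
    fix k assume "N \<le> k"
    then show "\<theta> k = T" unfolding \<open>T = \<theta> N\<close> by (rule N)
  qed
qed

lemma T_pos: "0 < T"
proof -
  obtain N where "\<And>k. N \<le> k \<Longrightarrow> \<theta> k = T" by (rule theta_settles) blast
  then show ?thesis using theta_pos[of N] by simp
qed

lemma eventually_linearized_feasible:
  obtains N where "\<And>k. N \<le> k \<Longrightarrow> \<theta> k = T" "\<And>k i. N \<le> k \<Longrightarrow> lin (g i) (x (Suc k)) (y k) \<le> 0"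
proof -
  obtain N where N: "\<And>k. N \<le> k \<Longrightarrow> \<theta> k = T" by (rule theta_settles) blast
  have "lin (g i) (x (Suc k)) (y k) \<le> 0" if "N \<le> k" for k i
  proof -
    have "\<theta> (Suc k) = \<theta> k" using N that by simp
    then show ?thesis using theta_Suc[of k] d_pos by (auto split: if_splits)
  qed
  then show thesis using that[OF N] by simp
qed

lemma accumulation_feasible:
  assumes r: "strict_mono r" and lim: "(x \<circ> r) \<longlonglongrightarrow> xs"
  shows "xs \<in> C" "g i xs \<le> 0" "violation xs xs = 0"
proof -
  note lims = subsequence_limits[OF r lim]
  show "xs \<in> C" using compact_imp_closed[OF C_compact] lims(1) x_in_C
    by (metis closed_sequentially)
  obtain N where N: "\<And>k. N \<le> k \<Longrightarrow> \<theta> k = T" "\<And>k i. N \<le> k \<Longrightarrow> lin (g i) (x (Suc k)) (y k) \<le> 0"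
    by (rule eventually_linearized_feasible) blast
  have le: "lin (g i) xs xs \<le> 0" for i
  proof (rule LIMSEQ_le_const2[OF lin_tendsto[OF lims(2,3)]], intro exI[of _ N] allI impI)
    fix n assume "N \<le> n"
    then have "N \<le> r n" using seq_suble[OF r, of n] by simp
    then show "lin (g i) (x (Suc (r n))) (y (r n)) \<le> 0" by (rule N(2))
  qed
  then show "g i xs \<le> 0" by (simp add: lin_def)
  have "violation xs xs \<le> 0" unfolding violation_def using le by (simp add: pos_max_le_iff)
  then show "violation xs xs = 0" using pos_max_nonneg[of "\<lambda>i. lin (g i) xs xs"]
    unfolding violation_def by linarith
qed

text \<open>An accumulation point solves the limiting subproblem, whose multipliers, scaled by
  the penalty parameter, are those required of a critical point; the subgradients \<open>\<xi>\<close> converge along a further subsequence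
  because they are bounded.\<close>

lemma accumulation_critical:
  assumes r: "strict_mono r" and lim: "(x \<circ> r) \<longlonglongrightarrow> xs"
  shows "xs \<in> critical_points P1 P2 g C"
proof -
  obtain R\<xi> where R\<xi>: "0 < R\<xi>" "\<And>k. norm (\<xi> k) \<le> R\<xi>" by (rule xi_bounded) blast
  then have "\<forall>n. (\<xi> \<circ> r) n \<in> cball 0 R\<xi>" by simp
  then obtain \<xi>s q where q: "strict_mono q" "((\<xi> \<circ> r) \<circ> q) \<longlonglongrightarrow> \<xi>s"
    using compact_cball[of "0::'a" R\<xi>] unfolding compact_def by meson
  define R where "R = r \<circ> q"
  have R: "strict_mono R" using r q by (auto simp: R_def strict_mono_o)
  have xR: "(x \<circ> R) \<longlonglongrightarrow> xs"
    unfolding R_def comp_assoc[symmetric] by (rule LIMSEQ_subseq_LIMSEQ[OF lim q(1)])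
  have \<xi>R: "(\<lambda>n. \<xi> (R n)) \<longlonglongrightarrow> \<xi>s" using q by (simp add: R_def comp_def)
  note lims = subsequence_limits[OF R xR]
  have \<xi>s: "\<xi>s \<in> convex_subdiff P2 xs"
    by (rule convex_subdiff_closed[OF P2 lims(1) \<xi>R]) (rule xi)
  obtain N where N: "\<And>k. N \<le> k \<Longrightarrow> \<theta> k = T" by (rule theta_settles) blast
  note feas = accumulation_feasible[OF r lim]
  have min: "P1 xs - \<xi>s \<bullet> xs + T * violation xs xs + T * Lg / 2 * (norm (xs - xs))\<^sup>2
      \<le> P1 u - \<xi>s \<bullet> u + T * violation u xs + T * Lg / 2 * (norm (u - xs))\<^sup>2" if u: "u \<in> C" for u
  proof (rule LIMSEQ_le)
    show "(\<lambda>n. P1 (x (Suc (R n))) - \<xi> (R n) \<bullet> x (Suc (R n)) + T * violation (x (Suc (R n))) (y (R n))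
       + T * Lg / 2 * (norm (x (Suc (R n)) - y (R n)))\<^sup>2) \<longlonglongrightarrow>
       P1 xs - \<xi>s \<bullet> xs + T * violation xs xs + T * Lg / 2 * (norm (xs - xs))\<^sup>2"
      by (intro tendsto_intros P1_tendsto violation_tendsto lims \<xi>R)
    show "(\<lambda>n. P1 u - \<xi> (R n) \<bullet> u + T * violation u (y (R n)) + T * Lg / 2 * (norm (u - y (R n)))\<^sup>2)
       \<longlonglongrightarrow> P1 u - \<xi>s \<bullet> u + T * violation u xs + T * Lg / 2 * (norm (u - xs))\<^sup>2"
      by (intro tendsto_intros violation_tendsto lims \<xi>R)
    show "\<exists>N. \<forall>n\<ge>N. P1 (x (Suc (R n))) - \<xi> (R n) \<bullet> x (Suc (R n)) + T * violation (x (Suc (R n))) (y (R n))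
       + T * Lg / 2 * (norm (x (Suc (R n)) - y (R n)))\<^sup>2
       \<le> P1 u - \<xi> (R n) \<bullet> u + T * violation u (y (R n)) + T * Lg / 2 * (norm (u - y (R n)))\<^sup>2"
    proof (intro exI[of _ N] allI impI)
      fix n assume "N \<le> n"
      then have "\<theta> (R n) = T" using seq_suble[OF R, of n] by (intro N) simp
      then show "P1 (x (Suc (R n))) - \<xi> (R n) \<bullet> x (Suc (R n)) + T * violation (x (Suc (R n))) (y (R n))
       + T * Lg / 2 * (norm (x (Suc (R n)) - y (R n)))\<^sup>2
       \<le> P1 u - \<xi> (R n) \<bullet> u + T * violation u (y (R n)) + T * Lg / 2 * (norm (u - y (R n)))\<^sup>2"
        using subproblem_optimal[OF u, of "R n"] by simp
    qed
  qed
  obtain \<mu> p \<nu> where K: "p \<in> convex_subdiff P1 xs" "\<nu> \<in> normal_cone C xs"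
    "\<forall>i. 0 \<le> \<mu> i" "sum \<mu> UNIV \<le> 1" "\<forall>i. \<mu> i \<noteq> 0 \<longrightarrow> lin (g i) xs xs = violation xs xs"
    "0 < violation xs xs \<longrightarrow> sum \<mu> UNIV = 1"
    "p - \<xi>s + T *\<^sub>R (\<Sum>i\<in>UNIV. \<mu> i *\<^sub>R grad (g i) xs) + (T * Lg) *\<^sub>R (xs - xs) + \<nu> = 0"
    by (rule penalty_KKT_violation[OF feas(1) T_pos min])
  define lam where "lam i = T * \<mu> i" for i
  have "lam i * g i xs = 0" for i
    using K(5) feas(3) by (cases "\<mu> i = 0") (auto simp: lam_def lin_def)
  moreover have "0 \<le> lam i" for i using K(3) T_pos by (simp add: lam_def)
  moreover have "0 = p - \<xi>s + (\<Sum>i\<in>UNIV. lam i *\<^sub>R grad (g i) xs) + \<nu>"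
    using K(7) by (simp add: lam_def scaleR_sum_right)
  ultimately have "\<exists>lam :: 'm \<Rightarrow> real. (\<forall>i. 0 \<le> lam i \<and> g i xs \<le> 0 \<and> lam i * g i xs = 0) \<and>
        (\<exists>\<xi>1 \<in> convex_subdiff P1 xs. \<exists>\<xi>2 \<in> convex_subdiff P2 xs. \<exists>\<nu> \<in> normal_cone C xs.
           0 = \<xi>1 - \<xi>2 + (\<Sum>i\<in>UNIV. lam i *\<^sub>R grad (g i) xs) + \<nu>)"
    using feas(2) K(1,2) \<xi>s by (intro exI[of _ lam] conjI bexI[of _ p] bexI[of _ \<xi>s] bexI[of _ \<nu>]) auto
  then show ?thesis using feas(1) by (simp add: critical_points_def)
qed

section \<open>Subgradients of the potential along a run\<close>

lemma P_apply: "P u = P1 u - P2 u"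
  by (simp add: P_eq)

definition H :: "'a \<times> 'a \<times> 'a \<Rightarrow> ereal" where "H = potential_H P g C Lg T"

lemma H_eq:
  "H (u, v, w) = (if u \<in> C then ereal ((P u - P_inf) / T + violation u w
      + Lg / 2 * (norm (u - v))\<^sup>2 + Lg / 2 * (norm (u - w))\<^sup>2) else \<infinity>)"
  by (simp add: H_def potential_H_def indicator_fun_def P_inf_def violation_def pos_max_def)

lemma H_merit: "H (x (Suc k), x k, y k) = ereal (merit T k)"
  using x_in_C by (simp add: H_eq merit_def)

text \<open>The multipliers of the subproblem define a differentiable minorant of the potential that
  touches it at \<open>(x (Suc k), x k, y k)\<close>: \<open>P1\<close> and the indicator of \<open>C\<close> are replaced by their affine minorants
  and the maximum by the combination of the linearizations with weights \<open>\<mu>\<close>. Stationarity cancels all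
  terms of the first component of its gradient except the difference of two gradients of \<open>P2\<close> and a
  multiple of the step.\<close>

lemma regular_subgradient_H:
  assumes k: "\<And>i. lin (g i) (x (Suc k)) (y k) \<le> 0" and \<theta>: "\<theta> k = T"
    and P2x: "P2 differentiable (at (x k))" "P2 differentiable (at (x (Suc k)))"
    and F: "\<And>i. (grad (g i) has_derivative blinfun_apply (F i)) (at (y k))"
    and FB: "\<And>i. norm (F i) \<le> BF"
    and K: "norm (grad P2 (x k) - grad P2 (x (Suc k))) \<le> K * norm (x (Suc k) - x k)"
  obtains \<zeta> where "\<zeta> \<in> regular_subdiff H (x (Suc k), x k, y k)"
    "norm \<zeta> \<le> (K / T + 2 * Lg) * norm (x (Suc k) - x k) + (BF + Lg) * norm (x (Suc k) - y k)"
proof -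
  define X Y Z where "X = x (Suc k)" and "Y = x k" and "Z = y k"
  have X: "X \<in> C" by (simp add: X_def x_in_C)
  have vio: "violation X Z = 0"
    using k pos_max_nonneg[of "\<lambda>i. lin (g i) X Z"]
    by (intro order_antisym) (auto simp: violation_def pos_max_le_iff X_def Z_def)
  note opt = subproblem_optimal[of _ k, unfolded \<theta>, folded X_def Z_def]
  obtain \<mu> p \<nu> where KKT: "p \<in> convex_subdiff P1 X" "\<nu> \<in> normal_cone C X"
    "\<forall>i. 0 \<le> \<mu> i" "sum \<mu> UNIV \<le> 1" "\<forall>i. \<mu> i \<noteq> 0 \<longrightarrow> lin (g i) X Z = violation X Z"
    "0 < violation X Z \<longrightarrow> sum \<mu> UNIV = 1"
    "p - \<xi> k + T *\<^sub>R (\<Sum>i\<in>UNIV. \<mu> i *\<^sub>R grad (g i) Z) + (T * Lg) *\<^sub>R (X - Z) + \<nu> = 0"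
    by (rule penalty_KKT_violation[OF X T_pos opt])
  define a where "a i = adjoint (blinfun_apply (F i)) (X - Z)" for i
  define q where "q v = (1 / T) * (P1 X - P_inf + (p + \<nu>) \<bullet> (fst v - X) - P2 (fst v))
      + (\<Sum>i\<in>UNIV. \<mu> i * lin (g i) (fst v) (snd (snd v)))
      + Lg / 2 * (norm (fst v - fst (snd v)))\<^sup>2 + Lg / 2 * (norm (fst v - snd (snd v)))\<^sup>2"
    for v :: "'a \<times> 'a \<times> 'a"
  define \<zeta> where "\<zeta> = (1 / T) *\<^sub>R (p + \<nu> - grad P2 X, 0, 0)
      + (\<Sum>i\<in>UNIV. \<mu> i *\<^sub>R (grad (g i) Z, 0, a i))
      + (Lg / 2) *\<^sub>R (2 *\<^sub>R (X - Y), - 2 *\<^sub>R (X - Y), 0)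
      + (Lg / 2) *\<^sub>R (2 *\<^sub>R (X - Z), 0, - 2 *\<^sub>R (X - Z))"
  have "GDERIV (\<lambda>u. P1 X - P_inf + (p + \<nu>) \<bullet> (u - X) - P2 u) X :> p + \<nu> - grad P2 X"
  proof (rule GDERIV_diff)
    show "GDERIV (\<lambda>u. P1 X - P_inf + (p + \<nu>) \<bullet> (u - X)) X :> p + \<nu>"
      unfolding gderiv_def by (auto intro!: derivative_eq_intros simp: inner_commute)
    show "GDERIV P2 X :> grad P2 X" using P2x(2) by (simp add: X_def GDERIV_grad)
  qed
  then have dq: "GDERIV q (X, Y, Z) :> \<zeta>"
    unfolding q_def \<zeta>_def a_def using F
    by (intro GDERIV_add GDERIV_cmult GDERIV_sum GDERIV_sq_dist_12 GDERIV_sq_dist_13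
        GDERIV_fst_comp[of "\<lambda>u. P1 X - P_inf + (p + \<nu>) \<bullet> (u - X) - P2 u"] GDERIV_lin g_diff)
      (auto simp: Z_def)
  have \<mu>lin: "(\<Sum>i\<in>UNIV. \<mu> i * lin (g i) X Z) = 0"
  proof (rule sum.neutral, rule ballI)
    fix i show "\<mu> i * lin (g i) X Z = 0" using KKT(5) vio by (cases "\<mu> i = 0") auto
  qed
  have \<zeta>sub: "\<zeta> \<in> regular_subdiff H (X, Y, Z)"
  proof (rule regular_subdiff_smooth_minorant[OF _ _ dq])
    show "H (X, Y, Z) = ereal (q (X, Y, Z))"
      using X vio \<mu>lin by (simp add: H_eq q_def P_apply)
    fix v :: "'a \<times> 'a \<times> 'a"
    obtain u1 u2 u3 where v: "v = (u1, u2, u3)" by (cases v) auto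
    show "ereal (q v) \<le> H v"
    proof (cases "u1 \<in> C")
      case True
      have "P1 X + p \<bullet> (u1 - X) \<le> P1 u1" using KKT(1) by (simp add: convex_subdiff_def)
      moreover have "\<nu> \<bullet> (u1 - X) \<le> 0" using KKT(2) True by (simp add: normal_cone_def)
      ultimately have "(1 / T) * (P1 X - P_inf + (p + \<nu>) \<bullet> (u1 - X) - P2 u1) \<le> (1 / T) * (P u1 - P_inf)"
        using T_pos by (intro mult_left_mono) (auto simp: P_apply inner_add_left)
      moreover have "(\<Sum>i\<in>UNIV. \<mu> i * lin (g i) u1 u3) \<le> violation u1 u3"
      proof -
        have "(\<Sum>i\<in>UNIV. \<mu> i * lin (g i) u1 u3) \<le> (\<Sum>i\<in>UNIV. \<mu> i * violation u1 u3)"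
          using KKT(3) by (intro sum_mono mult_left_mono) (auto simp: violation_def intro: le_pos_max)
        also have "\<dots> = sum \<mu> UNIV * violation u1 u3" by (simp add: sum_distrib_right)
        also have "\<dots> \<le> 1 * violation u1 u3"
          using KKT(4) pos_max_nonneg by (intro mult_right_mono) (auto simp: violation_def)
        finally show ?thesis by simp
      qed
      ultimately show ?thesis using True by (simp add: v H_eq q_def)
    qed (simp add: v H_eq)
  qed
  have fst\<zeta>: "fst \<zeta> = (1 / T) *\<^sub>R (grad P2 Y - grad P2 X) + Lg *\<^sub>R (X - Y)"
  proof -
    have \<xi>Y: "\<xi> k = grad P2 Y" using convex_subdiff_eq_grad[OF xi P2x(1)] by (simp add: Y_def)
    have "p + \<nu> = grad P2 Y - T *\<^sub>R (\<Sum>i\<in>UNIV. \<mu> i *\<^sub>R grad (g i) Z) - (T * Lg) *\<^sub>R (X - Z)"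
      using KKT(7) unfolding \<xi>Y by (simp add: algebra_simps eq_neg_iff_add_eq_0)
    then have "(1 / T) *\<^sub>R (p + \<nu> - grad P2 X) = (1 / T) *\<^sub>R (grad P2 Y - grad P2 X)
        - (\<Sum>i\<in>UNIV. \<mu> i *\<^sub>R grad (g i) Z) - Lg *\<^sub>R (X - Z)"
      using T_pos by (simp add: scaleR_diff_right)
    then show ?thesis by (simp add: \<zeta>_def fst_sum)
  qed
  have snd1: "fst (snd \<zeta>) = - (Lg *\<^sub>R (X - Y))" by (simp add: \<zeta>_def fst_sum snd_sum)
  have snd2: "snd (snd \<zeta>) = (\<Sum>i\<in>UNIV. \<mu> i *\<^sub>R a i) - Lg *\<^sub>R (X - Z)"
    by (simp add: \<zeta>_def snd_sum)
  have "norm (fst \<zeta>) \<le> (1 / T) * (K * norm (X - Y)) + Lg * norm (X - Y)"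
  proof -
    have "norm ((1 / T) *\<^sub>R (grad P2 Y - grad P2 X)) \<le> (1 / T) * (K * norm (X - Y))"
      using K T_pos by (simp add: X_def Y_def divide_right_mono)
    moreover have "norm (Lg *\<^sub>R (X - Y)) = Lg * norm (X - Y)" using Lg_pos by simp
    ultimately show ?thesis unfolding fst\<zeta>
      using norm_triangle_ineq[of "(1 / T) *\<^sub>R (grad P2 Y - grad P2 X)" "Lg *\<^sub>R (X - Y)"] by linarith
  qed
  moreover have "norm (fst (snd \<zeta>)) = Lg * norm (X - Y)" using Lg_pos by (simp add: snd1)
  moreover have "norm (snd (snd \<zeta>)) \<le> BF * norm (X - Z) + Lg * norm (X - Z)"
  proof -
    have "norm (\<Sum>i\<in>UNIV. \<mu> i *\<^sub>R a i) \<le> (\<Sum>i\<in>UNIV. \<mu> i * (BF * norm (X - Z)))"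
    proof (rule sum_norm_le)
      fix i
      have "norm (a i) \<le> norm (F i) * norm (X - Z)" unfolding a_def by (rule norm_adjoint_blinfun_le)
      also have "\<dots> \<le> BF * norm (X - Z)" using FB by (intro mult_right_mono) auto
      finally show "norm (\<mu> i *\<^sub>R a i) \<le> \<mu> i * (BF * norm (X - Z))"
        using KKT(3) by (simp add: mult_left_mono)
    qed
    also have "\<dots> = sum \<mu> UNIV * (BF * norm (X - Z))" by (simp add: sum_distrib_right)
    also have "\<dots> \<le> 1 * (BF * norm (X - Z))"
      using KKT(4) order_trans[OF norm_ge_zero FB] by (intro mult_right_mono mult_nonneg_nonneg) auto
    finally have "norm (\<Sum>i\<in>UNIV. \<mu> i *\<^sub>R a i) \<le> BF * norm (X - Z)" by simp
    moreover have "norm (Lg *\<^sub>R (X - Z)) = Lg * norm (X - Z)" using Lg_pos by simp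
    ultimately show ?thesis unfolding snd2
      using norm_triangle_ineq4[of "\<Sum>i\<in>UNIV. \<mu> i *\<^sub>R a i" "Lg *\<^sub>R (X - Z)"] by linarith
  qed
  moreover have "norm \<zeta> \<le> norm (fst \<zeta>) + (norm (fst (snd \<zeta>)) + norm (snd (snd \<zeta>)))"
    using norm_Pair_le[of "fst \<zeta>" "snd \<zeta>"] norm_Pair_le[of "fst (snd \<zeta>)" "snd (snd \<zeta>)"] by simp
  ultimately have "norm \<zeta> \<le> (K / T + 2 * Lg) * norm (X - Y) + (BF + Lg) * norm (X - Z)"
    by (simp add: algebra_simps)
  with \<zeta>sub show thesis using that by (simp add: X_def Y_def Z_def)
qed

text \<open>Accumulation points are critical and hence lie in the open set where \<open>P2\<close> has a locally Lipschitz
  gradient. Second derivatives of the constraints are bounded near \<open>xs\<close> by compactness.\<close>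

lemma regular_subgradient_H_small:
  assumes r: "strict_mono r" and lim: "(x \<circ> r) \<longlonglongrightarrow> xs"
  obtains N b \<delta> where "0 < b" "0 < \<delta>"
    "\<forall>k. N \<le> k \<and> norm (x (Suc k) - xs) < \<delta> \<longrightarrow>
      (\<exists>\<zeta> \<in> regular_subdiff H (x (Suc (Suc k)), x (Suc k), y (Suc k)). norm \<zeta> \<le> b * (D k + D (Suc k)))"
proof -
  obtain U0 where U0: "open U0" "critical_points P1 P2 g C \<subseteq> U0" "C1_on U0 P2"
    "locally_lipschitz_on U0 (grad P2)"
    using B unfolding assumption_B_def by auto
  have xsU: "xs \<in> U0" using accumulation_critical[OF r lim] U0(2) by auto
  obtain e1 where e1: "0 < e1" "ball xs e1 \<subseteq> U0" using U0(1) xsU openE by blast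
  obtain e2 K where e2: "0 < e2" and K: "K-lipschitz_on (ball xs e2 \<inter> U0) (grad P2)"
    using U0(4) xsU unfolding locally_lipschitz_on_def by blast
  have P2_diff: "P2 differentiable (at u)" if "u \<in> U0" for u
    using U0(3) that by (auto simp: C1_on_def differentiable_def)
  have "\<exists>F. (\<forall>z. (grad (g i) has_derivative blinfun_apply (F z)) (at z)) \<and> continuous_on UNIV F" for i
    using B by (auto simp: assumption_B_def twice_cont_diff_def C1_on_def)
  then obtain F where F: "\<And>i z. (grad (g i) has_derivative blinfun_apply (F i z)) (at z)"
    "\<And>i. continuous_on UNIV (F i)" by metis
  have "\<exists>c. \<forall>z\<in>cball xs 1. norm (F i z) \<le> c" for i
  proof -
    have "compact (F i ` cball xs 1)"
      using F(2)[of i] by (intro compact_continuous_image) (auto intro: continuous_on_subset)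
    then show ?thesis by (auto simp: bounded_iff dest!: compact_imp_bounded)
  qed
  then obtain c' where c': "\<And>i z. z \<in> cball xs 1 \<Longrightarrow> norm (F i z) \<le> c' i" by metis
  define BF where "BF = (\<Sum>i\<in>UNIV. \<bar>c' i\<bar>)"
  have BF: "norm (F i z) \<le> BF" if "z \<in> cball xs 1" for i z
  proof -
    have "norm (F i z) \<le> \<bar>c' i\<bar>" using c'[OF that, of i] by linarith
    also have "\<dots> \<le> BF" unfolding BF_def by (rule member_le_sum) auto
    finally show ?thesis .
  qed
  have BF0: "0 \<le> BF" by (auto simp: BF_def intro: sum_nonneg)
  \<comment> \<open>The three points at index \<open>Suc k\<close> lie within \<open>2 \<delta>\<close> of \<open>xs\<close> when \<open>x (Suc k)\<close> lies within \<open>\<delta>\<close>.\<close>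
  define \<delta> where "\<delta> = min (min e1 e2) 1 / 2"
  have \<delta>: "0 < \<delta>" "2 * \<delta> \<le> e1" "2 * \<delta> \<le> e2" "2 * \<delta> \<le> 1" using e1 e2 by (auto simp: \<delta>_def)
  have K0: "0 \<le> K" using K lipschitz_on_nonneg by blast
  define b where "b = K / T + 3 * Lg + BF"
  have b: "0 < b" using K0 T_pos Lg_pos BF0 by (simp add: b_def add_nonneg_pos add_pos_nonneg)
  obtain N1 where N1: "\<And>k. N1 \<le> k \<Longrightarrow> \<theta> k = T" "\<And>k i. N1 \<le> k \<Longrightarrow> lin (g i) (x (Suc k)) (y k) \<le> 0"
    by (rule eventually_linearized_feasible) blast
  have "eventually (\<lambda>k. D k < \<delta>) sequentially" using D_tendsto \<delta>(1) by (rule order_tendstoD(2))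
  then obtain N2 where N2: "\<And>k. N2 \<le> k \<Longrightarrow> D k < \<delta>" unfolding eventually_sequentially by blast
  have "\<exists>\<zeta> \<in> regular_subdiff H (x (Suc (Suc k)), x (Suc k), y (Suc k)). norm \<zeta> \<le> b * (D k + D (Suc k))"
    if k: "max N1 N2 \<le> k" and near: "norm (x (Suc k) - xs) < \<delta>" for k
  proof -
    define X Y Z where "X = x (Suc (Suc k))" and "Y = x (Suc k)" and "Z = y (Suc k)"
    have XY: "norm (X - Y) = D (Suc k)" by (simp add: X_def Y_def D_def)
    have YZ: "norm (Y - Z) \<le> D k" using extrapolation_le[of k] by (simp add: Y_def Z_def)
    have dk: "D k < \<delta>" "D (Suc k) < \<delta>" using N2 k by auto
    have Yb: "norm (Y - xs) < \<delta>" using near by (simp add: Y_def)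
    have Xb: "norm (X - xs) < 2 * \<delta>"
      using norm_triangle_ineq[of "X - Y" "Y - xs"] XY dk Yb by simp
    have Zb: "norm (Z - xs) < 2 * \<delta>"
      using norm_triangle_ineq[of "Z - Y" "Y - xs"] YZ dk Yb by (simp add: norm_minus_commute)
    have XZ: "norm (X - Z) \<le> D k + D (Suc k)"
      using norm_triangle_ineq[of "X - Y" "Y - Z"] XY YZ by simp
    have in1: "X \<in> ball xs e1" "Y \<in> ball xs e1" "X \<in> ball xs e2" "Y \<in> ball xs e2"
      using Xb Yb \<delta> by (auto simp: dist_norm norm_minus_commute)
    have inU: "X \<in> U0" "Y \<in> U0" using in1 e1 by auto
    have Zc: "Z \<in> cball xs 1" using Zb \<delta> by (simp add: dist_norm norm_minus_commute)
    have lip: "norm (grad P2 Y - grad P2 X) \<le> K * norm (X - Y)"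
      using lipschitz_onD[OF K, of Y X] in1 inU by (simp add: dist_norm norm_minus_commute)
    obtain \<zeta> where \<zeta>: "\<zeta> \<in> regular_subdiff H (X, Y, Z)"
      "norm \<zeta> \<le> (K / T + 2 * Lg) * norm (X - Y) + (BF + Lg) * norm (X - Z)"
      unfolding X_def Y_def Z_def
    proof (rule regular_subgradient_H[of "Suc k" "\<lambda>i. F i Z" BF K])
      show "lin (g i) (x (Suc (Suc k))) (y (Suc k)) \<le> 0" for i using N1(2) k by simp
      show "\<theta> (Suc k) = T" using N1(1) k by simp
      show "P2 differentiable at (x (Suc k))" "P2 differentiable at (x (Suc (Suc k)))"
        using P2_diff inU by (auto simp: X_def Y_def)
      show "norm (grad P2 (x (Suc k)) - grad P2 (x (Suc (Suc k)))) \<le> K * norm (x (Suc (Suc k)) - x (Suc k))"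
        using lip by (simp add: X_def Y_def)
      show "(grad (g i) has_derivative blinfun_apply (F i Z)) (at (y (Suc k)))" for i
        using F(1)[of i Z] by (simp add: Z_def)
      show "norm (F i Z) \<le> BF" for i by (rule BF[OF Zc])
    qed auto
    have "norm \<zeta> \<le> (K / T + 2 * Lg) * (D k + D (Suc k)) + (BF + Lg) * (D k + D (Suc k))"
    proof (rule order_trans[OF \<zeta>(2)], rule add_mono)
      show "(K / T + 2 * Lg) * norm (X - Y) \<le> (K / T + 2 * Lg) * (D k + D (Suc k))"
        using XY D_nonneg K0 T_pos Lg_pos by (intro mult_left_mono) auto
      show "(BF + Lg) * norm (X - Z) \<le> (BF + Lg) * (D k + D (Suc k))"
        using XZ BF0 Lg_pos by (intro mult_left_mono) auto
    qed
    also have "\<dots> = b * (D k + D (Suc k))" by (simp add: b_def algebra_simps)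
    finally show ?thesis using \<zeta>(1) by (auto simp: X_def Y_def Z_def)
  qed
  then show thesis using that[OF b \<delta>(1), of "max N1 N2"] by blast
qed

lemma merit_T_tail:
  obtains N where "\<forall>k\<ge>N. merit T (Suc k) \<le> merit T k - c * (D k)\<^sup>2"
proof -
  obtain N where N: "\<And>k. N \<le> k \<Longrightarrow> \<theta> k = T" by (rule theta_settles) blast
  have "merit T (Suc k) \<le> merit T k - c * (D k)\<^sup>2" if "N \<le> k" for k
    using merit_descent[of k] N[of k] N[of "Suc k"] that by simp
  then show thesis using that by blast
qed

text \<open>Monotone convergence gives a limit of the merit values, and continuity of the potential relative to \<open>C\<close>
  identifies it along the subsequence; the desingularizing function at \<open>(xs, xs, xs)\<close> is therefore evaluated at
  exactly the gaps \<open>merit T k - h\<close>.\<close>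

lemma merit_limit:
  assumes r: "strict_mono r" and lim: "(x \<circ> r) \<longlonglongrightarrow> xs"
  obtains h where "H (xs, xs, xs) = ereal h" "merit T \<longlonglongrightarrow> h"
proof -
  note lims = subsequence_limits[OF r lim]
  note feas = accumulation_feasible[OF r lim]
  obtain N where N: "\<And>k. N \<le> k \<Longrightarrow> \<theta> k = T" by (rule theta_settles) blast
  obtain h where h: "(\<lambda>k. merit (\<theta> k) k) \<longlonglongrightarrow> h" by (rule merit_convergent)
  have "eventually (\<lambda>k. merit (\<theta> k) k = merit T k) sequentially"
    using eventually_ge_at_top[of N] by eventually_elim (simp add: N)
  then have hT: "merit T \<longlonglongrightarrow> h" using Lim_transform_eventually[OF h] by simp
  have "(\<lambda>n. (P (x (Suc (r n))) - P_inf) / T + violation (x (Suc (r n))) (y (r n))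
     + Lg / 2 * (norm (x (Suc (r n)) - x (r n)))\<^sup>2 + Lg / 2 * (norm (x (Suc (r n)) - y (r n)))\<^sup>2)
    \<longlonglongrightarrow> (P xs - P_inf) / T + violation xs xs + Lg / 2 * (norm (xs - xs))\<^sup>2 + Lg / 2 * (norm (xs - xs))\<^sup>2"
    unfolding P_apply using T_pos
    by (intro tendsto_intros P1_tendsto P2_tendsto violation_tendsto lims) auto
  then have "(\<lambda>n. merit T (r n)) \<longlonglongrightarrow> (P xs - P_inf) / T" by (simp add: merit_def feas(3))
  moreover have "(\<lambda>n. merit T (r n)) \<longlonglongrightarrow> h"
    using LIMSEQ_subseq_LIMSEQ[OF hT r] by (simp add: comp_def)
  ultimately have "h = (P xs - P_inf) / T" using LIMSEQ_unique by blast
  then have "H (xs, xs, xs) = ereal h" using feas by (simp add: H_eq)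
  then show thesis using that hT by blast
qed

text \<open>The subgradients just found tend to 0 along the subsequence, so 0 is a limiting
  subgradient; this makes the Kurdyka--Lojasiewicz property available at \<open>(xs, xs, xs)\<close>.\<close>

lemma accumulation_in_dom:
  assumes r: "strict_mono r" and lim: "(x \<circ> r) \<longlonglongrightarrow> xs"
  shows "(xs, xs, xs) \<in> dom_subdiff H"
proof -
  obtain h where h: "H (xs, xs, xs) = ereal h" "merit T \<longlonglongrightarrow> h" by (rule merit_limit[OF r lim])
  obtain N b \<delta> where b: "0 < b" "0 < \<delta>"
    "\<forall>k. N \<le> k \<and> norm (x (Suc k) - xs) < \<delta> \<longrightarrow>
      (\<exists>\<zeta> \<in> regular_subdiff H (x (Suc (Suc k)), x (Suc k), y (Suc k)). norm \<zeta> \<le> b * (D k + D (Suc k)))"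
    by (rule regular_subgradient_H_small[OF r lim])
  define r' where "r' n = Suc (r n)" for n
  have r': "strict_mono r'" using r by (simp add: r'_def strict_mono_def)
  note lims = subsequence_limits[OF r lim]
  have "(x \<circ> r') \<longlonglongrightarrow> xs" using lims(2) by (simp add: comp_def r'_def)
  note lims' = subsequence_limits[OF r' this]
  have "eventually (\<lambda>n. dist (x (Suc (r n))) xs < \<delta>) sequentially"
    using lims(2) b(2) by (rule tendstoD)
  moreover have "eventually (\<lambda>n. N \<le> r n) sequentially"
    using filterlim_subseq[OF r] by (simp add: filterlim_at_top)
  ultimately have "eventually (\<lambda>n. dist (x (Suc (r n))) xs < \<delta> \<and> N \<le> r n) sequentially"
    by eventually_elim simp
  then obtain n0 where n0: "\<And>n. n0 \<le> n \<Longrightarrow> dist (x (Suc (r n))) xs < \<delta> \<and> N \<le> r n"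
    unfolding eventually_sequentially by blast
  define R where "R n = r (n + n0)" for n
  have "\<exists>\<zeta>. \<zeta> \<in> regular_subdiff H (x (Suc (Suc (R n))), x (Suc (R n)), y (Suc (R n))) \<and>
      norm \<zeta> \<le> b * (D (R n) + D (Suc (R n)))" for n
  proof -
    have "N \<le> R n \<and> norm (x (Suc (R n)) - xs) < \<delta>"
      using n0[of "n + n0"] by (simp add: R_def dist_norm)
    then show ?thesis using b(3) by blast
  qed
  then obtain \<Xi> where \<Xi>: "\<And>n. \<Xi> n \<in> regular_subdiff H (x (Suc (Suc (R n))), x (Suc (R n)), y (Suc (R n)))"
      "\<And>n. norm (\<Xi> n) \<le> b * (D (R n) + D (Suc (R n)))" by metis
  have Rs: "strict_mono R" using r by (simp add: R_def strict_mono_def)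
  have "(\<lambda>n. b * (D (R n) + D (Suc (R n)))) \<longlonglongrightarrow> b * (0 + 0)"
    using LIMSEQ_subseq_LIMSEQ[OF D_tendsto Rs] LIMSEQ_subseq_LIMSEQ[OF LIMSEQ_Suc[OF D_tendsto] Rs]
    by (intro tendsto_intros) (auto simp: comp_def)
  then have "(\<lambda>n. b * (D (R n) + D (Suc (R n)))) \<longlonglongrightarrow> 0" by simp
  then have \<Xi>0: "\<Xi> \<longlonglongrightarrow> 0" by (rule Lim_null_comparison[rotated]) (simp add: \<Xi>(2))
  have W: "(\<lambda>n. (x (Suc (Suc (R n))), x (Suc (R n)), y (Suc (R n)))) \<longlonglongrightarrow> (xs, xs, xs)"
    using LIMSEQ_ignore_initial_segment[OF lims'(1), of n0] LIMSEQ_ignore_initial_segment[OF lims'(2), of n0]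
      LIMSEQ_ignore_initial_segment[OF lims'(3), of n0]
    by (intro tendsto_Pair) (simp_all add: r'_def R_def)
  have "(\<lambda>n. merit T (Suc (R n))) \<longlonglongrightarrow> h"
    using LIMSEQ_subseq_LIMSEQ[OF LIMSEQ_Suc[OF h(2)] Rs] by (simp add: comp_def)
  then have HW: "(\<lambda>n. H (x (Suc (Suc (R n))), x (Suc (R n)), y (Suc (R n)))) \<longlonglongrightarrow> H (xs, xs, xs)"
    by (simp add: H_merit h(1))
  have "0 \<in> limiting_subdiff H (xs, xs, xs)"
    unfolding limiting_subdiff_def using W HW \<Xi>0 \<Xi>(1) h(1) by auto
  then show ?thesis by (auto simp: dom_subdiff_def)
qed

text \<open>The neighbourhood \<open>U\<close> lives in the product of three spaces. Because steps and extrapolation lengths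
  tend to 0, closeness of the single point \<open>x (Suc k)\<close> to \<open>xs\<close> is enough to enter it.\<close>

lemma KL_inequality_along_run:
  assumes r: "strict_mono r" and lim: "(x \<circ> r) \<longlonglongrightarrow> xs"
    and h: "H (xs, xs, xs) = ereal h"
    and des: "desingularizes H (xs, xs, xs) \<rho> U \<phi>"
  obtains N b \<delta> r0 where "0 < b" "0 < \<delta>" "0 < r0" "ereal r0 < \<rho>"
    "\<forall>k. N \<le> k \<and> norm (x (Suc k) - xs) < \<delta> \<and> h < merit T (Suc k) \<and> merit T (Suc k) < h + r0 \<longrightarrow>
      1 \<le> deriv \<phi> (merit T (Suc k) - h) * (b * (D k + D (Suc k)))"
proof -
  obtain N1 b \<delta>1 where b: "0 < b" "0 < \<delta>1"
    "\<forall>k. N1 \<le> k \<and> norm (x (Suc k) - xs) < \<delta>1 \<longrightarrow>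
      (\<exists>\<zeta> \<in> regular_subdiff H (x (Suc (Suc k)), x (Suc k), y (Suc k)). norm \<zeta> \<le> b * (D k + D (Suc k)))"
    by (rule regular_subgradient_H_small[OF r lim])
  have U: "open U" "(xs, xs, xs) \<in> U" and \<rho>: "0 < \<rho>"
    using des by (auto simp: desingularizes_def)
  obtain e where e: "0 < e" "ball (xs, xs, xs) e \<subseteq> U" using U openE by blast
  obtain r0 where r0: "0 < ereal r0" "ereal r0 < \<rho>" using ereal_dense2[OF \<rho>] by auto
  define \<delta> where "\<delta> = min \<delta>1 (e / 6)"
  have \<delta>: "0 < \<delta>" "\<delta> \<le> \<delta>1" "6 * \<delta> \<le> e" using b(2) e(1) by (auto simp: \<delta>_def)
  have "eventually (\<lambda>k. D k < \<delta>) sequentially" using D_tendsto \<delta>(1) by (rule order_tendstoD(2))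
  then obtain N2 where N2: "\<And>k. N2 \<le> k \<Longrightarrow> D k < \<delta>" unfolding eventually_sequentially by blast
  have "1 \<le> deriv \<phi> (merit T (Suc k) - h) * (b * (D k + D (Suc k)))"
    if k: "max N1 N2 \<le> k" and near: "norm (x (Suc k) - xs) < \<delta>"
      and gt: "h < merit T (Suc k)" and lt: "merit T (Suc k) < h + r0" for k
  proof -
    define w where "w = (x (Suc (Suc k)), x (Suc k), y (Suc k))"
    have dk: "D k < \<delta>" "D (Suc k) < \<delta>" using N2 k by auto
    have "norm (x (Suc (Suc k)) - xs) < 2 * \<delta>"
      using norm_triangle_ineq[of "x (Suc (Suc k)) - x (Suc k)" "x (Suc k) - xs"] dk near by (simp add: D_def)
    moreover have "norm (y (Suc k) - xs) < 2 * \<delta>"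
      using norm_triangle_ineq[of "y (Suc k) - x (Suc k)" "x (Suc k) - xs"] extrapolation_le[of k] dk near
      by (simp add: norm_minus_commute)
    moreover have "norm (w - (xs, xs, xs)) \<le> norm (x (Suc (Suc k)) - xs) + (norm (x (Suc k) - xs) + norm (y (Suc k) - xs))"
      unfolding w_def
      using norm_Pair_le[of "x (Suc (Suc k)) - xs" "(x (Suc k) - xs, y (Suc k) - xs)"]
        norm_Pair_le[of "x (Suc k) - xs" "y (Suc k) - xs"] by simp
    ultimately have "norm (w - (xs, xs, xs)) < e" using near \<delta> by linarith
    then have "w \<in> U" using e(2) by (auto simp: dist_norm norm_minus_commute)
    have Hw: "H w = ereal (merit T (Suc k))" unfolding w_def by (rule H_merit)
    have tr: "ereal (merit T (Suc k) - h) < \<rho>"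
    proof -
      have "ereal (merit T (Suc k) - h) < ereal r0" using lt by simp
      then show ?thesis using r0(2) by (rule less_trans)
    qed
    have "H (xs, xs, xs) < H w" using gt by (simp add: Hw h)
    moreover have "H w < H (xs, xs, xs) + \<rho>"
      using tr by (cases \<rho>) (auto simp: Hw h)
    ultimately have 1: "1 \<le> ereal (deriv \<phi> (real_of_ereal (H w - H (xs, xs, xs)))) * edist_set 0 (limiting_subdiff H w)"
      using des \<open>w \<in> U\<close> unfolding desingularizes_def by blast
    have \<phi>': "0 < deriv \<phi> (merit T (Suc k) - h)" using des gt tr by (simp add: desingularizes_def)
    obtain \<zeta> where \<zeta>: "\<zeta> \<in> regular_subdiff H w" "norm \<zeta> \<le> b * (D k + D (Suc k))"
      using b(3) k near \<delta>(2) unfolding w_def by (metis max.bounded_iff less_le_trans)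
    have "edist_set 0 (limiting_subdiff H w) \<le> ereal (dist 0 \<zeta>)"
      unfolding edist_set_def using \<zeta>(1) regular_subset_limiting by (intro INF_lower) auto
    also have "\<dots> \<le> ereal (b * (D k + D (Suc k)))" using \<zeta>(2) by simp
    finally have "ereal (deriv \<phi> (merit T (Suc k) - h)) * edist_set 0 (limiting_subdiff H w)
        \<le> ereal (deriv \<phi> (merit T (Suc k) - h)) * ereal (b * (D k + D (Suc k)))"
      using \<phi>' by (intro ereal_mult_left_mono) auto
    moreover have "1 \<le> ereal (deriv \<phi> (merit T (Suc k) - h)) * edist_set 0 (limiting_subdiff H w)"
      using 1 by (simp add: Hw h)
    ultimately have "1 \<le> ereal (deriv \<phi> (merit T (Suc k) - h)) * ereal (b * (D k + D (Suc k)))"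
      by (rule order_trans[rotated])
    then show ?thesis by (simp add: one_ereal_def)
  qed
  then show thesis using that[of b \<delta> r0 "max N1 N2"] b(1) \<delta>(1) r0 by auto
qed

section \<open>Convergence of a run\<close>

lemma KL_convergence_of_run:
  assumes r: "strict_mono r" and lim: "(x \<circ> r) \<longlonglongrightarrow> xs"
    and h: "H (xs, xs, xs) = ereal h" "merit T \<longlonglongrightarrow> h"
    and des: "desingularizes H (xs, xs, xs) \<rho> U \<phi>"
  obtains b where "0 < b" "x \<longlonglongrightarrow> xs"
    "eventually (\<lambda>k. norm (x (Suc k) - xs) \<le> D k + 2 * (b / c) * \<phi> (merit T (Suc k) - h)) sequentially"
    "eventually (\<lambda>k. h < merit T (Suc k) \<longrightarrow>
      1 \<le> deriv \<phi> (merit T (Suc k) - h) * (b * (D k + D (Suc k)))) sequentially"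
proof -
  obtain N b \<delta> r0 where b: "0 < b" "0 < \<delta>" "0 < r0" "ereal r0 < \<rho>" and
    KL: "\<forall>k. N \<le> k \<and> norm (x (Suc k) - xs) < \<delta> \<and> h < merit T (Suc k) \<and> merit T (Suc k) < h + r0 \<longrightarrow>
      1 \<le> deriv \<phi> (merit T (Suc k) - h) * (b * (D k + D (Suc k)))"
    by (rule KL_inequality_along_run[OF r lim h(1) des])
  obtain M where M: "\<forall>k\<ge>M. merit T (Suc k) \<le> merit T k - c * (D k)\<^sup>2" by (rule merit_T_tail)
  have below: "ereal t < \<rho>" if "t < r0" for t
  proof -
    have "ereal t < ereal r0" using that by simp
    then show ?thesis using b(4) by (rule less_trans)
  qed
  have des': "\<phi> 0 = 0" "\<And>t. 0 \<le> t \<Longrightarrow> t < r0 \<Longrightarrow> 0 \<le> \<phi> t" "continuous_on {0..<r0} \<phi>"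
    "\<And>s. 0 < s \<Longrightarrow> s < r0 \<Longrightarrow> 0 < deriv \<phi> s"
    using des below by (auto simp: desingularizes_def elim!: continuous_on_subset)
  note conv = KL_convergence[of D x c "max M N" "merit T" h r xs \<delta> r0 b \<phi> "deriv \<phi>",
      OF D_def c_pos _ h(2) r lim b(2,3,1) des'(1,2,3) _ des'(4)]
  have "x \<longlonglongrightarrow> xs" and est: "\<exists>K. \<forall>k\<ge>K. norm (x (Suc k) - xs) \<le> D k + 2 * (b / c) * \<phi> (merit T (Suc k) - h)"
    by (rule conv; use M KL desingularizes_tangent[OF des] below in auto)+
  have "eventually (\<lambda>k. dist (x (Suc k)) xs < \<delta>) sequentially"
    using LIMSEQ_Suc[OF \<open>x \<longlonglongrightarrow> xs\<close>] b(2) by (rule tendstoD)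
  moreover have "eventually (\<lambda>k. merit T (Suc k) < h + r0) sequentially"
    using LIMSEQ_Suc[OF h(2)] b(3) by (intro order_tendstoD(2)) auto
  ultimately have "eventually (\<lambda>k. h < merit T (Suc k) \<longrightarrow>
      1 \<le> deriv \<phi> (merit T (Suc k) - h) * (b * (D k + D (Suc k)))) sequentially"
    using eventually_ge_at_top[of N] by eventually_elim (use KL in \<open>auto simp: dist_norm\<close>)
  then show thesis using that[OF b(1) \<open>x \<longlonglongrightarrow> xs\<close>] est unfolding eventually_sequentially by blast
qed

text \<open>Once the whole sequence converges, the inequality with the power function holds for
  all large indices.\<close>

lemma KL_rates_of_run:
  assumes x: "x \<longlonglongrightarrow> xs" and KL: "KL_exponent_at H \<alpha> (xs, xs, xs)"
  shows "\<exists>M::nat.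
     (\<alpha> = 0 \<longrightarrow> (\<forall>k>M. x k = xs)) \<and>
     (0 < \<alpha> \<and> \<alpha> \<le> 1/2 \<longrightarrow>
        (\<exists>a0 a1. 0 < a0 \<and> a0 < 1 \<and> 0 < a1 \<and> (\<forall>k>M. norm (x k - xs) \<le> a1 * a0 ^ k))) \<and>
     (1/2 < \<alpha> \<longrightarrow>
        (\<exists>a2>0. \<forall>k>M. norm (x k - xs) \<le> a2 * real k powr (- ((1 - \<alpha>) / (2 * \<alpha> - 1)))))"
proof -
  have r: "strict_mono (id :: nat \<Rightarrow> nat)" and lim: "(x \<circ> id) \<longlonglongrightarrow> xs"
    using x by (auto simp: strict_mono_def)
  obtain h where h: "H (xs, xs, xs) = ereal h" "merit T \<longlonglongrightarrow> h" by (rule merit_limit[OF r lim])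
  obtain r1 U \<rho> where \<alpha>: "0 \<le> \<alpha>" "\<alpha> < 1" and \<rho>: "0 < \<rho>"
    and des: "desingularizes H (xs, xs, xs) r1 U (\<lambda>t. \<rho> * t powr (1 - \<alpha>))"
    using KL unfolding KL_exponent_at_def by auto
  obtain b where b: "0 < b" and
    ev: "eventually (\<lambda>k. norm (x (Suc k) - xs) \<le> D k + 2 * (b / c) * (\<rho> * (merit T (Suc k) - h) powr (1 - \<alpha>))) sequentially"
    "eventually (\<lambda>k. h < merit T (Suc k) \<longrightarrow>
      1 \<le> deriv (\<lambda>t. \<rho> * t powr (1 - \<alpha>)) (merit T (Suc k) - h) * (b * (D k + D (Suc k)))) sequentially"
    by (rule KL_convergence_of_run[OF r lim h des])
  obtain M where M: "\<forall>k\<ge>M. merit T (Suc k) \<le> merit T k - c * (D k)\<^sup>2" by (rule merit_T_tail)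
  obtain N where N: "\<And>k. N \<le> k \<Longrightarrow>
      norm (x (Suc k) - xs) \<le> D k + 2 * (b / c) * (\<rho> * (merit T (Suc k) - h) powr (1 - \<alpha>)) \<and>
      (h < merit T (Suc k) \<longrightarrow>
      1 \<le> deriv (\<lambda>t. \<rho> * t powr (1 - \<alpha>)) (merit T (Suc k) - h) * (b * (D k + D (Suc k))))"
    using eventually_conj[OF ev] unfolding eventually_sequentially by auto
  define u where "u k = merit T k - h" for k
  have ulim: "u \<longlonglongrightarrow> 0" using h(2) by (simp add: u_def[abs_def] LIM_zero)
  have desc: "u (Suc k) \<le> u k - c * (D k)\<^sup>2" if "max M N \<le> k" for k
    using M that by (simp add: u_def)
  have mono: "u (Suc k) \<le> u k" if "max M N \<le> k" for k
  proof -
    have "0 \<le> c * (D k)\<^sup>2" using c_pos by simp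
    then show ?thesis using desc[OF that] by linarith
  qed
  show ?thesis
  proof (rule KL_exponent_rates[OF \<alpha> c_pos _ _ D_nonneg _ ulim desc])
    show "0 < 2 * (b / c) * \<rho>" using b c_pos \<rho> by simp
    show "0 < \<rho> * (1 - \<alpha>) * b" using b \<alpha> \<rho> by simp
    show "0 \<le> u k" if "max M N \<le> k" for k
      by (rule limit_le_of_eventually_decreasing[OF mono ulim that])
    show "norm (x (Suc k) - xs) \<le> D k + 2 * (b / c) * \<rho> * u (Suc k) powr (1 - \<alpha>)" if "max M N \<le> k" for k
      using N[of k] that by (simp add: u_def mult.assoc)
    show "1 \<le> \<rho> * (1 - \<alpha>) * b * u (Suc k) powr (- \<alpha>) * (D k + D (Suc k))"
      if "max M N \<le> k" "0 < u (Suc k)" for k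
    proof -
      have "1 \<le> deriv (\<lambda>t. \<rho> * t powr (1 - \<alpha>)) (u (Suc k)) * (b * (D k + D (Suc k)))"
        using N[of k] that by (simp add: u_def)
      then show ?thesis unfolding deriv_power_desingularizer[OF that(2)] by (simp add: mult_ac)
    qed
  qed
qed

theorem run_converges:
  assumes KL: "KL_function H"
  shows "\<exists>xbar \<in> critical_points P1 P2 g C.
           x \<longlonglongrightarrow> xbar \<and>
           (xbar, xbar, xbar) \<in> accumulation_points (\<lambda>k. (x (Suc k), x k, y k))"
proof -
  have "\<forall>n. x n \<in> C" using x_in_C by simp
  then obtain xs r where r: "strict_mono r" "(x \<circ> r) \<longlonglongrightarrow> xs"
    using C_compact unfolding compact_def by meson
  have "KL_at H (xs, xs, xs)" using KL accumulation_in_dom[OF r] by (simp add: KL_function_def)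
  then obtain \<rho> U \<phi> where des: "desingularizes H (xs, xs, xs) \<rho> U \<phi>" by (auto simp: KL_at_def)
  obtain h where h: "H (xs, xs, xs) = ereal h" "merit T \<longlonglongrightarrow> h" by (rule merit_limit[OF r])
  have x: "x \<longlonglongrightarrow> xs" by (rule KL_convergence_of_run[OF r h des])
  have "((\<lambda>k. (x (Suc k), x k, y k)) \<circ> r) \<longlonglongrightarrow> (xs, xs, xs)"
    unfolding comp_def by (intro tendsto_Pair subsequence_limits[OF r])
  then show ?thesis
    using accumulation_critical[OF r] x r(1) by (auto simp: accumulation_points_def)
qed

end

theorem theorem4p4:
  fixes P P1 P2 :: "real ^ 'n \<Rightarrow> real"
    and g g1 g2 :: "'m::finite \<Rightarrow> real ^ 'n \<Rightarrow> real"
    and C :: "(real ^ 'n) set"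
    and L l :: "'m \<Rightarrow> real" and Lg lg d \<theta>hat :: real
    and \<beta> s \<theta> :: "nat \<Rightarrow> real"
    and x y \<xi> :: "nat \<Rightarrow> real ^ 'n"
    and H :: "(real ^ 'n) \<times> (real ^ 'n) \<times> (real ^ 'n) \<Rightarrow> ereal"
    and \<Omega> :: "((real ^ 'n) \<times> (real ^ 'n) \<times> (real ^ 'n)) set"
  assumes "convex_on UNIV P1" and "convex_on UNIV P2"
    and "P = (\<lambda>u. P1 u - P2 u)"
    and "\<And>i. \<exists>K. lipschitz_gradient K (g i)"
    and "C \<noteq> {}" and "compact C" and "convex C"
    and "C \<inter> feasible g \<noteq> {}"
    and "\<And>i. g i = (\<lambda>u. g1 i u - g2 i u)"
    and "\<And>i. convex_on UNIV (g1 i)" and "\<And>i. convex_on UNIV (g2 i)"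
    and "\<And>i. lipschitz_gradient (L i) (g1 i)" and "\<And>i. lipschitz_gradient (l i) (g2 i)"
    and "\<And>i. 0 < L i" and "\<And>i. 0 \<le> l i" and "\<And>i. l i \<le> L i"
    and "Lg = (MAX i. L i)" and "lg = (MAX i. l i)"
    and "assumption_A g C"
    and "assumption_B P1 P2 g C"
    and "ESQMe P1 P2 g C Lg lg d \<beta> x y \<xi> s \<theta>"
    and "\<theta>hat = eventual_value \<theta>"
    and "H = potential_H P g C Lg \<theta>hat"
    and "KL_function H"
    and "\<Omega> = accumulation_points (\<lambda>k. (x (Suc k), x k, y k))"
  shows "\<exists>xbar \<in> critical_points P1 P2 g C.
           x \<longlonglongrightarrow> xbar \<and>
           (\<forall>\<alpha>. 0 \<le> \<alpha> \<and> \<alpha> < 1 \<and> (\<forall>w\<in>\<Omega>. KL_exponent_at H \<alpha> w) \<longrightarrow>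
              (\<exists>N::nat.
                 (\<alpha> = 0 \<longrightarrow> (\<forall>k>N. x k = xbar)) \<and>
                 (0 < \<alpha> \<and> \<alpha> \<le> 1/2 \<longrightarrow>
                    (\<exists>a0 a1. 0 < a0 \<and> a0 < 1 \<and> 0 < a1 \<and>
                       (\<forall>k>N. norm (x k - xbar) \<le> a1 * a0 ^ k))) \<and>
                 (1/2 < \<alpha> \<longrightarrow>
                    (\<exists>a2>0. \<forall>k>N. norm (x k - xbar)
                                \<le> a2 * real k powr (- ((1 - \<alpha>) / (2 * \<alpha> - 1)))))))"
proof -
  interpret run: ESQMe_run P P1 P2 g g1 g2 C L l Lg lg d \<beta> s \<theta> x y \<xi>
    by (rule ESQMe_run.intro) (rule assms)+
  have H: "H = run.H" unfolding assms(23) assms(22) run.H_def run.T_def ..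
  obtain xbar where xbar: "xbar \<in> critical_points P1 P2 g C" "x \<longlonglongrightarrow> xbar" "(xbar, xbar, xbar) \<in> \<Omega>"
    using run.run_converges[OF assms(24)[unfolded H]] assms(25) by blast
  show ?thesis
  proof (intro bexI[OF _ xbar(1)] conjI allI impI)
    show "x \<longlonglongrightarrow> xbar" by (rule xbar(2))
    fix \<alpha> :: real
    assume "0 \<le> \<alpha> \<and> \<alpha> < 1 \<and> (\<forall>w\<in>\<Omega>. KL_exponent_at H \<alpha> w)"
    then have "KL_exponent_at run.H \<alpha> (xbar, xbar, xbar)" using xbar(3) H by simp
    from run.KL_rates_of_run[OF xbar(2) this]
    show "\<exists>N::nat.
                 (\<alpha> = 0 \<longrightarrow> (\<forall>k>N. x k = xbar)) \<and>
                 (0 < \<alpha> \<and> \<alpha> \<le> 1/2 \<longrightarrow>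
                    (\<exists>a0 a1. 0 < a0 \<and> a0 < 1 \<and> 0 < a1 \<and>
                       (\<forall>k>N. norm (x k - xbar) \<le> a1 * a0 ^ k))) \<and>
                 (1/2 < \<alpha> \<longrightarrow>
                    (\<exists>a2>0. \<forall>k>N. norm (x k - xbar)
                                \<le> a2 * real k powr (- ((1 - \<alpha>) / (2 * \<alpha> - 1)))))" .
  qed
qed

end
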